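(* Let $k\ge 2$ be an integer and let $n$ be sufficiently large (depending on $k$). Then $$\mathrm{ex}_4(n,W_{2k+2})=e(T_{n,3})-\left(n-\left\lceil\frac{n}{3}\right\rceil\right)+2=e(T_{n-1,3})+2$$ and $$\mathrm{Ex}_4(n,W_{2k+2})=\mathscr{G}(n)$$ (as families of graphs up to isomorphism).
   Context: All graphs are finite, undirected and simple; $e(G)$ is the number of edges of $G$. The wheel $W_t$ of order $t\ge 4$ is obtained from the cycle $C_{t-1}$ by adding a new vertex adjacent to every vertex of the cycle. A graph is $H$-free if it has no subgraph (not necessarily induced) isomorphic to $H$. A graph is $3$-partite if its vertex set can be partitioned into 3 nonempty parts with no edge inside a part, and non-$3$-partite otherwise. $T_{n,r}$ is the Turán graph: the complete $r$-partite graph of order $n$ with part sizes as equal as possible. $\mathrm{ex}_4(n,W_{2k+2})$ is the maximum number of edges of a non-$3$-partite $W_{2k+2}$-free graph of order $n$, and $\mathrm{Ex}_4(n,W_{2k+2})$ is the family of all non-$3$-partite $W_{2k+2}$-free graphs of order $n$ attaining this maximum. The family $\mathscr{G}(n)$: Let $K_{|V_1|,|V_2|,|V_3|}$ be the complete $3$-partite graph on $n$ vertices with partite sets $V_1,V_2,V_3$, where $|V_1|=\lceil\frac{n-1}{3}\rceil+1$ or $|V_1|=\lfloor\frac{n-1}{3}\rfloor+1$, and $\big||V_2|-|V_3|\big|\le 1$. Let $H$ be obtained from it by adding an edge $uv$, where $u,v$ are two distinct vertices of $V_1$. Let $V_2^*\subset V_2$ with $1\le |V_2^*|\le |V_2|-1$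 and let $w\in V_3$. Let $G^*(n,|V_2^*|)$ be the graph obtained from $H$ by deleting all edges between $V_2\setminus V_2^*$ and $v$, all edges between $V_3\setminus\{w\}$ and $u$, and all edges between $V_2^*$ and $w$. Then $\mathscr{G}(n)=\{G^*(n,|V_2^*|):1\le |V_2^*|\le |V_2|-1\}$, ranging over all admissible choices of $|V_1|,|V_2|,|V_3|$ as well. *)

theory Defs
  imports Complex_Main "HOL-Library.Disjoint_Sets"
begin

text \<open>A graph is a pair of a vertex set and a set of edges, each edge being a two-element set of
  vertices.\<close>

type_synonym 'a ugraph = "'a set \<times> 'a set set"

abbreviation verts :: "'a ugraph \<Rightarrow> 'a set" where
  "verts \<equiv> fst"

abbreviation edges :: "'a ugraph \<Rightarrow> 'a set set" where
  "edges \<equiv> snd"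

definition simple_graph :: "'a ugraph \<Rightarrow> bool" where
  "simple_graph G \<longleftrightarrow> finite (verts G) \<and> (\<forall>e\<in>edges G. e \<subseteq> verts G \<and> card e = 2)"

definition num_edges :: "'a ugraph \<Rightarrow> nat" where
  "num_edges G = card (edges G)"

definition graph_iso :: "'a ugraph \<Rightarrow> 'b ugraph \<Rightarrow> bool" where
  "graph_iso G H \<longleftrightarrow>
     (\<exists>f. bij_betw f (verts G) (verts H) \<and> edges H = (\<lambda>e. f ` e) ` edges G)"

definition is_subgraph :: "'a ugraph \<Rightarrow> 'a ugraph \<Rightarrow> bool" where
  "is_subgraph S G \<longleftrightarrow> simple_graph S \<and> verts S \<subseteq> verts G \<and> edges S \<subseteq> edges G"

definition free_of :: "'b ugraph \<Rightarrow> 'a ugraph \<Rightarrow> bool" where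
  "free_of H G \<longleftrightarrow> \<not> (\<exists>S. is_subgraph S G \<and> graph_iso S H)"

text \<open>The members of a \<open>partition_on\<close> are nonempty and pairwise disjoint.\<close>

definition r_partite :: "nat \<Rightarrow> 'a ugraph \<Rightarrow> bool" where
  "r_partite r G \<longleftrightarrow>
     (\<exists>P. partition_on (verts G) P \<and> finite P \<and> card P = r \<and>
          (\<forall>A\<in>P. \<forall>e\<in>edges G. \<not> e \<subseteq> A))"

definition cycle_graph :: "nat \<Rightarrow> nat ugraph" where
  "cycle_graph m = ({..<m}, {{i, (i + 1) mod m} | i. i < m})"

text \<open>The wheel of order \<open>t\<close> (meant for \<open>t \<ge> 4\<close>): the vertices below \<open>t - 1\<close> form the rim, and
  \<open>t - 1\<close> is the hub.\<close>

definition wheel :: "nat \<Rightarrow> nat ugraph" where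
  "wheel t =
     (insert (t - 1) (verts (cycle_graph (t - 1))),
      edges (cycle_graph (t - 1)) \<union> {{x, t - 1} | x. x \<in> verts (cycle_graph (t - 1))})"

text \<open>The parts of the Turan graph are taken to be the residue classes modulo \<open>r\<close> in
  \<open>{..<n}\<close>, whose sizes differ by at most one.\<close>

definition turan_graph :: "nat \<Rightarrow> nat \<Rightarrow> nat ugraph" where
  "turan_graph n r = ({..<n}, {{x, y} | x y. x < n \<and> y < n \<and> x mod r \<noteq> y mod r})"

text \<open>Graphs of order \<open>n\<close> are represented with vertices in \<open>nat\<close>; every finite graph has an
  isomorphic copy of this kind.\<close>

definition nonpartite_free_graphs :: "nat \<Rightarrow> nat \<Rightarrow> 'b ugraph \<Rightarrow> nat ugraph set" where
  "nonpartite_free_graphs r n H =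
     {G. simple_graph G \<and> card (verts G) = n \<and> \<not> r_partite r G \<and> free_of H G}"

definition ex4 :: "nat \<Rightarrow> 'b ugraph \<Rightarrow> nat" where
  "ex4 n H = Max (num_edges ` nonpartite_free_graphs 3 n H)"

definition Ex4 :: "nat \<Rightarrow> 'b ugraph \<Rightarrow> nat ugraph set" where
  "Ex4 n H = {G \<in> nonpartite_free_graphs 3 n H. num_edges G = ex4 n H}"

text \<open>The maximum in \<open>ex4\<close> ranges over a finite set.\<close>

lemma finite_num_edges_nonpartite_free_graphs:
  "finite (num_edges ` nonpartite_free_graphs r n H)"
proof (rule finite_subset)
  show "num_edges ` nonpartite_free_graphs r n H \<subseteq> {..2 ^ n}"
  proof clarsimp
    fix V :: "nat set" and E assume "(V, E) \<in> nonpartite_free_graphs r n H"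
    then have V: "finite V" "card V = n" and E: "E \<subseteq> Pow V"
      by (auto simp: nonpartite_free_graphs_def simple_graph_def)
    have "card E \<le> card (Pow V)"
      using V E by (intro card_mono) auto
    then show "num_edges (V, E) \<le> 2 ^ n"
      using V by (simp add: num_edges_def card_Pow)
  qed
qed simp

definition edges_between :: "'a set \<Rightarrow> 'a set \<Rightarrow> 'a set set" where
  "edges_between A B = {{x, y} | x y. x \<in> A \<and> y \<in> B}"

definition complete_tripartite :: "'a set \<Rightarrow> 'a set \<Rightarrow> 'a set \<Rightarrow> 'a ugraph" where
  "complete_tripartite V1 V2 V3 =
     (V1 \<union> V2 \<union> V3, edges_between V1 V2 \<union> edges_between V1 V3 \<union> edges_between V2 V3)"

text \<open>\<open>S\<close> plays the role of \<open>V\<^sub>2\<^sup>*\<close>.\<close>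

definition Gstar ::
  "'a set \<Rightarrow> 'a set \<Rightarrow> 'a set \<Rightarrow> 'a \<Rightarrow> 'a \<Rightarrow> 'a \<Rightarrow> 'a set \<Rightarrow> 'a ugraph" where
  "Gstar V1 V2 V3 u v w S =
     (V1 \<union> V2 \<union> V3,
      insert {u, v} (edges (complete_tripartite V1 V2 V3))
        - (edges_between (V2 - S) {v} \<union> edges_between (V3 - {w}) {u} \<union> edges_between S {w}))"

definition G_family :: "nat \<Rightarrow> nat ugraph set" where
  "G_family n =
     {Gstar V1 V2 V3 u v w S | V1 V2 V3 u v w S.
        finite V1 \<and> finite V2 \<and> finite V3 \<and>
        V1 \<inter> V2 = {} \<and> V1 \<inter> V3 = {} \<and> V2 \<inter> V3 = {} \<and>
        card V1 + card V2 + card V3 = n \<and>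
        (int (card V1) = \<lceil>(real n - 1) / 3\<rceil> + 1 \<or> int (card V1) = \<lfloor>(real n - 1) / 3\<rfloor> + 1) \<and>
        \<bar>int (card V2) - int (card V3)\<bar> \<le> 1 \<and>
        u \<in> V1 \<and> v \<in> V1 \<and> u \<noteq> v \<and> w \<in> V3 \<and>
        S \<subseteq> V2 \<and> 1 \<le> card S \<and> card S \<le> card V2 - 1}"

definition same_up_to_iso :: "'a ugraph set \<Rightarrow> 'b ugraph set \<Rightarrow> bool" where
  "same_up_to_iso \<A> \<B> \<longleftrightarrow>
     (\<forall>G\<in>\<A>. \<exists>H\<in>\<B>. graph_iso G H) \<and> (\<forall>H\<in>\<B>. \<exists>G\<in>\<A>. graph_iso G H)"

end

(* Let n be large and let G be a non-3-partite W_{2k+2}-free graph with at least e(T_{n-1,3}) + 2 edges.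

   Removing copies of K_{t,t,t} one after the other shows that every W_{2k+2}-free graph on m vertices
   has at most m^2/3 + O(1) edges. Applied to G minus a bounded set U this bounds the degree sum of U
   from below by (|U| - 1) 2n/3 - O(1). Hence almost every vertex of G is joined to almost all of two parts
   of a large K_{t,t,t}, and V(G) splits into three independent, nearly completely joined classes
   and a small exceptional set X.

   As G is not 3-colourable, some vertices of X cannot be placed in the classes. Wheels are so easy to
   find that one of three obstructions occurs: a single vertex, an edge both of whose ends have
   to go to the same class, or a path v u w where v and w block the two classes available to u. In each case
   the degrees of the at most three vertices involved are as small as the degree sum bound permits, so
   all other vertices have nearly full degree and can be put into the classes. Once X consists of the
   obstruction only, an injection from the vertices of two classes into the missing cross edges
   gives e(G) <= e(T_{n-1,3}) + 2, and equality forces the graph G^*. *)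

theory Submission
  imports Defs
begin

section \<open>Alternating paths and wheels\<close>

text \<open>The threshold is that of order n - 1, so the total degree deficiency is about 2n/3, the
  degree of one vertex; it may sit in one vertex or be shared by several. Hence no minimum degree
  condition is available, only the degree sum bound with its |U| - 1, and it is the degree sum of a
  whole obstruction that has to be small.

  Apart from at most three vertices, the rim of every wheel that is found runs alternately between
  two nearly completely joined sets. Such a path alone closes to an even cycle; one, two or three
  consecutive further vertices, with the ends of the path on suitable sides, give the odd length 2k
  + 1. These are the three shapes of forbidden wheels.

  The final count rests on e(K_{a+1,b,c}) = e(K_{a,b,c}) + b + c with a + b + c = n - 1: if b + c -
  1 cross edges are missing and a single edge lies inside the first class, at most e(T_{n-1,3}) + 2
  edges remain.

  Each reduction of X multiplies the error by 20, and at most four reductions occur, whence the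
  constant 160000.\<close>

locale symmetric_relation =
  fixes adj :: "'a \<Rightarrow> 'a \<Rightarrow> bool"
  assumes adj_sym: "adj x y \<Longrightarrow> adj y x" and adj_irrefl: "\<not> adj x x"
begin

lemma adj_commute: "adj x y \<longleftrightarrow> adj y x"
  using adj_sym by blast

definition nbrs :: "'a \<Rightarrow> 'a set \<Rightarrow> 'a set" where
  "nbrs x A = {y\<in>A. adj x y}"

lemma mem_nbrs [simp]: "y \<in> nbrs x A \<longleftrightarrow> y \<in> A \<and> adj x y"
  by (simp add: nbrs_def)

lemma finite_nbrs [simp]: "finite A \<Longrightarrow> finite (nbrs x A)"
  by (simp add: nbrs_def)

lemma nbrs_subset: "nbrs x A \<subseteq> A"
  by auto

lemma nbrs_mono: "A \<subseteq> B \<Longrightarrow> nbrs x A \<subseteq> nbrs x B"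
  by auto

lemma card_nbrs_mono: "A \<subseteq> B \<Longrightarrow> finite B \<Longrightarrow> card (nbrs x A) \<le> card (nbrs x B)"
  by (intro card_mono nbrs_mono) auto

lemma card_nbrs_le: "finite A \<Longrightarrow> card (nbrs x A) \<le> card A"
  by (intro card_mono) auto

lemma nbrs_Un: "nbrs x (A \<union> B) = nbrs x A \<union> nbrs x B"
  by auto

text \<open>Induction on \<open>j\<close>, extending at the front: \<open>p\<close> and another
  vertex \<open>p2\<close> of \<open>P\<close> are joined through a common neighbour
  \<open>q\<close>, and the rest is found in \<open>P - {p}\<close> and \<open>Q - {q}\<close>.
  Deleting \<open>q\<close> lowers every number of common neighbours by at most one, so the bound
  \<open>j\<close> can shrink along with the path.\<close>

lemma odd_alternating_path:
  assumes "1 \<le> j" "finite P" "finite Q" "P \<inter> Q = {}"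
    and "\<And>p p'. p \<in> P \<Longrightarrow> p' \<in> P \<Longrightarrow> j \<le> card (nbrs p Q \<inter> nbrs p' Q)"
    and "j + 1 \<le> card P" "p \<in> P" "p' \<in> P" "p \<noteq> p'"
  shows "\<exists>xs. distinct xs \<and> length xs = 2 * j + 1 \<and> hd xs = p \<and> last xs = p' \<and>
     set xs \<subseteq> P \<union> Q \<and> successively adj xs"
  using assms
proof (induction j arbitrary: P Q p rule: nat_induct_at_least)
  case base
  have "1 \<le> card (nbrs p Q \<inter> nbrs p' Q)"
    using base.prems(4)[of p p'] base.prems(6,7) by simp
  then have "nbrs p Q \<inter> nbrs p' Q \<noteq> {}"
    by (metis card.empty not_one_le_zero)
  then obtain q where "q \<in> Q" "adj p q" "adj p' q"
    by auto
  then show ?case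
    using base by (intro exI[of _ "[p, q, p']"]) (auto simp: adj_commute)
next
  case (Suc j)
  have "card (P - {p, p'}) > 0"
    using Suc.prems Suc.hyps by (simp add: card_Diff_subset)
  then obtain p2 where p2: "p2 \<in> P" "p2 \<noteq> p" "p2 \<noteq> p'"
    by (metis DiffD1 DiffD2 card_gt_0_iff ex_in_conv insertCI)
  have "Suc j \<le> card (nbrs p Q \<inter> nbrs p2 Q)"
    using Suc.prems(4)[of p p2] Suc.prems(6) p2 by simp
  then have "nbrs p Q \<inter> nbrs p2 Q \<noteq> {}"
    by (metis card.empty Suc_le_D nat.distinct(1))
  then obtain q where q: "q \<in> Q" "adj p q" "adj p2 q"
    by auto
  have common: "j \<le> card (nbrs a (Q - {q}) \<inter> nbrs b (Q - {q}))" if "a \<in> P - {p}" "b \<in> P - {p}" for a b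
  proof -
    have "Suc j \<le> card (nbrs a Q \<inter> nbrs b Q)"
      using Suc.prems(4)[of a b] that by simp
    also have "nbrs a Q \<inter> nbrs b Q \<subseteq> insert q (nbrs a (Q - {q}) \<inter> nbrs b (Q - {q}))"
      by auto
    then have "card (nbrs a Q \<inter> nbrs b Q) \<le> card (insert q (nbrs a (Q - {q}) \<inter> nbrs b (Q - {q})))"
      using Suc.prems by (intro card_mono) auto
    also have "\<dots> \<le> Suc (card (nbrs a (Q - {q}) \<inter> nbrs b (Q - {q})))"
      by (simp add: card_insert_if Suc.prems)
    finally show ?thesis by simp
  qed
  have "\<exists>xs. distinct xs \<and> length xs = 2 * j + 1 \<and> hd xs = p2 \<and> last xs = p' \<and>
     set xs \<subseteq> (P - {p}) \<union> (Q - {q}) \<and> successively adj xs"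
  proof (rule Suc.IH)
    show "j + 1 \<le> card (P - {p})"
      using Suc.prems by simp
  qed (use Suc.prems p2 common in auto)
  then obtain xs where xs: "distinct xs" "length xs = 2 * j + 1" "hd xs = p2" "last xs = p'"
     "set xs \<subseteq> (P - {p}) \<union> (Q - {q})" "successively adj xs"
    by blast
  then have "xs \<noteq> []" by auto
  then show ?case
    using xs Suc.prems q by (intro exI[of _ "p # q # xs"]) (auto simp: successively_Cons adj_commute)
qed

text \<open>With \<open>q\<close> removed from \<open>Q\<close>, an odd path from \<open>p\<close>
  to the prescribed predecessor \<open>p'\<close> of \<open>q\<close> is extended by
  \<open>q\<close>. For \<open>j = 1\<close> the path is the single edge \<open>p q\<close>, hence
  the last hypothesis.\<close>

lemma even_alternating_path:
  assumes "1 \<le> j" "finite P" "finite Q" "P \<inter> Q = {}"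
    and common: "\<And>p p'. p \<in> P \<Longrightarrow> p' \<in> P \<Longrightarrow> j \<le> card (nbrs p Q \<inter> nbrs p' Q)"
    and "j \<le> card P" "p \<in> P" "q \<in> Q" "p' \<in> P" "p' \<noteq> p" "adj q p'"
    and "j = 1 \<Longrightarrow> adj p q"
  shows "\<exists>xs. distinct xs \<and> length xs = 2 * j \<and> hd xs = p \<and> last xs = q \<and>
     set xs \<subseteq> P \<union> Q \<and> successively adj xs"
proof (cases "j = 1")
  case True
  then show ?thesis
    using assms by (intro exI[of _ "[p, q]"]) auto
next
  case False
  then obtain i where i: "j = Suc i" "1 \<le> i"
    using assms(1) by (cases j) auto
  have "i \<le> card (nbrs a (Q - {q}) \<inter> nbrs b (Q - {q}))" if "a \<in> P" "b \<in> P" for a b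
  proof -
    have "Suc i \<le> card (nbrs a Q \<inter> nbrs b Q)"
      using common[of a b] that i by simp
    also have "nbrs a Q \<inter> nbrs b Q \<subseteq> insert q (nbrs a (Q - {q}) \<inter> nbrs b (Q - {q}))"
      by auto
    then have "card (nbrs a Q \<inter> nbrs b Q) \<le> card (insert q (nbrs a (Q - {q}) \<inter> nbrs b (Q - {q})))"
      using assms by (intro card_mono) auto
    also have "\<dots> \<le> Suc (card (nbrs a (Q - {q}) \<inter> nbrs b (Q - {q})))"
      by (simp add: card_insert_if assms)
    finally show ?thesis by simp
  qed
  then have "\<exists>xs. distinct xs \<and> length xs = 2 * i + 1 \<and> hd xs = p \<and> last xs = p' \<and>
     set xs \<subseteq> P \<union> (Q - {q}) \<and> successively adj xs"
    using assms i by (intro odd_alternating_path) auto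
  then obtain xs where xs: "distinct xs" "length xs = 2 * i + 1" "hd xs = p" "last xs = p'"
     "set xs \<subseteq> P \<union> (Q - {q})" "successively adj xs"
    by blast
  then have "xs \<noteq> []" by auto
  then show ?thesis
    using xs assms i by (intro exI[of _ "xs @ [q]"]) (auto simp: successively_append_iff adj_commute)
qed

end

text \<open>A wheel is given by its rim, listed in cyclic order, and its hub \<open>h\<close>;
  irreflexivity keeps \<open>h\<close> off the rim.\<close>

locale wheel_free = symmetric_relation +
  fixes k :: nat
  assumes k_ge_2: "2 \<le> k"
    and no_wheel: "\<lbrakk>distinct xs; length xs = 2 * k + 1; successively adj xs; adj (last xs) (hd xs);
       \<And>x. x \<in> set xs \<Longrightarrow> adj h x\<rbrakk> \<Longrightarrow> False"
begin

text \<open>The rim is \<open>x\<close> followed by an alternating path on \<open>2 * k\<close>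
  vertices from \<open>b\<close> to \<open>c\<close>; the vertex \<open>p'\<close> precedes
  \<open>c\<close> on this path.\<close>

lemma no_wheel_one:
  assumes "finite P" "finite Q" "P \<inter> Q = {}" "x \<notin> P" "x \<notin> Q"
    and "\<And>p p'. p \<in> P \<Longrightarrow> p' \<in> P \<Longrightarrow> k \<le> card (nbrs p Q \<inter> nbrs p' Q)"
    and "k \<le> card P" "b \<in> P" "c \<in> Q" "p' \<in> P" "p' \<noteq> b" "adj c p'"
    and "adj x b" "adj x c" "adj h x" "\<And>y. y \<in> P \<union> Q \<Longrightarrow> adj h y"
  shows False
proof -
  have "\<exists>xs. distinct xs \<and> length xs = 2 * k \<and> hd xs = b \<and> last xs = c \<and>
     set xs \<subseteq> P \<union> Q \<and> successively adj xs"
    using assms k_ge_2 by (intro even_alternating_path[where p' = p']) auto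
  then obtain xs where xs: "distinct xs" "length xs = 2 * k" "hd xs = b" "last xs = c"
     "set xs \<subseteq> P \<union> Q" "successively adj xs"
    by blast
  then have "xs \<noteq> []"
    using k_ge_2 by auto
  show False
    by (rule no_wheel[of "x # xs" h])
       (use xs \<open>xs \<noteq> []\<close> assms in \<open>auto simp: successively_Cons adj_commute\<close>)
qed

text \<open>The rim is \<open>y\<close>, \<open>x\<close> followed by an alternating path on
  \<open>2 * k - 1\<close> vertices, whose ends \<open>b\<close> and \<open>c\<close> therefore lie
  on the same side.\<close>

lemma no_wheel_two:
  assumes "finite P" "finite Q" "P \<inter> Q = {}" "x \<notin> P" "x \<notin> Q" "y \<notin> P" "y \<notin> Q"
    and common: "\<And>p p'. p \<in> P \<Longrightarrow> p' \<in> P \<Longrightarrow> k - 1 \<le> card (nbrs p Q \<inter> nbrs p' Q)"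
    and "k \<le> card P" "b \<in> P" "c \<in> P" "b \<noteq> c"
    and "adj x y" "adj x b" "adj y c" "adj h x" "adj h y" "\<And>y. y \<in> P \<union> Q \<Longrightarrow> adj h y"
  shows False
proof -
  have "\<exists>xs. distinct xs \<and> length xs = 2 * (k - 1) + 1 \<and> hd xs = b \<and> last xs = c \<and>
     set xs \<subseteq> P \<union> Q \<and> successively adj xs"
    using assms k_ge_2 by (intro odd_alternating_path) auto
  then obtain xs where xs: "distinct xs" "length xs = 2 * (k - 1) + 1" "hd xs = b" "last xs = c"
     "set xs \<subseteq> P \<union> Q" "successively adj xs"
    by blast
  then have "xs \<noteq> []"
    using k_ge_2 by auto
  have "x \<noteq> y"
    using assms(13) adj_irrefl by blast
  show False
  proof (rule no_wheel[of "y # x # xs" h])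
    show "length (y # x # xs) = 2 * k + 1"
      using xs k_ge_2 by simp
  qed (use xs \<open>xs \<noteq> []\<close> \<open>x \<noteq> y\<close> assms in \<open>auto simp: successively_Cons adj_commute\<close>)
qed

text \<open>The rim is \<open>w\<close>, \<open>u\<close>, \<open>v\<close> followed by an
  alternating path on \<open>2 * k - 2\<close> vertices from \<open>c\<close> to \<open>a\<close>,
  on opposite sides. For \<open>k = 2\<close> that path is just the edge \<open>c a\<close>, which
  is why \<open>adj c a\<close> is assumed.\<close>

lemma no_wheel_three:
  assumes "finite P" "finite Q" "P \<inter> Q = {}" "{u, v, w} \<inter> (P \<union> Q) = {}" "v \<noteq> w"
    and common: "\<And>p p'. p \<in> P \<Longrightarrow> p' \<in> P \<Longrightarrow> k \<le> card (nbrs p Q \<inter> nbrs p' Q)"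
    and "k \<le> card P" "c \<in> P" "a \<in> Q" "p' \<in> P" "p' \<noteq> c" "adj a p'" "adj c a"
    and "adj u v" "adj u w" "adj v c" "adj w a" "adj h u" "adj h v" "adj h w"
    and "\<And>y. y \<in> P \<union> Q \<Longrightarrow> adj h y"
  shows False
proof -
  have "\<exists>xs. distinct xs \<and> length xs = 2 * (k - 1) \<and> hd xs = c \<and> last xs = a \<and>
     set xs \<subseteq> P \<union> Q \<and> successively adj xs"
  proof (rule even_alternating_path[where p' = p'])
    show "k - 1 \<le> card (nbrs p Q \<inter> nbrs p' Q)" if "p \<in> P" "p' \<in> P" for p p'
      using common[OF that] by simp
  qed (use assms k_ge_2 in auto)
  then obtain xs where xs: "distinct xs" "length xs = 2 * (k - 1)" "hd xs = c" "last xs = a"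
     "set xs \<subseteq> P \<union> Q" "successively adj xs"
    by blast
  then have "xs \<noteq> []"
    using k_ge_2 by auto
  have "u \<noteq> v" "u \<noteq> w"
    using assms(14,15) adj_irrefl by blast+
  show False
  proof (rule no_wheel[of "w # u # v # xs" h])
    show "length (w # u # v # xs) = 2 * k + 1"
      using xs k_ge_2 by simp
  qed (use xs \<open>xs \<noteq> []\<close> \<open>u \<noteq> v\<close> \<open>u \<noteq> w\<close> assms in \<open>auto simp: successively_Cons adj_commute\<close>)
qed

end

section \<open>Complete tripartite subgraphs of dense graphs\<close>

context symmetric_relation
begin

text \<open>This counts ordered adjacent pairs, so \<open>deg_sum V V\<close> is twice the number of
  edges and double counting becomes symmetry in \<open>A\<close> and \<open>B\<close>.\<close>

definition deg_sum :: "'a set \<Rightarrow> 'a set \<Rightarrow> nat" where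
  "deg_sum A B = (\<Sum>x\<in>A. card (nbrs x B))"

lemma card_nbrs_eq_sum: "finite B \<Longrightarrow> card (nbrs x B) = (\<Sum>y\<in>B. of_bool (adj x y))"
  by (simp add: nbrs_def of_bool_def sum.inter_filter[symmetric])

lemma deg_sum_commute:
  assumes "finite A" "finite B"
  shows "deg_sum A B = deg_sum B A"
proof -
  have "deg_sum A B = (\<Sum>x\<in>A. \<Sum>y\<in>B. of_bool (adj x y))"
    by (simp add: deg_sum_def card_nbrs_eq_sum assms)
  also have "\<dots> = (\<Sum>y\<in>B. \<Sum>x\<in>A. of_bool (adj x y))"
    by (rule sum.swap)
  also have "\<dots> = (\<Sum>y\<in>B. \<Sum>x\<in>A. of_bool (adj y x))"
    by (intro sum.cong refl arg_cong[where f = of_bool] adj_commute)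
  also have "\<dots> = deg_sum B A"
    by (simp add: deg_sum_def card_nbrs_eq_sum assms)
  finally show ?thesis .
qed

lemma deg_sum_Un_left:
  "finite A \<Longrightarrow> finite B \<Longrightarrow> A \<inter> B = {} \<Longrightarrow> deg_sum (A \<union> B) C = deg_sum A C + deg_sum B C"
  by (simp add: deg_sum_def sum.union_disjoint)

lemma deg_sum_Un_right:
  assumes "finite A" "finite B" "finite C" "A \<inter> B = {}"
  shows "deg_sum C (A \<union> B) = deg_sum C A + deg_sum C B"
  using assms by (simp add: deg_sum_commute[of C] deg_sum_Un_left)

text \<open>The pairs inside \<open>X\<close> occur twice in \<open>2 * deg_sum X W\<close>; they
  are balanced on the left to avoid subtraction of natural numbers.\<close>

lemma deg_sum_split:
  assumes "finite W" "X \<subseteq> W"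
  shows "deg_sum W W + deg_sum X X = deg_sum (W - X) (W - X) + 2 * deg_sum X W"
proof -
  have fin: "finite X" "finite (W - X)"
    using assms finite_subset by auto
  have W: "W = X \<union> (W - X)" "X \<inter> (W - X) = {}"
    using assms by auto
  have "deg_sum W W = deg_sum X W + deg_sum (W - X) W"
    using deg_sum_Un_left[OF fin W(2), of W] W(1) by simp
  moreover have "deg_sum (W - X) W = deg_sum (W - X) X + deg_sum (W - X) (W - X)"
    using deg_sum_Un_right[OF fin fin(2) W(2)] W(1) by simp
  moreover have "deg_sum X W = deg_sum X X + deg_sum X (W - X)"
    using deg_sum_Un_right[OF fin fin(1) W(2)] W(1) by simp
  moreover have "deg_sum (W - X) X = deg_sum X (W - X)"
    using fin by (rule deg_sum_commute[rotated])
  ultimately show ?thesis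
    by simp
qed

lemma deg_sum_le: "finite B \<Longrightarrow> (\<And>x. x \<in> A \<Longrightarrow> card (nbrs x B) \<le> c) \<Longrightarrow> deg_sum A B \<le> card A * c"
  unfolding deg_sum_def using sum_bounded_above[of A "\<lambda>x. card (nbrs x B)" c] by simp

lemma deg_sum_le_square: "finite W \<Longrightarrow> deg_sum W W \<le> card W * card W"
  by (intro deg_sum_le card_nbrs_le)

text \<open>Vertices of degree below \<open>0.6 * card W\<close> are deleted one by one. A deletion
  costs less than \<open>1.2 * card W\<close> in the degree sum, which is exactly how much
  \<open>0.6 * c * (c + 1)\<close> falls when \<open>c = card W\<close> drops by one. So the surplus
  \<open>\<gamma>\<close> survives, and at the end it is bounded by the square of the remaining
  order.\<close>

lemma dense_core:
  fixes \<gamma> :: real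
  assumes "finite W" "0 < \<gamma>"
    and "0.6 * card W * (card W + 1) + \<gamma> \<le> deg_sum W W"
  shows "\<exists>U\<subseteq>W. (\<forall>x\<in>U. 0.6 * card U \<le> card (nbrs x U)) \<and> \<gamma> \<le> (real (card U))\<^sup>2"
  using assms
proof (induction W rule: finite_psubset_induct)
  case (psubset W)
  show ?case
  proof (cases "\<forall>x\<in>W. 0.6 * card W \<le> card (nbrs x W)")
    case True
    have "0 \<le> 0.6 * real (card W) * real (card W + 1)"
      by simp
    then have "\<gamma> \<le> real (deg_sum W W)"
      using psubset.prems(2) by linarith
    also have "\<dots> \<le> real (card W * card W)"
      using deg_sum_le_square[OF psubset.hyps] by (simp only: of_nat_le_iff)
    finally show ?thesis
      using True by (intro exI[of _ W]) (auto simp: power2_eq_square)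
  next
    case False
    then obtain x where x: "x \<in> W" "real (card (nbrs x W)) < 0.6 * card W"
      by auto
    have "deg_sum W W + deg_sum {x} {x} = deg_sum (W - {x}) (W - {x}) + 2 * deg_sum {x} W"
      using x psubset.hyps by (intro deg_sum_split) auto
    moreover have "nbrs x {x} = {}"
      using adj_irrefl by auto
    ultimately have dW: "real (deg_sum W W) = real (deg_sum (W - {x}) (W - {x})) + 2 * real (card (nbrs x W))"
      by (simp add: deg_sum_def)
    define c where "c = real (card W)"
    have cW: "real (card (W - {x})) = c - 1" "real (card (W - {x}) + 1) = c"
      using card_Suc_Diff1[OF psubset.hyps x(1)] unfolding c_def by simp_all
    have "real (card W + 1) = c + 1"
      unfolding c_def by simp
    then have "0.6 * c * (c + 1) + \<gamma> \<le> deg_sum W W"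
      using psubset.prems(2) c_def by metis
    moreover have "real (card (nbrs x W)) < 0.6 * c"
      using x(2) unfolding c_def .
    moreover have "0.6 * (c - 1) * c = 0.6 * c * (c + 1) - 1.2 * c"
      by (simp add: field_simps)
    ultimately have "0.6 * (c - 1) * c + \<gamma> \<le> deg_sum (W - {x}) (W - {x})"
      using dW by linarith
    then have "0.6 * card (W - {x}) * (card (W - {x}) + 1) + \<gamma> \<le> deg_sum (W - {x}) (W - {x})"
      unfolding cW .
    then have "\<exists>U\<subseteq>W - {x}. (\<forall>x\<in>U. 0.6 * card U \<le> card (nbrs x U)) \<and> \<gamma> \<le> (real (card U))\<^sup>2"
      using x psubset.prems(1) by (intro psubset.IH) auto
    then show ?thesis
      by blast
  qed
qed

text \<open>Many vertices have more than half of \<open>S\<close> as neighbours; by the pigeonhole principle many of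
  them have the same neighbours in \<open>S\<close>.\<close>

lemma common_trace:
  assumes "finite U" "S \<subseteq> U" "S \<noteq> {}" "1 \<le> m"
    and deg: "\<And>y. y \<in> S \<Longrightarrow> 0.6 * card U \<le> card (nbrs y U)"
    and large: "20 * 2 ^ card S * m \<le> card U"
  shows "\<exists>T M. T \<subseteq> S \<and> 0.55 * card S \<le> card T \<and> M \<subseteq> U \<and> card M = m \<and> (\<forall>x\<in>M. \<forall>y\<in>T. adj x y)"
proof -
  \<comment> \<open>The average number of neighbours in \<open>S\<close> is at least
    \<open>0.6 * card S\<close>, so at least the share 0.6 - 0.55 = 1/20 of \<open>U\<close> lies in
    \<open>H\<close>. This is the factor 20 in \<open>large\<close>; the factor
    \<open>2 ^ card S\<close> counts the possible neighbourhoods.\<close>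
  define H where "H = {x\<in>U. 0.55 * card S \<le> card (nbrs x S)}"
  have finS: "finite S" and finH: "finite H" and HU: "H \<subseteq> U"
    using assms finite_subset by (auto simp: H_def)
  have pos: "real (card S) > 0"
    using assms finS by (simp add: card_gt_0_iff)
  have "0.6 * real (card U) * card S \<le> (\<Sum>y\<in>S. real (card (nbrs y U)))"
    using sum_bounded_below[of S "0.6 * real (card U)" "\<lambda>y. real (card (nbrs y U))"] deg
    by (simp add: mult.commute)
  also have "\<dots> = real (deg_sum S U)"
    by (simp add: deg_sum_def)
  also have "\<dots> = real (deg_sum U S)"
    using deg_sum_commute finS assms by simp
  also have "\<dots> = (\<Sum>x\<in>U. real (card (nbrs x S)))"
    by (simp add: deg_sum_def)
  also have "\<dots> \<le> (\<Sum>x\<in>U. 0.55 * real (card S) + (if x \<in> H then real (card S) else 0))"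
  proof (rule sum_mono)
    fix x assume "x \<in> U"
    then show "real (card (nbrs x S)) \<le> 0.55 * real (card S) + (if x \<in> H then real (card S) else 0)"
      using card_nbrs_le[OF finS, of x] by (auto simp: H_def not_le)
  qed
  also have "\<dots> = 0.55 * real (card S) * card U + card H * card S"
  proof -
    have "(\<Sum>x\<in>U. if x \<in> H then real (card S) else 0) = (\<Sum>x\<in>H. real (card S))"
      using HU assms(1) by (simp add: sum.If_cases Int_absorb1 Int_absorb2)
    then show ?thesis
      by (simp add: sum.distrib)
  qed
  finally have "0.05 * real (card U) * card S \<le> card H * card S"
    by (simp add: algebra_simps)
  then have "0.05 * real (card U) \<le> card H"
    using pos by simp
  moreover have "real (20 * 2 ^ card S * m) \<le> real (card U)"
    using large by (simp only: of_nat_le_iff)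
  ultimately have "real (2 ^ card S * m) \<le> real (card H)"
    by simp
  then have H_large: "2 ^ card S * m \<le> card H"
    by (simp only: of_nat_le_iff)
  define F where "F T = {x\<in>H. nbrs x S = T}" for T
  have "\<exists>T\<in>Pow S. m \<le> card (F T)"
  proof (rule ccontr)
    assume "\<not> ?thesis"
    then have lt: "card (F T) < m" if "T \<in> Pow S" for T
      using that by (meson not_le)
    have "card (F T) \<le> m - 1" if "T \<in> Pow S" for T
      using lt[OF that] by linarith
    then have "(\<Sum>T\<in>Pow S. card (F T)) \<le> card (Pow S) * (m - 1)"
      using sum_bounded_above[of "Pow S" "\<lambda>T. card (F T)" "m - 1"] by simp
    moreover have "H = (\<Union>T\<in>Pow S. F T)"
      unfolding F_def using nbrs_subset by blast
    then have "card H \<le> (\<Sum>T\<in>Pow S. card (F T))"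
      using card_UN_le[of "Pow S" F] finS by simp
    ultimately have "2 ^ card S * m \<le> 2 ^ card S * (m - 1)"
      using H_large card_Pow[OF finS] by (metis le_trans)
    then show False
      using assms(4) by simp
  qed
  then obtain T where T: "T \<subseteq> S" "m \<le> card (F T)"
    by blast
  then obtain M where M: "M \<subseteq> F T" "card M = m"
    using obtain_subset_with_card_n by metis
  then have "M \<noteq> {}"
    using assms(4) by auto
  then have "0.55 * card S \<le> card T"
    using M by (auto simp: F_def H_def)
  moreover have "\<forall>x\<in>M. \<forall>y\<in>T. adj x y"
    using M by (auto simp: F_def)
  ultimately show ?thesis
    using T M HU by (intro exI[of _ T] exI[of _ M]) (auto simp: F_def)
qed

text \<open>In a core of minimum degree above half its order, \<open>common_trace\<close> is applied
  twice: to a set of \<open>20 * t\<close> vertices, which gives a complete bipartite graph with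
  sides of size \<open>10 * t\<close>, and then to the union of these sides. The second trace has at
  least \<open>11 * t\<close> vertices, hence at least \<open>t\<close> on either side.\<close>

lemma complete_tripartite_in_dense:
  assumes "finite W" "1 \<le> t"
    and dense: "0.64 * (real (card W))\<^sup>2 \<le> deg_sum W W"
    and large: "2000 * t * 2 ^ (20 * t) \<le> card W"
  shows "\<exists>B1 B2 B3. B1 \<subseteq> W \<and> B2 \<subseteq> W \<and> B3 \<subseteq> W \<and> card B1 = t \<and> card B2 = t \<and> card B3 = t \<and>
     (\<forall>x\<in>B1. \<forall>y\<in>B2. adj x y) \<and> (\<forall>x\<in>B1. \<forall>y\<in>B3. adj x y) \<and> (\<forall>x\<in>B2. \<forall>y\<in>B3. adj x y)"
proof -
  define n where "n = real (card W)"
  define K where "K = t * 2 ^ (20 * t)"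
  have "K > 0"
    unfolding K_def using assms(2) by (intro mult_pos_pos) auto
  have large: "2000 * K \<le> card W"
    using large unfolding K_def mult.assoc .
  with \<open>K > 0\<close> have n: "n \<ge> 2000"
    unfolding n_def by linarith
  then have "30 * n \<le> n * n"
    by (intro mult_right_mono) auto
  then have "\<exists>U\<subseteq>W. (\<forall>x\<in>U. 0.6 * card U \<le> card (nbrs x U)) \<and> 0.02 * n\<^sup>2 \<le> (real (card U))\<^sup>2"
  proof (intro dense_core)
    \<comment> \<open>Half of the surplus 0.64 - 0.6 absorbs the linear term; the other half is the
      surplus handed to \<open>dense_core\<close>.\<close>
    have "0.6 * n * (n + 1) + 0.02 * (n * n) = 0.62 * (n * n) + 0.6 * n"
      by (simp add: field_simps)
    also have "\<dots> \<le> 0.64 * (n * n)"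
      using \<open>30 * n \<le> n * n\<close> by simp
    also have "\<dots> \<le> deg_sum W W"
      using dense unfolding n_def power2_eq_square .
    finally have "0.6 * n * (n + 1) + 0.02 * (n * n) \<le> deg_sum W W" .
    then show "0.6 * card W * (card W + 1) + 0.02 * n\<^sup>2 \<le> deg_sum W W"
      unfolding n_def power2_eq_square by (simp add: add.commute)
  qed (use n assms(1) in auto)
  then obtain U where U: "U \<subseteq> W" "\<And>x. x \<in> U \<Longrightarrow> 0.6 * card U \<le> card (nbrs x U)"
      "0.02 * n\<^sup>2 \<le> (real (card U))\<^sup>2"
    by blast
  have finU: "finite U"
    using U assms finite_subset by blast
  have "(0.1 * n)\<^sup>2 = 0.01 * n\<^sup>2"
    by (simp add: power2_eq_square)
  also have "\<dots> \<le> 0.02 * n\<^sup>2"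
    by (intro mult_right_mono) auto
  also note U(3)
  finally have "(0.1 * n)\<^sup>2 \<le> (real (card U))\<^sup>2" .
  then have "0.1 * n \<le> real (card U)"
    by (rule power2_le_imp_le) auto
  moreover have "real (2000 * K) \<le> n"
    using large unfolding n_def by (simp only: of_nat_le_iff)
  ultimately have "real (200 * K) \<le> real (card U)"
    by simp
  then have "200 * K \<le> card U"
    by (simp only: of_nat_le_iff)
  then have cU: "20 * 2 ^ (20 * t) * (10 * t) \<le> card U"
    by (simp add: K_def algebra_simps)
  have "t * 1 \<le> K"
    unfolding K_def by (intro mult_left_mono) auto
  then have "20 * t \<le> card U"
    using \<open>200 * K \<le> card U\<close> by linarith
  then obtain S where S: "S \<subseteq> U" "card S = 20 * t"
    using obtain_subset_with_card_n by metis
  then have "S \<noteq> {}"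
    using assms(2) by auto
  have "\<exists>T M. T \<subseteq> S \<and> 0.55 * card S \<le> card T \<and> M \<subseteq> U \<and> card M = 10 * t \<and> (\<forall>x\<in>M. \<forall>y\<in>T. adj x y)"
    using S U \<open>S \<noteq> {}\<close> finU cU assms(2) by (intro common_trace) auto
  then obtain T M where T: "T \<subseteq> S" "0.55 * card S \<le> card T" "M \<subseteq> U" "card M = 10 * t"
      and TM: "\<And>x y. x \<in> M \<Longrightarrow> y \<in> T \<Longrightarrow> adj x y"
    by blast
  have "real (10 * t) \<le> real (card T)"
    using T(2) S(2) by simp
  then have "10 * t \<le> card T"
    by (simp only: of_nat_le_iff)
  then obtain S1 where S1: "S1 \<subseteq> T" "card S1 = 10 * t"
    using obtain_subset_with_card_n by metis
  have disj: "M \<inter> S1 = {}"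
    using TM S1 adj_irrefl by blast
  have finite_M: "finite M" "finite S1"
    using T S1 S finU by (meson finite_subset)+
  have cS: "card (S1 \<union> M) = 20 * t"
    using S1 T finite_M disj by (simp add: card_Un_disjoint Int_commute)
  have "\<exists>T2 M2. T2 \<subseteq> S1 \<union> M \<and> 0.55 * card (S1 \<union> M) \<le> card T2 \<and> M2 \<subseteq> U \<and> card M2 = t \<and> (\<forall>x\<in>M2. \<forall>y\<in>T2. adj x y)"
  proof (rule common_trace)
    show "20 * 2 ^ card (S1 \<union> M) * t \<le> card U"
      using cU unfolding cS by simp
    show "0.6 * card U \<le> card (nbrs y U)" if "y \<in> S1 \<union> M" for y
      using U(2)[of y] that S S1 T by blast
    show "S1 \<union> M \<noteq> {}"
      using S1 assms(2) by auto
  qed (use S S1 T U finU assms(2) in auto)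
  then obtain T2 M2 where T2: "T2 \<subseteq> S1 \<union> M" "0.55 * card (S1 \<union> M) \<le> card T2" "M2 \<subseteq> U" "card M2 = t"
      and TM2: "\<And>x y. x \<in> M2 \<Longrightarrow> y \<in> T2 \<Longrightarrow> adj x y"
    by blast
  have "real (11 * t) \<le> real (card T2)"
    using T2(2) cS by simp
  then have cT2: "11 * t \<le> card T2"
    by (simp only: of_nat_le_iff)
  have finT2: "finite T2"
    using T2 finite_M finite_subset by blast
  have "T2 = (T2 \<inter> S1) \<union> (T2 \<inter> M)"
    using T2(1) by blast
  then have sum: "card T2 \<le> card (T2 \<inter> S1) + card (T2 \<inter> M)"
    by (metis card_Un_le)
  moreover have "card (T2 \<inter> S1) \<le> 10 * t" "card (T2 \<inter> M) \<le> 10 * t"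
    using card_mono[of S1 "T2 \<inter> S1"] card_mono[of M "T2 \<inter> M"] finite_M S1 T by auto
  ultimately have "t \<le> card (T2 \<inter> S1)" "t \<le> card (T2 \<inter> M)"
    using cT2 by linarith+
  then obtain B1 B2 where B: "B1 \<subseteq> T2 \<inter> S1" "card B1 = t" "B2 \<subseteq> T2 \<inter> M" "card B2 = t"
    using obtain_subset_with_card_n by metis
  show ?thesis
  proof (intro exI conjI ballI)
    show "adj x y" if "x \<in> B1" "y \<in> B2" for x y
      using adj_sym[OF TM[of y x]] that B S1 by blast
    show "adj x y" if "x \<in> B1" "y \<in> M2" for x y
      using adj_sym[OF TM2[of y x]] that B by blast
    show "adj x y" if "x \<in> B2" "y \<in> M2" for x y
      using adj_sym[OF TM2[of y x]] that B by blast
    show "B1 \<subseteq> W" "B2 \<subseteq> W" "M2 \<subseteq> W"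
      using B T T2 S1 S U by blast+
  qed (use B T2 in auto)
qed

end

section \<open>The edge bound\<close>

lemma three_indices:
  fixes i j l :: nat
  assumes "i < 3" "j < 3" "l < 3" "i \<noteq> j" "i \<noteq> l" "j \<noteq> l"
  shows "{..<3} = {i, j, l}"
  using assms by auto

context symmetric_relation
begin

lemma deg_sum_split_off:
  assumes "finite W" "X \<subseteq> W"
  shows "deg_sum W W = deg_sum (W - X) (W - X) + 2 * deg_sum (W - X) X + deg_sum X X"
proof -
  have fin: "finite X" "finite (W - X)"
    using assms finite_subset by auto
  have "deg_sum X W = deg_sum X X + deg_sum X (W - X)"
    using deg_sum_Un_right[OF fin fin(1)] assms(2) by (simp add: Un_absorb1)
  moreover have "deg_sum (W - X) X = deg_sum X (W - X)"
    using fin by (rule deg_sum_commute[rotated])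
  ultimately show ?thesis
    using deg_sum_split[OF assms] by simp
qed

text \<open>Disjointness of the parts follows from irreflexivity; their independence comes later
  from \<open>complete_parts_misses_one\<close>.\<close>

definition complete_parts :: "nat \<Rightarrow> (nat \<Rightarrow> 'a set) \<Rightarrow> bool" where
  "complete_parts t B \<longleftrightarrow> (\<forall>i<3. finite (B i) \<and> card (B i) = t) \<and>
     (\<forall>i<3. \<forall>j<3. i \<noteq> j \<longrightarrow> (\<forall>x\<in>B i. \<forall>y\<in>B j. adj x y))"

lemma complete_parts_disjoint:
  assumes "complete_parts t B" "i < 3" "j < 3" "i \<noteq> j"
  shows "B i \<inter> B j = {}"
  using assms adj_irrefl unfolding complete_parts_def by blast

lemma card_complete_parts:
  assumes "complete_parts t B"
  shows "finite (\<Union>i<3. B i)" "card (\<Union>i<3. B i) = 3 * t"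
proof -
  show "finite (\<Union>i<3. B i)"
    using assms by (auto simp: complete_parts_def)
  have "card (\<Union>i<3. B i) = (\<Sum>i<3. card (B i))"
    using assms complete_parts_disjoint[OF assms]
    by (intro card_UN_disjoint) (auto simp: complete_parts_def)
  also have "\<dots> = 3 * t"
    using assms by (simp add: complete_parts_def)
  finally show "card (\<Union>i<3. B i) = 3 * t" .
qed

lemma complete_parts_in_dense:
  assumes "finite W" "1 \<le> t"
    and "0.64 * (real (card W))\<^sup>2 \<le> deg_sum W W" "2000 * t * 2 ^ (20 * t) \<le> card W"
  shows "\<exists>B. complete_parts t B \<and> (\<Union>i<3. B i) \<subseteq> W"
proof -
  obtain B1 B2 B3 where B: "B1 \<subseteq> W" "B2 \<subseteq> W" "B3 \<subseteq> W" "card B1 = t" "card B2 = t" "card B3 = t"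
     "\<forall>x\<in>B1. \<forall>y\<in>B2. adj x y" "\<forall>x\<in>B1. \<forall>y\<in>B3. adj x y" "\<forall>x\<in>B2. \<forall>y\<in>B3. adj x y"
    using complete_tripartite_in_dense[OF assms] by blast
  define B where "B i = (if i = 0 then B1 else if i = 1 then B2 else B3)" for i :: nat
  have "finite B1" "finite B2" "finite B3"
    using B assms(1) finite_subset by auto
  moreover have "adj y x" if "x \<in> B1 \<and> y \<in> B2 \<or> x \<in> B1 \<and> y \<in> B3 \<or> x \<in> B2 \<and> y \<in> B3" for x y
    using B that adj_sym by blast
  ultimately have "complete_parts t B"
    using B by (auto simp: complete_parts_def B_def)
  moreover have "(\<Union>i<3. B i) \<subseteq> W"
    using B by (auto simp: B_def)
  ultimately show ?thesis
    by blast
qed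

end

section \<open>The Turan-type bound for wheel-free graphs and its consequence for degree
  sums\<close>

context wheel_free
begin

text \<open>Neighbours \<open>a\<close>, \<open>b\<close>, \<open>c\<close> of \<open>x\<close> in
  the three parts would give a wheel with hub \<open>a\<close> whose rim is \<open>x\<close> and a
  path from \<open>b\<close> to \<open>c\<close> in the other two parts. As \<open>x\<close> may
  itself lie in one of these, it is removed there, which explains \<open>k + 1\<close> instead of
  \<open>k\<close>.\<close>

lemma complete_parts_misses_one:
  assumes B: "complete_parts t B" and "k + 1 \<le> t"
  shows "\<exists>i<3. nbrs x (B i) = {}"
proof (rule ccontr)
  assume *: "\<not> ?thesis"
  have ne: "\<exists>y. y \<in> B i \<and> adj x y" if "i < 3" for i
    using * that by (metis all_not_in_conv mem_nbrs)
  obtain a where a: "a \<in> B 0" "adj x a"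
    using ne[of 0] by auto
  obtain b where b: "b \<in> B 1" "adj x b"
    using ne[of 1] by auto
  obtain c where c: "c \<in> B 2" "adj x c"
    using ne[of 2] by auto
  have fin: "finite (B 1)" "finite (B 2)" "card (B 1) = t" "card (B 2) = t"
    using B by (auto simp: complete_parts_def)
  have adj: "adj y z" if "y \<in> B i" "z \<in> B j" "i < 3" "j < 3" "i \<noteq> j" for y z i j
    using B that unfolding complete_parts_def by blast
  have "card (B 1 - {x, b}) > 0"
    using assms(2) k_ge_2 fin card_Diff_subset[of "{x, b}" "B 1"] diff_card_le_card_Diff[of "{x, b}" "B 1"]
    by (cases "x = b") auto
  then obtain p' where p': "p' \<in> B 1" "p' \<noteq> x" "p' \<noteq> b"
    by (metis DiffE card_gt_0_iff ex_in_conv insertCI)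
  show False
  proof (rule no_wheel_one[of "B 1 - {x}" "B 2 - {x}" x b c p' a])
    show "(B 1 - {x}) \<inter> (B 2 - {x}) = {}"
      using complete_parts_disjoint[OF B, of 1 2] by auto
    show "k \<le> card (B 1 - {x})"
      using fin assms(2) by (auto simp: card_Diff_singleton_if)
    show "k \<le> card (nbrs p (B 2 - {x}) \<inter> nbrs p' (B 2 - {x}))" if "p \<in> B 1 - {x}" "p' \<in> B 1 - {x}" for p p'
    proof -
      have "nbrs p (B 2 - {x}) \<inter> nbrs p' (B 2 - {x}) = B 2 - {x}"
        using that adj[of _ 1 _ 2] by auto
      moreover have "k \<le> card (B 2 - {x})"
        using fin assms(2) by (auto simp: card_Diff_singleton_if)
      ultimately show ?thesis
        by (simp only:)
    qed
    show "adj a y" if "y \<in> (B 1 - {x}) \<union> (B 2 - {x})" for y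
      using that a adj[of a 0 y 1] adj[of a 0 y 2] by auto
    show "adj c p'"
      using c p' adj[of c 2 p' 1] by auto
  qed (use a b c p' fin adj_irrefl adj_sym in auto)
qed

lemma complete_parts_degree:
  assumes B: "complete_parts t B" and "k + 1 \<le> t"
  shows "card (nbrs x (\<Union>i<3. B i)) \<le> 2 * t"
proof -
  obtain i where i: "i < 3" "nbrs x (B i) = {}"
    using complete_parts_misses_one[OF assms] by blast
  have "nbrs x (\<Union>i<3. B i) \<subseteq> (\<Union>j\<in>{..<3} - {i}. B j)"
  proof
    fix y assume "y \<in> nbrs x (\<Union>i<3. B i)"
    then obtain j where "j < 3" "y \<in> nbrs x (B j)"
      by auto
    then show "y \<in> (\<Union>j\<in>{..<3} - {i}. B j)"
      using i by (cases "j = i") auto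
  qed
  then have "card (nbrs x (\<Union>i<3. B i)) \<le> card (\<Union>j\<in>{..<3} - {i}. B j)"
    using B by (intro card_mono) (auto simp: complete_parts_def)
  also have "\<dots> \<le> (\<Sum>j\<in>{..<3} - {i}. card (B j))"
    by (rule card_UN_le) auto
  also have "\<dots> = 2 * t"
    using B i by (simp add: complete_parts_def)
  finally show ?thesis .
qed

text \<open>The square of the order from which \<open>complete_parts_in_dense\<close> applies with
  \<open>t = k + 1\<close>; for smaller \<open>W\<close> it bounds \<open>deg_sum W W\<close>
  trivially.\<close>

definition edge_slack :: real where
  "edge_slack = (real (2000 * (k + 1) * 2 ^ (20 * (k + 1))))\<^sup>2"

lemma edge_slack_nonneg: "0 \<le> edge_slack"
  by (simp add: edge_slack_def)

text \<open>Induction by removing a complete tripartite graph on \<open>3 * t\<close> vertices, to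
  which every vertex has degree at most \<open>2 * t\<close>. The terms in \<open>t\<close> then
  cancel exactly against \<open>2 / 3 * (m - 3 * t)\<^sup>2\<close>, so the error does not
  grow.\<close>

lemma deg_sum_bound:
  assumes "finite W"
  shows "deg_sum W W \<le> 2 / 3 * (real (card W))\<^sup>2 + edge_slack"
  using assms
proof (induction W rule: finite_psubset_induct)
  case (psubset W)
  define m where "m = real (card W)"
  have sq: "real (deg_sum W W) \<le> m\<^sup>2"
    using deg_sum_le_square[OF psubset.hyps] unfolding m_def power2_eq_square
    by (metis of_nat_le_iff of_nat_mult)
  consider (small) "card W < 2000 * (k + 1) * 2 ^ (20 * (k + 1))"
    | (sparse) "deg_sum W W \<le> 2 / 3 * m\<^sup>2"
    | (dense) "2000 * (k + 1) * 2 ^ (20 * (k + 1)) \<le> card W" "deg_sum W W > 2 / 3 * m\<^sup>2"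
    by linarith
  then show ?case
  proof cases
    case small
    then have "m \<le> real (2000 * (k + 1) * 2 ^ (20 * (k + 1)))"
      unfolding m_def by (simp only: of_nat_le_iff)
    then have "m\<^sup>2 \<le> edge_slack"
      unfolding edge_slack_def by (rule power_mono) (simp add: m_def)
    then show ?thesis
      using sq zero_le_power2[of m] unfolding m_def[symmetric] by linarith
  next
    case sparse
    then show ?thesis
      using edge_slack_nonneg by (simp add: m_def)
  next
    case dense
    define t where "t = k + 1"
    have "0.64 * m\<^sup>2 \<le> 2 / 3 * m\<^sup>2"
      by (intro mult_right_mono) auto
    then have "\<exists>B. complete_parts t B \<and> (\<Union>i<3. B i) \<subseteq> W"
      using dense psubset.hyps unfolding m_def t_def
      by (intro complete_parts_in_dense) auto
    then obtain B where B: "complete_parts t B" "(\<Union>i<3. B i) \<subseteq> W"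
      by blast
    define U where "U = (\<Union>i<3. B i)"
    have cU: "card U = 3 * t" "finite U"
      using card_complete_parts[OF B(1)] by (auto simp: U_def)
    have deg: "card (nbrs x U) \<le> 2 * t" for x
      unfolding U_def t_def by (rule complete_parts_degree) (use B in \<open>auto simp: t_def\<close>)
    have "U \<noteq> {}"
      using cU(1) unfolding t_def by auto
    have UW: "U \<subseteq> W"
      using B by (simp add: U_def)
    have cWU: "real (card (W - U)) = m - 3 * t"
      using card_Diff_subset[OF cU(2) UW] card_mono[OF psubset.hyps UW] cU(1)
      by (simp add: m_def of_nat_diff)
    have "deg_sum (W - U) U \<le> card (W - U) * (2 * t)" "deg_sum U U \<le> card U * (2 * t)"
      by (intro deg_sum_le deg cU(2))+
    then have "real (deg_sum (W - U) U) \<le> real (card (W - U) * (2 * t))"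
       "real (deg_sum U U) \<le> real (card U * (2 * t))"
      by (simp_all only: of_nat_le_iff)
    then have 1: "real (deg_sum (W - U) U) \<le> (m - 3 * t) * (2 * t)" "real (deg_sum U U) \<le> 3 * t * (2 * t)"
      using cWU cU by simp_all
    have "W - U \<subset> W"
      using UW \<open>U \<noteq> {}\<close> by auto
    then have 2: "deg_sum (W - U) (W - U) \<le> 2 / 3 * (m - 3 * t)\<^sup>2 + edge_slack"
      using psubset.IH[of "W - U"] cWU by simp
    have "deg_sum W W = deg_sum (W - U) (W - U) + 2 * deg_sum (W - U) U + deg_sum U U"
      by (rule deg_sum_split_off[OF psubset.hyps UW])
    then have "real (deg_sum W W) = real (deg_sum (W - U) (W - U)) + 2 * real (deg_sum (W - U) U) + real (deg_sum U U)"
      by simp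
    also have "\<dots> \<le> 2 / 3 * (m - 3 * t)\<^sup>2 + edge_slack + 2 * ((m - 3 * t) * (2 * t)) + 3 * t * (2 * t)"
      using 1 2 by linarith
    also have "\<dots> = 2 / 3 * m\<^sup>2 + edge_slack"
      by (simp add: field_simps power2_eq_square)
    finally show ?thesis
      by (simp add: m_def)
  qed
qed

text \<open>Since \<open>deg_sum_bound\<close> limits the edges of \<open>V - X\<close>, the rest of
  what \<open>many\<close> guarantees must be incident with \<open>X\<close>. The 1 subtracted from
  \<open>card X\<close> reflects that \<open>many\<close> is the threshold of order
  \<open>card V - 1\<close>.\<close>

lemma deg_sum_lower:
  assumes "finite V" "X \<subseteq> V" and many: "2 / 3 * (real (card V) - 1)\<^sup>2 \<le> deg_sum V V"
  shows "2 / 3 * (real (card X) - 1) * card V - ((real (card X))\<^sup>2 + edge_slack) \<le> deg_sum X V"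
proof -
  define n where "n = real (card V)"
  define s where "s = real (card X)"
  have finX: "finite X"
    using assms finite_subset by blast
  have cVX: "real (card (V - X)) = n - s"
    using card_Diff_subset[OF finX assms(2)] card_mono[OF assms(1,2)]
    by (simp add: n_def s_def of_nat_diff)
  have "deg_sum V V \<le> deg_sum (V - X) (V - X) + 2 * deg_sum X V"
    using deg_sum_split[OF assms(1,2)] by linarith
  then have "real (deg_sum V V) \<le> real (deg_sum (V - X) (V - X) + 2 * deg_sum X V)"
    by (simp only: of_nat_le_iff)
  then have "real (deg_sum V V) \<le> 2 / 3 * (n - s)\<^sup>2 + edge_slack + 2 * real (deg_sum X V)"
    using deg_sum_bound[of "V - X"] assms(1) cVX by simp
  then have "2 / 3 * (n - 1)\<^sup>2 \<le> 2 / 3 * (n - s)\<^sup>2 + edge_slack + 2 * real (deg_sum X V)"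
    using many unfolding n_def by linarith
  moreover have "2 / 3 * (n - 1)\<^sup>2 - 2 / 3 * (n - s)\<^sup>2 = 2 * (2 / 3 * (s - 1) * n) - 2 / 3 * s\<^sup>2 + 2 / 3"
    by (simp add: field_simps power2_eq_square)
  moreover have "0 \<le> s\<^sup>2"
    by simp
  ultimately show ?thesis
    using edge_slack_nonneg unfolding n_def[symmetric] s_def[symmetric] by linarith
qed

end

section \<open>Stability\<close>

lemma third_index: "\<exists>l<3. i \<noteq> l \<and> j \<noteq> l" for i j :: nat
  by presburger

lemma other_indices:
  fixes i :: nat
  assumes "i < 3"
  shows "\<exists>j l. j < 3 \<and> l < 3 \<and> i \<noteq> j \<and> i \<noteq> l \<and> j \<noteq> l"
  using assms by presburger

context symmetric_relation
begin

definition near_tripartite :: "real \<Rightarrow> 'a set \<Rightarrow> 'a set \<Rightarrow> (nat \<Rightarrow> 'a set) \<Rightarrow> bool" where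
  "near_tripartite \<eta> V X P \<longleftrightarrow>
     finite V \<and> V = X \<union> (\<Union>i<3. P i) \<and> (\<forall>i<3. P i \<inter> X = {}) \<and>
     (\<forall>i<3. \<forall>j<3. i \<noteq> j \<longrightarrow> P i \<inter> P j = {}) \<and>
     real (card X) \<le> \<eta> * real (card V) \<and>
     (\<forall>i<3. (1 / 3 - \<eta>) * card V \<le> card (P i) \<and> card (P i) \<le> (1 / 3 + \<eta>) * card V) \<and>
     (\<forall>i<3. \<forall>x\<in>P i. nbrs x (P i) = {}) \<and>
     (\<forall>i<3. \<forall>j<3. i \<noteq> j \<longrightarrow> (\<forall>x\<in>P i. real (card (P j)) - \<eta> * real (card V) \<le> real (card (nbrs x (P j)))))"

end

text \<open>The identity \<open>id\<close> expresses the loss against equal sizes by the squared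
  differences of the sizes; the assumed lower bound on the products makes their sum at most
  \<open>(3 * e * n)\<^sup>2\<close>.\<close>

lemma part_size_bounds:
  fixes a b c m n \<delta> e :: real
  assumes "0 \<le> a" "0 \<le> b" "0 \<le> c" "a + b + c \<le> n" "(1 - e\<^sup>2) * n \<le> a + b + c"
    and "2 / 3 * (n - 1)\<^sup>2 \<le> 2 * (a * b + a * c + b * c) + 2 * (e\<^sup>2 * n\<^sup>2)"
    and "2 \<le> e\<^sup>2 * n" "0 < e" "e \<le> 1 / 100" "0 < n"
  shows "(1 / 3 - 3 * e) * n \<le> a" "a \<le> (1 / 3 + 2 * e) * n"
proof -
  have id: "2 * (a * b + a * c + b * c) =
      2 / 3 * (a + b + c)\<^sup>2 - 1 / 3 * ((a - b)\<^sup>2 + (a - c)\<^sup>2 + (b - c)\<^sup>2)"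
    by (simp add: field_simps power2_eq_square)
  have "2 * n \<le> e\<^sup>2 * n * n"
    using assms by (intro mult_right_mono) auto
  then have "2 * n \<le> e\<^sup>2 * n\<^sup>2"
    by (simp add: power2_eq_square mult.assoc)
  moreover have "4 * n + 6 * r \<le> 9 * r" if "2 * n \<le> r" for r
    using that assms(10) by linarith
  ultimately have b: "4 * n + 6 * (e\<^sup>2 * n\<^sup>2) \<le> 9 * (e\<^sup>2 * n\<^sup>2)"
    by blast
  have "(a + b + c)\<^sup>2 \<le> n\<^sup>2"
    using assms by (intro power_mono) auto
  moreover have "2 / 3 * (n - 1)\<^sup>2 = 2 / 3 * n\<^sup>2 - 4 / 3 * n + 2 / 3"
    by (simp add: field_simps power2_eq_square)
  moreover have "q \<le> 4 * n + 6 * r"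
    if "p = 2 / 3 * u - 1 / 3 * q" "u \<le> v" "w = 2 / 3 * v - 4 / 3 * n + 2 / 3" "w \<le> p + 2 * r"
    for p q r u v w :: real
    using that by linarith
  ultimately have "(a - b)\<^sup>2 + (a - c)\<^sup>2 + (b - c)\<^sup>2 \<le> 4 * n + 6 * (e\<^sup>2 * n\<^sup>2)"
    using assms(6) id by blast
  also note b
  also have "9 * (e\<^sup>2 * n\<^sup>2) = (3 * e * n)\<^sup>2"
    by (simp add: power2_eq_square)
  finally have *: "(a - b)\<^sup>2 + (a - c)\<^sup>2 + (b - c)\<^sup>2 \<le> (3 * e * n)\<^sup>2" .
  have "(a - b)\<^sup>2 \<le> (3 * e * n)\<^sup>2" "(a - c)\<^sup>2 \<le> (3 * e * n)\<^sup>2"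
    using * zero_le_power2[of "a - b"] zero_le_power2[of "a - c"] zero_le_power2[of "b - c"] by linarith+
  then have "\<bar>a - b\<bar> \<le> 3 * e * n" "\<bar>a - c\<bar> \<le> 3 * e * n"
    using assms abs_le_square_iff[of "a - b" "3 * e * n"] abs_le_square_iff[of "a - c" "3 * e * n"]
    by (auto simp: abs_mult)
  moreover have "e\<^sup>2 * n \<le> e * n"
    using assms by (intro mult_right_mono) (auto simp: power2_eq_square mult_le_cancel_left1)
  moreover have "0 \<le> e * n"
    using assms by simp
  moreover have "n / 3 - 3 * r \<le> a \<and> a \<le> n / 3 + 2 * r"
    if "\<bar>a - b\<bar> \<le> 3 * r" "\<bar>a - c\<bar> \<le> 3 * r" "d \<le> r" "0 \<le> r" "n - d \<le> a + b + c" for r d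
    using that assms(4) by linarith
  ultimately have "n / 3 - 3 * (e * n) \<le> a \<and> a \<le> n / 3 + 2 * (e * n)"
    using assms(5) by (simp only: left_diff_distrib mult.assoc mult_1)
  then show "(1 / 3 - 3 * e) * n \<le> a" "a \<le> (1 / 3 + 2 * e) * n"
    by (simp_all add: algebra_simps)
qed

context wheel_free
begin

text \<open>With \<open>\<tau>\<close> the rounded-up \<open>1 / e\<^sup>2\<close> this is
  \<open>2 * \<tau> + k + 1\<close>: two vertices that each miss fewer than \<open>\<tau>\<close>
  vertices of a part of this size still have more than \<open>k\<close> common neighbours there,
  while \<open>\<tau>\<close> is large enough for only \<open>e\<^sup>2 * n\<close> vertices to do
  worse.\<close>

definition blowup_size :: "real \<Rightarrow> nat" where
  "blowup_size e = 2 * nat \<lceil>1 / e\<^sup>2\<rceil> + k + 1"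

text \<open>The summands are the lower bounds on the order that the stability argument uses one by one.\<close>

definition order_bound :: "real \<Rightarrow> real" where
  "order_bound e = real (2000 * blowup_size e * 2 ^ (20 * blowup_size e)) +
     3 * ((3 * real (blowup_size e))\<^sup>2 + edge_slack) +
     3 * ((real (nat \<lceil>1 / e\<rceil>))\<^sup>2 + edge_slack) + nat \<lceil>1 / e\<rceil> / e + 2 / e\<^sup>2 + 1"

text \<open>In order \<open>n\<close>, at least \<open>1 / e\<close> such vertices, say
  \<open>s\<close> of them, would have degree sum at most \<open>2 / 3 * s * n - n\<close>, whereas
  \<open>deg_sum_lower\<close> guarantees \<open>2 / 3 * s * n - 2 / 3 * n\<close> up to a
  constant.\<close>

lemma few_low_degree_vertices:
  assumes "finite V" and many: "2 / 3 * (real (card V) - 1)\<^sup>2 \<le> deg_sum V V"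
    and e: "0 < e" and large: "3 * ((real (nat \<lceil>1 / e\<rceil>))\<^sup>2 + edge_slack) < card V"
    and L: "L \<subseteq> V" "\<And>x. x \<in> L \<Longrightarrow> card (nbrs x V) \<le> (2 / 3 - e) * card V"
  shows "card L \<le> nat \<lceil>1 / e\<rceil>"
proof (rule ccontr)
  define s where "s = nat \<lceil>1 / e\<rceil>"
  assume "\<not> ?thesis"
  then have "s \<le> card L"
    unfolding s_def by linarith
  then obtain Y where Y: "Y \<subseteq> L" "card Y = s"
    using obtain_subset_with_card_n by metis
  have "1 / e \<le> real s"
    using e by (simp add: s_def)
  then have "1 \<le> real s * e"
    using e by (simp add: field_simps)
  then have n: "1 * real (card V) \<le> real s * e * card V"
    by (rule mult_right_mono) simp
  have "2 / 3 * (real s - 1) * card V - ((real s)\<^sup>2 + edge_slack) \<le> real (deg_sum Y V)"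
    using deg_sum_lower[of V Y] Y L assms(1) many by auto
  also have "\<dots> = (\<Sum>x\<in>Y. real (card (nbrs x V)))"
    by (simp add: deg_sum_def)
  also have "\<dots> \<le> real s * ((2 / 3 - e) * card V)"
    using sum_bounded_above[of Y "\<lambda>x. real (card (nbrs x V))" "(2 / 3 - e) * card V"] L Y by auto
  finally have "2 / 3 * (real s - 1) * card V - ((real s)\<^sup>2 + edge_slack) \<le> real s * ((2 / 3 - e) * card V)" .
  moreover have "2 / 3 * (real s - 1) * card V = 2 / 3 * (s * real (card V)) - 2 / 3 * card V"
    by (simp add: field_simps)
  moreover have "real s * ((2 / 3 - e) * card V) = 2 / 3 * (s * real (card V)) - real s * e * card V"
    by (simp add: field_simps)
  moreover have "q \<le> 2 / 3 * u + T" if "w - T \<le> z" "w = 2 / 3 * p - 2 / 3 * u" "z = 2 / 3 * p - q" for p q u w z T :: real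
    using that by linarith
  ultimately have "real s * e * card V \<le> 2 / 3 * card V + ((real s)\<^sup>2 + edge_slack)"
    by blast
  moreover have False if "q \<le> 2 / 3 * u + T" "1 * u \<le> q" "3 * T < u" for q u T :: real
    using that by linarith
  ultimately show False
    using n large unfolding s_def by blast
qed

text \<open>If \<open>x\<close> and \<open>y\<close> were adjacent, \<open>x\<close> would be the
  hub of a wheel whose rim is \<open>y\<close> and a path inside the neighbourhood of
  \<open>x\<close> in the two parts, from one common neighbour of \<open>x\<close> and
  \<open>y\<close> to another.\<close>

lemma complete_parts_twins_nonadjacent:
  assumes B: "complete_parts t B" and "2 * \<tau> + k + 1 \<le> t"
    and idx: "i < 3" "j < 3" "l < 3" "i \<noteq> j" "i \<noteq> l" "j \<noteq> l"
    and x: "x \<notin> B j" "x \<notin> B l" "t < card (nbrs x (B j)) + \<tau>" "t < card (nbrs x (B l)) + \<tau>"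
    and y: "y \<notin> B j" "y \<notin> B l" "t < card (nbrs y (B j)) + \<tau>" "t < card (nbrs y (B l)) + \<tau>"
  shows "\<not> adj x y"
proof
  assume "adj x y"
  have fin: "finite (B j)" "finite (B l)" "card (B j) = t" "card (B l) = t"
    using B idx by (auto simp: complete_parts_def)
  have adj: "adj u v" if "u \<in> B j" "v \<in> B l" for u v
    using B that idx unfolding complete_parts_def by blast
  have common: "\<exists>z. z \<in> nbrs x (B m) \<and> z \<in> nbrs y (B m)" if "m = j \<or> m = l" for m
  proof -
    have "card (nbrs x (B m) \<union> nbrs y (B m)) \<le> t"
    proof -
      have "card (nbrs x (B m) \<union> nbrs y (B m)) \<le> card (B m)"
        using that fin by (intro card_mono) auto
      then show ?thesis
        using that fin by auto
    qed
    moreover have "card (nbrs x (B m)) + card (nbrs y (B m)) =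
        card (nbrs x (B m) \<union> nbrs y (B m)) + card (nbrs x (B m) \<inter> nbrs y (B m))"
      using that fin by (intro card_Un_Int) auto
    moreover have "2 * t < card (nbrs x (B m)) + card (nbrs y (B m)) + 2 * \<tau>"
      using that x y by auto
    ultimately have "card (nbrs x (B m) \<inter> nbrs y (B m)) > 0"
      using assms(2) by linarith
    then show ?thesis
      by (metis IntE card_gt_0_iff ex_in_conv)
  qed
  obtain b where b: "b \<in> nbrs x (B j)" "b \<in> nbrs y (B j)"
    using common by blast
  obtain c where c: "c \<in> nbrs x (B l)" "c \<in> nbrs y (B l)"
    using common by blast
  have "card (nbrs x (B j) - {b}) > 0"
    using x assms(2) b fin by simp
  then obtain p' where p': "p' \<in> nbrs x (B j)" "p' \<noteq> b"
    by (metis DiffE card_gt_0_iff ex_in_conv insertCI)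
  show False
  proof (rule no_wheel_one[of "nbrs x (B j)" "nbrs x (B l)" y b c p' x])
    show "nbrs x (B j) \<inter> nbrs x (B l) = {}"
      using complete_parts_disjoint[OF B, of j l] idx by auto
    show "k \<le> card (nbrs x (B j))"
      using x assms(2) by linarith
    show "k \<le> card (nbrs p (nbrs x (B l)) \<inter> nbrs p' (nbrs x (B l)))" if "p \<in> nbrs x (B j)" "p' \<in> nbrs x (B j)" for p p'
    proof -
      have "nbrs p (nbrs x (B l)) \<inter> nbrs p' (nbrs x (B l)) = nbrs x (B l)"
        using that adj by auto
      moreover have "k \<le> card (nbrs x (B l))"
        using x assms(2) by linarith
      ultimately show ?thesis
        by (simp only:)
    qed
    show "adj c p'"
      using adj[of p' c] c p' adj_sym by auto
  qed (use b c p' y \<open>adj x y\<close> fin in auto)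
qed

text \<open>A complete tripartite graph \<open>U\<close> of bounded size classifies the vertices by
  the part that they miss. The vertices with too few neighbours in \<open>U\<close>
  (\<open>R0\<close>) and those of low degree (\<open>L\<close>) form \<open>X\<close>.\<close>

lemma near_tripartite_exists:
  assumes V: "finite V" and many: "2 / 3 * (real (card V) - 1)\<^sup>2 \<le> deg_sum V V"
    and e: "0 < e" "e \<le> 1 / 100" and large: "order_bound e \<le> card V"
  shows "\<exists>X P. near_tripartite (7 * e) V X P"
proof -
  define n where "n = real (card V)"
  define t where "t = blowup_size e"
  define s where "s = nat \<lceil>1 / e\<rceil>"
  define \<tau> where "\<tau> = nat \<lceil>1 / e\<^sup>2\<rceil>"
  have t: "t = 2 * \<tau> + k + 1"
    by (simp add: t_def \<tau>_def blowup_size_def)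
  have terms: "0 \<le> real (2000 * t * 2 ^ (20 * t))" "0 \<le> (3 * real t)\<^sup>2 + edge_slack"
     "0 \<le> (real s)\<^sup>2 + edge_slack" "0 \<le> real s / e" "0 \<le> 2 / e\<^sup>2"
    using edge_slack_nonneg e by auto
  have "real (2000 * t * 2 ^ (20 * t)) + 3 * ((3 * real t)\<^sup>2 + edge_slack) +
     3 * ((real s)\<^sup>2 + edge_slack) + s / e + 2 / e\<^sup>2 + 1 \<le> n"
    using large unfolding order_bound_def n_def t_def s_def .
  moreover have "a \<le> n \<and> 3 * b \<le> n \<and> 3 * c < n \<and> d \<le> n \<and> f \<le> n \<and> 1 \<le> n"
    if "a + 3 * b + 3 * c + d + f + 1 \<le> n" "0 \<le> a" "0 \<le> b" "0 \<le> c" "0 \<le> d" "0 \<le> f" for a b c d f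
    using that by auto
  ultimately have n: "real (2000 * t * 2 ^ (20 * t)) \<le> n" "3 * ((3 * real t)\<^sup>2 + edge_slack) \<le> n"
     "3 * ((real s)\<^sup>2 + edge_slack) < n" "s / e \<le> n" "2 / e\<^sup>2 \<le> n" "1 \<le> n"
    using terms by blast+
  have e2: "0 < e\<^sup>2"
    using e by simp
  have tau: "1 / e\<^sup>2 \<le> real \<tau>"
    by (simp add: \<tau>_def)
  then have tau_pos: "0 < real \<tau>"
    using e2 by (metis less_le_trans zero_less_divide_1_iff)
  have e2n: "2 \<le> e\<^sup>2 * n"
    using n(5) e2 by (simp add: field_simps)
  have "0.64 * n\<^sup>2 \<le> deg_sum V V"
  proof -
    have "10000 \<le> 1 / e\<^sup>2"
      using e power_mono[of e "1 / 100" 2] by (simp add: field_simps power2_eq_square)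
    then have "10000 \<le> n"
      using n(5) by simp
    then have "10000 * n \<le> n * n"
      by (intro mult_right_mono) auto
    moreover have "16 / 25 * p \<le> 2 / 3 * p - 4 / 3 * n + 2 / 3" if "10000 * n \<le> p" for p
      using that \<open>10000 \<le> n\<close> by simp
    ultimately have "16 / 25 * (n * n) \<le> 2 / 3 * (n * n) - 4 / 3 * n + 2 / 3"
      by blast
    moreover have "2 / 3 * (n * n) - 4 / 3 * n + 2 / 3 = 2 / 3 * (n - 1)\<^sup>2"
      by (simp add: field_simps power2_eq_square)
    ultimately have "16 / 25 * (n * n) \<le> deg_sum V V"
      using many unfolding n_def by linarith
    then show ?thesis
      by (simp add: power2_eq_square)
  qed
  moreover have "2000 * t * 2 ^ (20 * t) \<le> card V"
    using n(1) unfolding n_def by (simp only: of_nat_le_iff)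
  ultimately obtain B where B: "complete_parts t B" "(\<Union>i<3. B i) \<subseteq> V"
    using complete_parts_in_dense[OF V, of t] unfolding n_def t by auto
  define U where "U = (\<Union>i<3. B i)"
  have U: "finite U" "card U = 3 * t" "U \<subseteq> V"
    using card_complete_parts[OF B(1)] B(2) by (auto simp: U_def)
  have dU: "card (nbrs x U) \<le> 2 * t" for x
    unfolding U_def by (rule complete_parts_degree[OF B(1)]) (simp add: t)
  define R0 where "R0 = {x\<in>V. card (nbrs x U) + \<tau> \<le> 2 * t}"
  have R0V: "R0 \<subseteq> V"
    by (auto simp: R0_def)
  \<comment> \<open>Every vertex has at most \<open>2 * t\<close> neighbours in \<open>U\<close>,
    and those in \<open>R0\<close> have \<open>\<tau>\<close> fewer; but the degree sum of
    \<open>U\<close> is within \<open>2 / 3 * n\<close> and a constant of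
    \<open>2 * t * n\<close>.\<close>
  have "real \<tau> * card R0 \<le> n"
  proof -
    have "2 / 3 * (3 * real t - 1) * n - ((3 * real t)\<^sup>2 + edge_slack) \<le> real (deg_sum U V)"
      using deg_sum_lower[OF V U(3) many] U(2) unfolding n_def by simp
    also have "\<dots> = real (deg_sum V U)"
      using deg_sum_commute[OF V U(1)] by simp
    also have "\<dots> = (\<Sum>x\<in>V. real (card (nbrs x U)))"
      by (simp add: deg_sum_def)
    also have "\<dots> \<le> (\<Sum>x\<in>V. 2 * real t - (if x \<in> R0 then real \<tau> else 0))"
    proof (rule sum_mono)
      fix x assume "x \<in> V"
      show "real (card (nbrs x U)) \<le> 2 * real t - (if x \<in> R0 then real \<tau> else 0)"
        using dU[of x] by (auto simp: R0_def)
    qed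
    also have "\<dots> = 2 * real t * n - real \<tau> * card R0"
      using V R0V by (simp add: sum_subtractf sum.If_cases Int_absorb1 Int_absorb2 n_def)
    finally have "real \<tau> * card R0 \<le> 2 / 3 * n + ((3 * real t)\<^sup>2 + edge_slack)"
      by (simp add: algebra_simps)
    moreover have "a \<le> n" if "a \<le> 2 / 3 * n + T" "3 * T \<le> n" for a T
      using that by linarith
    ultimately show ?thesis
      using n(2) by blast
  qed
  then have "1 / e\<^sup>2 * card R0 \<le> n"
    using tau mult_right_mono[OF tau, of "real (card R0)"] by simp
  then have cR0: "card R0 \<le> e\<^sup>2 * n"
    using e2 by (simp add: field_simps)
  define A where "A i = {x\<in>V. nbrs x (B i) = {} \<and> x \<notin> R0}" for i
  have A_B: "t < card (nbrs x (B j)) + \<tau>" if "x \<in> A i" "i < 3" "j < 3" "i \<noteq> j" for x i j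
  proof -
    obtain l where l: "l < 3" "i \<noteq> l" "j \<noteq> l"
      using third_index \<open>i < 3\<close> \<open>j < 3\<close> by blast
    have "nbrs x U = nbrs x (B j) \<union> nbrs x (B l)"
      using three_indices[of i j l] l that unfolding U_def A_def by auto
    then have "card (nbrs x U) \<le> card (nbrs x (B j)) + card (nbrs x (B l))"
      by (simp add: card_Un_le)
    moreover have "card (nbrs x (B l)) \<le> t"
      using card_nbrs_le[of "B l" x] B(1) l by (simp add: complete_parts_def)
    moreover have "2 * t < card (nbrs x U) + \<tau>"
      using that by (auto simp: A_def R0_def)
    ultimately show ?thesis
      by linarith
  qed
  have A_B2: "x \<notin> B j" if "x \<in> A i" "i < 3" "j < 3" "i \<noteq> j" for x i j
  proof
    assume "x \<in> B j"
    then have "B i \<subseteq> nbrs x (B i)"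
      using B(1) that unfolding complete_parts_def by auto
    moreover have "B i \<noteq> {}"
      using B(1) that unfolding complete_parts_def t by fastforce
    ultimately show False
      using that by (auto simp: A_def)
  qed
  have A_disj: "A i \<inter> A j = {}" if "i < 3" "j < 3" "i \<noteq> j" for i j
  proof -
    have False if "x \<in> A i" "x \<in> A j" for x
      using A_B[OF that(1), of j] that(2) \<open>i < 3\<close> \<open>j < 3\<close> \<open>i \<noteq> j\<close> t by (auto simp: A_def)
    then show ?thesis by blast
  qed
  have V_eq: "V = R0 \<union> (\<Union>i<3. A i)"
    using complete_parts_misses_one[OF B(1)] R0V by (auto simp: A_def t)
  have indep: "\<not> adj x y" if "x \<in> A i" "y \<in> A i" "i < 3" for x y i
  proof -
    obtain j l where idx: "j < 3" "l < 3" "i \<noteq> j" "i \<noteq> l" "j \<noteq> l"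
      using other_indices[OF \<open>i < 3\<close>] by blast
    show ?thesis
      by (rule complete_parts_twins_nonadjacent[OF B(1), of \<tau> i j l])
         (use idx that A_B[of _ i] A_B2[of _ i] t in auto)
  qed
  have finA: "finite (A i)" for i
    using V by (simp add: A_def)
  have finR: "finite R0"
    using V R0V finite_subset by blast
  have RA: "R0 \<inter> A i = {}" for i
    by (auto simp: A_def)
  define a where "a i = real (card (A i))" for i
  have card_V: "n = card R0 + (\<Sum>i<3. a i)"
  proof -
    have "card V = card R0 + card (\<Union>i<3. A i)"
      using V_eq finR finA RA by (subst V_eq, subst card_Un_disjoint) auto
    also have "card (\<Union>i<3. A i) = (\<Sum>i<3. card (A i))"
      using finA A_disj by (intro card_UN_disjoint) auto
    finally show ?thesis
      unfolding n_def a_def by simp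
  qed
  have sum3: "(\<Sum>i<3. f i) = f i + f j + f l" if "i < 3" "j < 3" "l < 3" "i \<noteq> j" "i \<noteq> l" "j \<noteq> l"
    for f :: "nat \<Rightarrow> real" and i j l
    using three_indices[OF that] that by simp
  \<comment> \<open>All edges outside \<open>R0\<close> run between different classes, so the edge
    count forces nearly maximal products of class sizes.\<close>
  have size: "(1 / 3 - 3 * e) * n \<le> a i" "a i \<le> (1 / 3 + 2 * e) * n"
    if idx: "i < 3" "j < 3" "l < 3" "i \<noteq> j" "i \<noteq> l" "j \<noteq> l" for i j l
  proof -
    have "deg_sum V V \<le> 2 * deg_sum R0 V + deg_sum (V - R0) (V - R0)"
      using deg_sum_split[OF V R0V] by linarith
    also have "deg_sum R0 V \<le> card R0 * card V"
      using V by (intro deg_sum_le card_nbrs_le)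
    finally have 1: "deg_sum V V \<le> 2 * (card R0 * card V) + deg_sum (V - R0) (V - R0)"
      by simp
    have VR: "V - R0 = A i \<union> (A j \<union> A l)"
      using V_eq RA three_indices[OF idx] by auto
    have dA: "deg_sum (A p) (V - R0) \<le> card (A p) * (card (A q) + card (A r))"
      if "{p, q, r} = {i, j, l}" for p q r
    proof (rule deg_sum_le)
      show "finite (V - R0)" using V by simp
      fix x assume x: "x \<in> A p"
      have "p < 3" using that idx by auto
      have "(\<Union>m\<in>{p, q, r}. A m) = (\<Union>m\<in>{i, j, l}. A m)"
        using that by (simp only:)
      then have "V - R0 = A p \<union> A q \<union> A r"
        using VR by auto
      then have "nbrs x (V - R0) \<subseteq> A q \<union> A r"
        using indep[OF x _ \<open>p < 3\<close>] by auto
      then have "card (nbrs x (V - R0)) \<le> card (A q \<union> A r)"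
        using finA by (intro card_mono) auto
      then show "card (nbrs x (V - R0)) \<le> card (A q) + card (A r)"
        using card_Un_le[of "A q" "A r"] by linarith
    qed
    have "deg_sum (V - R0) (V - R0) = deg_sum (A i) (V - R0) + (deg_sum (A j) (V - R0) + deg_sum (A l) (V - R0))"
      unfolding VR using finA A_disj idx by (subst deg_sum_Un_left, auto, subst deg_sum_Un_left, auto)
    also have "\<dots> \<le> card (A i) * (card (A j) + card (A l)) + (card (A j) * (card (A i) + card (A l)) + card (A l) * (card (A i) + card (A j)))"
      by (intro add_mono dA) auto
    finally have "deg_sum V V \<le> 2 * (card R0 * card V) + (card (A i) * (card (A j) + card (A l)) + (card (A j) * (card (A i) + card (A l)) + card (A l) * (card (A i) + card (A j))))"
      using 1 by linarith
    then have "real (deg_sum V V) \<le> real (2 * (card R0 * card V) + (card (A i) * (card (A j) + card (A l)) + (card (A j) * (card (A i) + card (A l)) + card (A l) * (card (A i) + card (A j)))))"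
      by (simp only: of_nat_le_iff)
    also have "\<dots> = 2 * (real (card R0) * n) + 2 * (a i * a j + a i * a l + a j * a l)"
      by (simp add: a_def n_def algebra_simps)
    also have "real (card R0) * n \<le> e\<^sup>2 * n * n"
      using cR0 n(6) by (intro mult_right_mono) auto
    finally have 2: "2 / 3 * (n - 1)\<^sup>2 \<le> 2 * (a i * a j + a i * a l + a j * a l) + 2 * (e\<^sup>2 * n\<^sup>2)"
      using many unfolding n_def[symmetric] by (simp add: power2_eq_square)
    have 3: "n = card R0 + (a i + a j + a l)"
      using card_V sum3[OF idx] by simp
    have 4: "(1 - e\<^sup>2) * n = n - e\<^sup>2 * n"
      by (simp add: algebra_simps)
    show "(1 / 3 - 3 * e) * n \<le> a i" "a i \<le> (1 / 3 + 2 * e) * n"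
      by (rule part_size_bounds[of "a i" "a j" "a l" n e];
          use 2 3 4 e e2n n(6) cR0 in \<open>simp add: a_def\<close>)+
  qed
  define L where "L = {x\<in>V. card (nbrs x V) \<le> (2 / 3 - e) * n}"
  have LV: "L \<subseteq> V" "finite L"
    using V by (auto simp: L_def)
  have "card L \<le> s"
    unfolding s_def
  proof (rule few_low_degree_vertices[OF V many e(1) _ LV(1)])
    show "3 * ((real (nat \<lceil>1 / e\<rceil>))\<^sup>2 + edge_slack) < real (card V)"
      using n(3) unfolding s_def n_def .
  qed (simp add: L_def n_def)
  moreover have "s \<le> e * n"
    using n(4) e by (simp add: field_simps)
  ultimately have cL: "card L \<le> e * n"
    by linarith
  define X where "X = R0 \<union> L"
  define P where "P i = A i - L" for i
  have e2e: "e\<^sup>2 * n \<le> e * n"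
    using e n(6) by (intro mult_right_mono) (auto simp: power2_eq_square mult_le_cancel_left1)
  have size': "(1 / 3 - 3 * e) * n \<le> a i" "a i \<le> (1 / 3 + 2 * e) * n" if "i < 3" for i
  proof -
    obtain j l where "j < 3" "l < 3" "i \<noteq> j" "i \<noteq> l" "j \<noteq> l"
      using other_indices[OF \<open>i < 3\<close>] by blast
    then show "(1 / 3 - 3 * e) * n \<le> a i" "a i \<le> (1 / 3 + 2 * e) * n"
      using size that by blast+
  qed
  have expand: "(c + d * e) * n = c * n + d * (e * n)" "(c - d * e) * n = c * n - d * (e * n)" for c d :: real
    by (simp_all add: algebra_simps)
  have card_P: "a i - e * n \<le> card (P i)" "card (P i) \<le> a i" for i
  proof -
    have "card (A i) \<le> card (P i \<union> L)"
      using finA LV by (intro card_mono) (auto simp: P_def)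
    also have "\<dots> \<le> card (P i) + card L"
      by (rule card_Un_le)
    finally show "a i - e * n \<le> card (P i)"
      using cL unfolding a_def by linarith
    show "card (P i) \<le> a i"
      unfolding a_def P_def using finA by (simp add: card_mono)
  qed
  have "near_tripartite (7 * e) V X P"
    unfolding near_tripartite_def n_def[symmetric]
  proof (intro conjI allI impI ballI)
    show "V = X \<union> (\<Union>i<3. P i)"
      using V_eq LV by (auto simp: X_def P_def)
    have "card X \<le> card R0 + card L"
      unfolding X_def by (rule card_Un_le)
    then show "card X \<le> 7 * e * n"
      using cR0 cL e2e e n(6) mult_nonneg_nonneg[of e n] by linarith
    fix i :: nat assume i: "i < 3"
    show "P i \<inter> X = {}"
      using RA by (auto simp: P_def X_def)
    show "(1 / 3 - 7 * e) * n \<le> card (P i)" "card (P i) \<le> (1 / 3 + 7 * e) * n"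
      using size'[OF i] card_P[of i] e n(6) mult_nonneg_nonneg[of e n] unfolding expand by linarith+
    show "nbrs x (P i) = {}" if "x \<in> P i" for x
      using indep[OF _ _ i] that by (auto simp: P_def)
    fix j :: nat assume j: "j < 3" "i \<noteq> j"
    show "P i \<inter> P j = {}"
      using A_disj[OF i j] by (auto simp: P_def)
    fix x assume x: "x \<in> P i"
    obtain l where l: "l < 3" "i \<noteq> l" "j \<noteq> l"
      using third_index i j by blast
    \<comment> \<open>Origin of the factor 7: of a degree above \<open>(2 / 3 - e) * n\<close>, at
      most \<open>(1 / 3 + 2 * e) * n\<close> goes to \<open>A l\<close> and
      \<open>2 * e * n\<close> to \<open>X\<close>. So \<open>(1 / 3 - 5 * e) * n\<close> is left
      for \<open>P j\<close>, whose size is at most \<open>(1 / 3 + 2 * e) * n\<close>.\<close>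
    have "nbrs x V \<subseteq> nbrs x (P j) \<union> A l \<union> X"
      using V_eq three_indices[OF i j(1) l(1) j(2) l(2,3)] indep[OF _ _ i] x
      by (auto simp: P_def X_def)
    then have "card (nbrs x V) \<le> card (nbrs x (P j) \<union> A l \<union> X)"
      using finA finR LV by (intro card_mono) (auto simp: P_def X_def)
    also have "\<dots> \<le> card (nbrs x (P j) \<union> A l) + card X"
      by (rule card_Un_le)
    also have "card (nbrs x (P j) \<union> A l) \<le> card (nbrs x (P j)) + card (A l)"
      by (rule card_Un_le)
    finally have "card (nbrs x V) \<le> card (nbrs x (P j)) + card (A l) + card X"
      by simp
    moreover have "(2 / 3 - 1 * e) * n < card (nbrs x V)"
      using x V_eq i unfolding P_def L_def by auto
    ultimately have "(2 / 3 - 1 * e) * n < card (nbrs x (P j)) + a l + (card R0 + card L)"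
      using \<open>card X \<le> card R0 + card L\<close> unfolding a_def by linarith
    then show "card (P j) - 7 * e * n \<le> card (nbrs x (P j))"
      using size'[OF l(1)] size'[OF j(1)] card_P[of j] cR0 cL e2e unfolding expand by linarith
  qed (use V in auto)
  then show ?thesis
    by blast
qed

end

section \<open>Exceptional vertices\<close>

text \<open>Degree sums over four vertices suffice: at most three for an obstruction and one more to
  be compared with it. In \<open>not_3_colourable\<close> every colour has to occur because the
  members of a partition in \<open>r_partite\<close> are nonempty.\<close>

locale dense_wheel_free = wheel_free +
  fixes V :: "'a set" and \<epsilon> :: real
  assumes finite_V: "finite V"
    and slack_pos: "0 < \<epsilon>"
    and order_large: "real k + 10 \<le> \<epsilon> * card V"
    and degree_sum: "\<lbrakk>U \<subseteq> V; card U \<le> 4\<rbrakk> \<Longrightarrow>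
       2 / 3 * (real (card U) - 1) * card V - \<epsilon> * card V \<le> deg_sum U V"
    and not_3_colourable: "\<lbrakk>\<And>x. x \<in> V \<Longrightarrow> f x < (3 :: nat); \<And>i. i < 3 \<Longrightarrow> \<exists>x\<in>V. f x = i\<rbrakk>
       \<Longrightarrow> \<exists>x\<in>V. \<exists>y\<in>V. adj x y \<and> f x = f y"

locale near_partition = dense_wheel_free +
  fixes \<eta> :: real and X :: "'a set" and P :: "nat \<Rightarrow> 'a set"
  assumes near: "near_tripartite \<eta> V X P" and eta: "\<epsilon> \<le> \<eta>" "\<eta> \<le> 1 / 1000"
begin

definition n :: real where "n = real (card V)"
text \<open>The unit in which all errors are measured; by \<open>h_ge\<close> it also absorbs
  \<open>k\<close> and additive constants.\<close>

definition h :: real where "h = \<eta> * n"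

lemma h_le: "1000 * h \<le> n"
  using eta(2) mult_right_mono[of \<eta> "1 / 1000" n] by (simp add: h_def n_def)

lemma slack_le_h: "\<epsilon> * n \<le> h"
  using eta(1) by (simp add: h_def n_def mult_right_mono)

lemma h_ge: "real k + 10 \<le> h"
  using slack_le_h order_large by (simp add: n_def)

lemma V_eq: "V = X \<union> (\<Union>i<3. P i)"
  using near by (simp add: near_tripartite_def)

lemma finite_parts: "finite X" "i < 3 \<Longrightarrow> finite (P i)"
proof -
  show "finite X"
    using finite_V V_eq by (metis finite_Un)
  have "finite (\<Union>i<3. P i)"
    using finite_V V_eq by (metis finite_Un)
  then show "finite (P i)" if "i < 3"
    using that by (meson UN_upper finite_subset lessThan_iff)
qed

lemma X_subset: "X \<subseteq> V"
  using V_eq by blast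

lemma P_subset: "i < 3 \<Longrightarrow> P i \<subseteq> V"
  using V_eq by blast

lemma P_disjoint: "\<lbrakk>i < 3; j < 3; i \<noteq> j\<rbrakk> \<Longrightarrow> P i \<inter> P j = {}"
  using near unfolding near_tripartite_def by blast

lemma P_X_disjoint: "i < 3 \<Longrightarrow> P i \<inter> X = {}"
  using near unfolding near_tripartite_def by blast

lemma card_X: "card X \<le> h"
  using near unfolding near_tripartite_def h_def n_def by blast

lemma card_P: "i < 3 \<Longrightarrow> n / 3 - h \<le> card (P i)" "i < 3 \<Longrightarrow> card (P i) \<le> n / 3 + h"
proof -
  have "(1 / 3 - \<eta>) * n = n / 3 - h" "(1 / 3 + \<eta>) * n = n / 3 + h"
    by (simp_all add: h_def algebra_simps)
  then show "i < 3 \<Longrightarrow> n / 3 - h \<le> card (P i)" "i < 3 \<Longrightarrow> card (P i) \<le> n / 3 + h"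
    using near unfolding near_tripartite_def n_def by metis+
qed

lemma P_nonempty: "i < 3 \<Longrightarrow> P i \<noteq> {}"
  using card_P(1)[of i] h_le h_ge by fastforce

lemma P_indep: "i < 3 \<Longrightarrow> x \<in> P i \<Longrightarrow> y \<in> P i \<Longrightarrow> \<not> adj x y"
  using near unfolding near_tripartite_def by (metis empty_iff mem_nbrs)

lemma card_nbrs_P: "\<lbrakk>i < 3; j < 3; i \<noteq> j; x \<in> P i\<rbrakk> \<Longrightarrow> card (P j) - h \<le> card (nbrs x (P j))"
  using near unfolding near_tripartite_def h_def n_def by blast

text \<open>Missing at most \<open>h\<close> vertices of a class implies missing at most
  \<open>h\<close> of any subset. This is how adjacency is found inside the neighbourhoods of
  exceptional vertices.\<close>

lemma card_nbrs_sub: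
  assumes "i < 3" "j < 3" "i \<noteq> j" "x \<in> P i" "Q \<subseteq> P j"
  shows "card Q \<le> card (nbrs x Q) + h"
proof -
  have fin: "finite (P j)" "finite Q"
    using finite_parts assms finite_subset by blast+
  have "card (Q - nbrs x Q) \<le> card (P j - nbrs x (P j))"
    using assms fin by (intro card_mono) auto
  moreover have "card (P j - nbrs x (P j)) = card (P j) - card (nbrs x (P j))"
    using fin by (simp add: card_Diff_subset nbrs_subset)
  moreover have "card (Q - nbrs x Q) = card Q - card (nbrs x Q)"
    using fin by (simp add: card_Diff_subset nbrs_subset)
  moreover have "card (nbrs x (P j)) \<le> card (P j)" "card (nbrs x Q) \<le> card Q"
    using fin by (auto intro: card_nbrs_le)
  moreover have "card (P j) - h \<le> card (nbrs x (P j))"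
    using card_nbrs_P assms by blast
  ultimately show ?thesis
    by linarith
qed

lemma card_common_nbrs_sub:
  assumes "i < 3" "j < 3" "i \<noteq> j" "x \<in> P i" "y \<in> P i" "Q \<subseteq> P j"
  shows "card Q \<le> card (nbrs x Q \<inter> nbrs y Q) + 2 * h"
proof -
  have "nbrs y (nbrs x Q) = nbrs x Q \<inter> nbrs y Q"
    by auto
  moreover have "card (nbrs x Q) \<le> card (nbrs y (nbrs x Q)) + h"
    using assms by (intro card_nbrs_sub[of i j]) auto
  moreover have "card Q \<le> card (nbrs x Q) + h"
    using assms by (intro card_nbrs_sub[of i j]) auto
  ultimately show ?thesis
    by simp
qed

lemma ex_other:
  assumes "1 < real (card S)"
  shows "\<exists>y\<in>S. y \<noteq> b"
proof -
  have "\<not> S \<subseteq> {b}"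
    using assms card_mono[of "{b}" S] by fastforce
  then show ?thesis by blast
qed

lemma ex_elem: "0 < real (card S) \<Longrightarrow> \<exists>y. y \<in> S"
  by (metis card.empty ex_in_conv of_nat_0 less_irrefl)

text \<open>Otherwise \<open>a\<close> is the hub of a wheel whose rim is \<open>x\<close> and a
  path from \<open>b\<close> to \<open>c\<close> among the neighbours of \<open>a\<close> in the
  other two classes.\<close>

lemma no_cherry:
  assumes idx: "i < 3" "j < 3" "l < 3" "i \<noteq> j" "i \<noteq> l" "j \<noteq> l"
    and x: "x \<in> X" "a \<in> nbrs x (P i)" "b \<in> nbrs x (P j)" "c \<in> nbrs x (P l)"
    and "adj a b" "adj a c"
  shows False
proof -
  define S where "S m = nbrs a (P m)" for m
  have S: "n / 3 - 2 * h \<le> card (S j)" "n / 3 - 2 * h \<le> card (S l)" "S j \<subseteq> P j" "S l \<subseteq> P l"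
    using card_nbrs_P[of i j a] card_nbrs_P[of i l a] card_P[of j] card_P[of l] x idx
    unfolding S_def by auto
  have "card (S j) \<le> card (nbrs c (S j)) + h"
    using x idx S by (intro card_nbrs_sub[of l j]) auto
  then have "1 < real (card (nbrs c (S j)))"
    using S h_le h_ge by linarith
  then obtain p' where p': "p' \<in> nbrs c (S j)" "p' \<noteq> b"
    using ex_other[of "nbrs c (S j)" b] by blast
  have notin: "x \<notin> S j" "x \<notin> S l"
    using S x idx P_X_disjoint by blast+
  show False
  proof (rule no_wheel_one[of "S j" "S l" x b c p' a])
    show "finite (S j)" "finite (S l)"
      using finite_parts idx by (auto simp: S_def)
    show "S j \<inter> S l = {}"
      using S P_disjoint idx by blast
    show "k \<le> card (S j)"
      using S h_le h_ge by linarith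
    show "k \<le> card (nbrs p (S l) \<inter> nbrs p' (S l))" if "p \<in> S j" "p' \<in> S j" for p p'
    proof -
      have "card (S l) \<le> card (nbrs p (S l) \<inter> nbrs p' (S l)) + 2 * h"
        using that idx S by (intro card_common_nbrs_sub[of j l]) auto
      then show ?thesis
        using S h_le h_ge by linarith
    qed
  qed (use assms p' notin adj_sym in \<open>auto simp: S_def\<close>)
qed

text \<open>Otherwise \<open>b\<close> is the hub of a wheel: its rim is the edge
  \<open>x y\<close>, closed by a path between \<open>c\<close> and \<open>d\<close> that starts and
  ends in \<open>P l\<close>.\<close>

lemma no_distinct_reps:
  assumes idx: "i < 3" "j < 3" "l < 3" "i \<noteq> j" "i \<noteq> l" "j \<noteq> l"
    and "x \<in> X" "y \<in> X" "adj x y" "b \<in> P j" "adj x b" "adj y b"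
    and "c \<in> nbrs b (P l)" "d \<in> nbrs b (P l)" "adj x c" "adj y d"
  shows "c = d"
proof (rule ccontr)
  assume "c \<noteq> d"
  define S where "S m = nbrs b (P m)" for m
  have S: "n / 3 - 2 * h \<le> card (S i)" "n / 3 - 2 * h \<le> card (S l)" "S i \<subseteq> P i" "S l \<subseteq> P l"
    using card_nbrs_P[of j i b] card_nbrs_P[of j l b] card_P[of i] card_P[of l] assms
    unfolding S_def by auto
  have notin: "x \<notin> S i" "x \<notin> S l" "y \<notin> S i" "y \<notin> S l"
    using S assms P_X_disjoint by blast+
  show False
  proof (rule no_wheel_two[of "S l" "S i" x y c d b])
    show "finite (S l)" "finite (S i)"
      using finite_parts idx by (auto simp: S_def)
    show "S l \<inter> S i = {}"
      using S P_disjoint idx by blast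
    show "k \<le> card (S l)"
      using S h_le h_ge by linarith
    show "k - 1 \<le> card (nbrs p (S i) \<inter> nbrs p' (S i))" if "p \<in> S l" "p' \<in> S l" for p p'
    proof -
      have "card (S i) \<le> card (nbrs p (S i) \<inter> nbrs p' (S i)) + 2 * h"
        using that idx S by (intro card_common_nbrs_sub[of l i]) auto
      then show ?thesis
        using S h_le h_ge by linarith
    qed
  qed (use assms notin \<open>c \<noteq> d\<close> adj_sym in \<open>auto simp: S_def\<close>)
qed

text \<open>Here \<open>b\<close> would be the hub of a wheel whose rim is the path
  \<open>v u w\<close>, closed by a path from \<open>c\<close> to \<open>a\<close> among the
  neighbours of \<open>b\<close>.\<close>

lemma no_fan:
  assumes idx: "i < 3" "j < 3" "l < 3" "i \<noteq> j" "i \<noteq> l" "j \<noteq> l"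
    and "u \<in> X" "v \<in> X" "w \<in> X" "v \<noteq> w" "adj u v" "adj u w"
    and "b \<in> P j" "adj u b" "adj v b" "adj w b"
    and "c \<in> nbrs b (P l)" "a \<in> nbrs b (P i)" "adj v c" "adj w a" "adj c a"
  shows False
proof -
  define S where "S m = nbrs b (P m)" for m
  have S: "n / 3 - 2 * h \<le> card (S i)" "n / 3 - 2 * h \<le> card (S l)" "S i \<subseteq> P i" "S l \<subseteq> P l"
    using card_nbrs_P[of j i b] card_nbrs_P[of j l b] card_P[of i] card_P[of l] assms
    unfolding S_def by auto
  have "card (S l) \<le> card (nbrs a (S l)) + h"
    using assms S by (intro card_nbrs_sub[of i l]) auto
  then have "1 < real (card (nbrs a (S l)))"
    using S h_le h_ge by linarith
  then obtain p' where p': "p' \<in> nbrs a (S l)" "p' \<noteq> c"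
    using ex_other[of "nbrs a (S l)" c] by blast
  show False
  proof (rule no_wheel_three[of "S l" "S i" u v w c a p' b])
    show "finite (S l)" "finite (S i)"
      using finite_parts idx by (auto simp: S_def)
    show "S l \<inter> S i = {}"
      using S P_disjoint idx by blast
    show "{u, v, w} \<inter> (S l \<union> S i) = {}"
      using S assms P_X_disjoint by blast
    show "k \<le> card (S l)"
      using S h_le h_ge by linarith
    show "k \<le> card (nbrs p (S i) \<inter> nbrs p' (S i))" if "p \<in> S l" "p' \<in> S l" for p p'
    proof -
      have "card (S i) \<le> card (nbrs p (S i) \<inter> nbrs p' (S i)) + 2 * h"
        using that idx S by (intro card_common_nbrs_sub[of l i]) auto
      then show ?thesis
        using S h_le h_ge by linarith
    qed
  qed (use assms p' adj_sym in \<open>auto simp: S_def\<close>)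
qed

lemma degree_le:
  assumes idx: "i < 3" "j < 3" "l < 3" "i \<noteq> j" "i \<noteq> l" "j \<noteq> l"
  shows "card (nbrs x V) \<le> card (nbrs x (P i)) + card (nbrs x (P j)) + card (nbrs x (P l)) + h"
proof -
  have "V = P i \<union> P j \<union> P l \<union> X"
    using V_eq unfolding three_indices[OF idx] by blast
  then have "nbrs x V = nbrs x (P i) \<union> nbrs x (P j) \<union> nbrs x (P l) \<union> nbrs x X"
    by (metis nbrs_Un)
  then have "card (nbrs x V) \<le> card (nbrs x (P i) \<union> nbrs x (P j) \<union> nbrs x (P l)) + card (nbrs x X)"
    by (simp add: card_Un_le)
  also have "card (nbrs x (P i) \<union> nbrs x (P j) \<union> nbrs x (P l)) \<le>
     card (nbrs x (P i) \<union> nbrs x (P j)) + card (nbrs x (P l))"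
    by (rule card_Un_le)
  also have "card (nbrs x (P i) \<union> nbrs x (P j)) \<le> card (nbrs x (P i)) + card (nbrs x (P j))"
    by (rule card_Un_le)
  finally have "card (nbrs x V) \<le> card (nbrs x (P i)) + card (nbrs x (P j)) + card (nbrs x (P l)) + card (nbrs x X)"
    by simp
  moreover have "card (nbrs x X) \<le> card X"
    using finite_parts by (intro card_nbrs_le)
  ultimately show ?thesis
    using card_X by linarith
qed

lemma card_nbrs_P_le: "i < 3 \<Longrightarrow> card (nbrs x (P i)) \<le> n / 3 + h"
  using card_nbrs_le[of "P i" x] finite_parts(2)[of i] card_P(2)[of i] by fastforce

text \<open>Let \<open>x\<close> have neighbours \<open>b\<close> and \<open>c\<close> in two
  classes, and let \<open>Q\<close> be its neighbourhood in the third. By \<open>no_cherry\<close>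
  no vertex of \<open>Q\<close> is adjacent to both, though each misses at most \<open>h\<close> of
  \<open>Q\<close>; so \<open>Q\<close> has at most \<open>2 * h\<close> elements. The three classes
  and \<open>X\<close> together give \<open>7 * h\<close>.\<close>

lemma empty_or_low:
  assumes "x \<in> X"
  shows "(\<exists>i<3. nbrs x (P i) = {}) \<or> card (nbrs x V) \<le> 7 * h"
proof (rule disjCI)
  assume "\<not> card (nbrs x V) \<le> 7 * h"
  show "\<exists>i<3. nbrs x (P i) = {}"
  proof (rule ccontr)
    assume *: "\<not> ?thesis"
    have small: "card (nbrs x (P i)) \<le> 2 * h"
      if idx: "i < 3" "j < 3" "l < 3" "i \<noteq> j" "i \<noteq> l" "j \<noteq> l" for i j l
    proof -
      obtain b where b: "b \<in> nbrs x (P j)"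
        using * idx by blast
      obtain c where c: "c \<in> nbrs x (P l)"
        using * idx by blast
      define Q where "Q = nbrs x (P i)"
      have Q: "Q \<subseteq> P i" "finite Q"
        using idx finite_parts by (auto simp: Q_def)
      have "card Q \<le> card (nbrs b Q) + h"
        using b Q idx by (intro card_nbrs_sub[of j i]) auto
      moreover have "card Q \<le> card (nbrs c Q) + h"
        using c Q idx by (intro card_nbrs_sub[of l i]) auto
      moreover have "nbrs b Q \<inter> nbrs c Q = {}"
      proof -
        have False if "a \<in> nbrs b Q" "a \<in> nbrs c Q" for a
          using no_cherry[OF idx assms, of a b c] b c that adj_sym[of b a] adj_sym[of c a]
          by (simp add: Q_def)
        then show ?thesis by blast
      qed
      then have "card (nbrs b Q) + card (nbrs c Q) \<le> card Q"
        using Q by (subst card_Un_disjoint[symmetric]) (auto intro!: card_mono)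
      ultimately show ?thesis
        unfolding Q_def by linarith
    qed
    have "card (nbrs x V) \<le> 7 * h"
      using small[of 0 1 2] small[of 1 0 2] small[of 2 0 1] degree_le[of 0 1 2 x] by simp
    then show False
      using \<open>\<not> card (nbrs x V) \<le> 7 * h\<close> by blast
  qed
qed

text \<open>Adding a vertex to \<open>U\<close> in \<open>degree_sum\<close> shows that every vertex
  outside \<open>U\<close> has degree at least \<open>2 / 3 * n - 9 * h\<close>. Such a vertex of
  \<open>X\<close> misses exactly one class and is put into it.\<close>

lemma shrink_exceptional_set:
  assumes U: "U \<subseteq> X" "card U \<le> 3"
    and low: "deg_sum U V \<le> 2 / 3 * (real (card U) - 1) * n + 8 * h"
  shows "\<exists>P'. near_tripartite (20 * \<eta>) V U P'"
proof -
  have finU: "finite U"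
    using U finite_parts finite_subset by blast
  have high: "2 / 3 * n - 9 * h \<le> card (nbrs z V)" if "z \<in> V - U" for z
  proof -
    have "2 / 3 * (real (card (insert z U)) - 1) * card V - \<epsilon> * card V \<le> deg_sum (insert z U) V"
      using that U X_subset finU by (intro degree_sum) auto
    moreover have "deg_sum (insert z U) V = card (nbrs z V) + deg_sum U V"
      using that finU by (simp add: deg_sum_def)
    moreover have "real (card (insert z U)) - 1 = real (card U)"
      using that finU by simp
    ultimately have "2 / 3 * real (card U) * n - \<epsilon> * n \<le> card (nbrs z V) + real (deg_sum U V)"
      by (simp add: n_def)
    moreover have "2 / 3 * (real (card U) - 1) * n = 2 / 3 * real (card U) * n - 2 / 3 * n"
      by (simp add: field_simps)
    ultimately show ?thesis
      using low slack_le_h by linarith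
  qed
  define P' where "P' i = P i \<union> {z \<in> X - U. nbrs z (P i) = {}}" for i
  have big: "n / 3 - 11 * h \<le> card (nbrs z (P j))"
    if idx: "i < 3" "j < 3" "l < 3" "i \<noteq> j" "i \<noteq> l" "j \<noteq> l" and z: "z \<in> X - U" "nbrs z (P i) = {}" for z i j l
    using high[of z] degree_le[OF idx, of z] card_nbrs_P_le[of l z] z X_subset idx by auto
  have X_P': "\<exists>i<3. z \<in> P' i" if "z \<in> X - U" for z
    using empty_or_low[of z] high[of z] that X_subset h_le h_ge by (auto simp: P'_def)
  have P'_disj: "P' i \<inter> P' j = {}" if ij: "i < 3" "j < 3" "i \<noteq> j" for i j
  proof -
    obtain l where l: "l < 3" "i \<noteq> l" "j \<noteq> l"
      using third_index ij by blast
    have False if "z \<in> X - U" "nbrs z (P i) = {}" "nbrs z (P j) = {}" for z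
      using big[OF ij(1,2) l(1) ij(3) l(2,3) that(1,2)] that h_le h_ge by simp
    then show ?thesis
      using P_disjoint[OF ij] P_X_disjoint[OF ij(1)] P_X_disjoint[OF ij(2)] by (auto simp: P'_def)
  qed
  have P'_indep: "\<not> adj x y" if i: "i < 3" and xy: "x \<in> P' i" "y \<in> P' i" for i x y
  proof
    assume "adj x y"
    have X: "x \<in> X - U" "nbrs x (P i) = {}" "y \<in> X - U" "nbrs y (P i) = {}"
      using xy \<open>adj x y\<close> adj_sym[OF \<open>adj x y\<close>] P_indep[OF i] by (auto simp: P'_def)
    obtain j l where "j < 3" "l < 3" "i \<noteq> j" "i \<noteq> l" "j \<noteq> l"
      using other_indices[OF i] by blast
    then have idx: "i < 3" "j < 3" "l < 3" "i \<noteq> j" "i \<noteq> l" "j \<noteq> l" and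
      idx': "i < 3" "l < 3" "j < 3" "i \<noteq> l" "i \<noteq> j" "l \<noteq> j"
      using i by auto
    have "card (nbrs x (P j) \<union> nbrs y (P j)) \<le> card (P j)"
      using finite_parts idx by (intro card_mono) auto
    moreover have "card (nbrs x (P j)) + card (nbrs y (P j)) =
        card (nbrs x (P j) \<union> nbrs y (P j)) + card (nbrs x (P j) \<inter> nbrs y (P j))"
      using finite_parts idx by (intro card_Un_Int) auto
    ultimately have "0 < real (card (nbrs x (P j) \<inter> nbrs y (P j)))"
      using big[OF idx X(1,2)] big[OF idx X(3,4)] card_P[of j] idx h_le h_ge by linarith
    then obtain b where b: "b \<in> nbrs x (P j) \<inter> nbrs y (P j)"
      using ex_elem by blast
    have "card (nbrs x (P l)) \<le> card (nbrs b (nbrs x (P l))) + h"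
      using b idx by (intro card_nbrs_sub[of j l]) auto
    then have "0 < real (card (nbrs b (nbrs x (P l))))"
      using big[OF idx' X(1,2)] h_le h_ge by linarith
    then obtain c where c: "c \<in> nbrs b (nbrs x (P l))"
      using ex_elem by blast
    have "card (nbrs y (P l)) \<le> card (nbrs b (nbrs y (P l))) + h"
      using b idx by (intro card_nbrs_sub[of j l]) auto
    then have "1 < real (card (nbrs b (nbrs y (P l))))"
      using big[OF idx' X(3,4)] h_le h_ge by linarith
    then obtain d where d: "d \<in> nbrs b (nbrs y (P l))" "d \<noteq> c"
      using ex_other[of "nbrs b (nbrs y (P l))" c] by blast
    show False
      using no_distinct_reps[OF idx, of x y b c d] X \<open>adj x y\<close> b c d by auto
  qed
  have card_P': "card (P i) \<le> card (P' i)" "card (P' i) \<le> card (P i) + h" if "i < 3" for i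
  proof -
    have fin: "finite (P i)" "finite X"
      using that finite_parts by auto
    then show "card (P i) \<le> card (P' i)"
      by (intro card_mono) (auto simp: P'_def)
    have "card (P' i) \<le> card (P i \<union> X)"
      using fin by (intro card_mono) (auto simp: P'_def)
    also have "\<dots> \<le> card (P i) + card X"
      by (rule card_Un_le)
    finally show "card (P' i) \<le> card (P i) + h"
      using card_X by linarith
  qed
  have "near_tripartite (20 * \<eta>) V U P'"
    unfolding near_tripartite_def n_def[symmetric]
  proof (intro conjI allI impI ballI)
    have h20: "20 * \<eta> * n = 20 * h"
      by (simp add: h_def)
    show "V = U \<union> (\<Union>i<3. P' i)"
    proof
      show "V \<subseteq> U \<union> (\<Union>i<3. P' i)"
        using V_eq X_P' by (fastforce simp: P'_def)
      show "U \<union> (\<Union>i<3. P' i) \<subseteq> V"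
        using V_eq U by (auto simp: P'_def)
    qed
    have "card U \<le> card X"
      using U finite_parts by (intro card_mono)
    then show "card U \<le> 20 * \<eta> * n"
      using card_X h_ge unfolding h20 by linarith
    fix i :: nat assume i: "i < 3"
    show "P' i \<inter> U = {}"
      using P_X_disjoint[OF i] U by (auto simp: P'_def)
    show "(1 / 3 - 20 * \<eta>) * n \<le> card (P' i)" "card (P' i) \<le> (1 / 3 + 20 * \<eta>) * n"
    proof -
      have "(1 / 3 - 20 * \<eta>) * n = n / 3 - 20 * h" "(1 / 3 + 20 * \<eta>) * n = n / 3 + 20 * h"
        by (simp_all add: h_def algebra_simps)
      then show "(1 / 3 - 20 * \<eta>) * n \<le> card (P' i)" "card (P' i) \<le> (1 / 3 + 20 * \<eta>) * n"
        using card_P'[OF i] card_P[OF i] h_ge by linarith+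
    qed
    show "nbrs x (P' i) = {}" if "x \<in> P' i" for x
      using P'_indep[OF i that] by auto
    fix j :: nat assume j: "j < 3" "i \<noteq> j"
    show "P' i \<inter> P' j = {}"
      using P'_disj[OF i j] .
    fix x assume x: "x \<in> P' i"
    obtain l where l: "l < 3" "i \<noteq> l" "j \<noteq> l"
      using third_index i j by blast
    \<comment> \<open>A class also gains at most \<open>h\<close> new vertices, so 13 would already
      do for the factor 20.\<close>
    have "card (P j) - 12 * h \<le> card (nbrs x (P j))"
    proof (cases "x \<in> P i")
      case True
      then show ?thesis
        using card_nbrs_P[OF i j True] h_ge by linarith
    next
      case False
      then have "x \<in> X - U" "nbrs x (P i) = {}"
        using x by (auto simp: P'_def)
      from big[OF i j(1) l(1) j(2) l(2,3) this] show ?thesis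
        using card_P[OF j(1)] by linarith
    qed
    moreover have "card (nbrs x (P j)) \<le> card (nbrs x (P' j))"
      using finite_parts j by (intro card_nbrs_mono) (auto simp: P'_def)
    ultimately show "card (P' j) - 20 * \<eta> * n \<le> card (nbrs x (P' j))"
      using card_P'[OF j(1)] h_ge unfolding h20 by linarith
  qed (rule finite_V)
  then show ?thesis
    by blast
qed

end

section \<open>Obstructions to extending the colouring to the exceptional set\<close>

context near_partition
begin

text \<open>Let \<open>g\<close> be extended by colouring each \<open>P i\<close> with
  \<open>i\<close>. An edge with equally coloured ends exists, and it must lie in \<open>X\<close>:
  the classes are independent, and \<open>x\<close> has no neighbour in the class that gives it its
  colour.\<close>

lemma monochromatic_edge:
  assumes g: "\<And>x. x \<in> X \<Longrightarrow> g x < 3 \<and> nbrs x (P (g x)) = {}"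
  shows "\<exists>x\<in>X. \<exists>y\<in>X. adj x y \<and> g x = g y"
proof -
  define f where "f z = (if z \<in> X then g z else (THE i. i < 3 \<and> z \<in> P i))" for z
  have f_P: "f z = i" if "z \<in> P i" "i < 3" for z i
  proof -
    have "z \<notin> X"
      using P_X_disjoint that by blast
    moreover have "(THE i. i < 3 \<and> z \<in> P i) = i"
      using that P_disjoint by (intro the_equality) blast+
    ultimately show ?thesis
      by (simp add: f_def)
  qed
  have f_X: "f z = g z" if "z \<in> X" for z
    using that by (simp add: f_def)
  have "\<exists>x\<in>V. \<exists>y\<in>V. adj x y \<and> f x = f y"
  proof (rule not_3_colourable)
    fix z assume "z \<in> V"
    then show "f z < 3"
      using V_eq f_P f_X g by (metis UN_E Un_iff lessThan_iff)
  next
    fix i :: nat assume "i < 3"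
    then show "\<exists>x\<in>V. f x = i"
      using P_nonempty[of i] f_P P_subset by blast
  qed
  then obtain x y where xy: "x \<in> V" "y \<in> V" "adj x y" "f x = f y"
    by blast
  have no: False if "a \<in> X" "b \<in> P i" "i < 3" "adj a b" "f a = f b" for a b i
    using g[OF that(1)] f_P[OF that(2,3)] f_X[OF that(1)] that by auto
  show ?thesis
  proof (cases "x \<in> X")
    case True
    then have "y \<in> X"
      using no[of x y] xy V_eq by blast
    then show ?thesis
      using True xy f_X by metis
  next
    case False
    then obtain i where i: "i < 3" "x \<in> P i"
      using xy V_eq by blast
    then have "y \<notin> X"
      using no[of y x i] xy adj_sym by metis
    then obtain j where j: "j < 3" "y \<in> P j"
      using xy V_eq by blast
    then show ?thesis
      using i xy f_P P_indep by metis
  qed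
qed

lemma card_union_inter_nbrs:
  assumes "i < 3"
  shows "card (nbrs x (P i)) + card (nbrs y (P i)) \<le> n / 3 + h + card (nbrs x (P i) \<inter> nbrs y (P i))"
proof -
  have "card (nbrs x (P i) \<union> nbrs y (P i)) \<le> card (P i)"
    using finite_parts(2)[OF assms] by (intro card_mono) auto
  moreover have "card (nbrs x (P i)) + card (nbrs y (P i)) =
      card (nbrs x (P i) \<union> nbrs y (P i)) + card (nbrs x (P i) \<inter> nbrs y (P i))"
    using finite_parts(2)[OF assms] by (intro card_Un_Int) auto
  ultimately show ?thesis
    using card_P(2)[OF assms] by linarith
qed

text \<open>Some common neighbour \<open>b\<close> in \<open>P j\<close> is adjacent to a neighbour
  \<open>c\<close> of \<open>x\<close> in \<open>P l\<close>. By \<open>no_distinct_reps\<close>,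
  \<open>b\<close> sees no neighbour of \<open>y\<close> in \<open>P l\<close> other than
  \<open>c\<close>, yet it misses at most \<open>h\<close> of them.\<close>

lemma few_common_or_low:
  assumes idx: "i < 3" "j < 3" "l < 3" "i \<noteq> j" "i \<noteq> l" "j \<noteq> l"
    and xy: "x \<in> X" "y \<in> X" "adj x y" and ne: "nbrs x (P l) \<noteq> {}"
    and common: "h < card (nbrs x (P j) \<inter> nbrs y (P j))"
  shows "card (nbrs y (P l)) \<le> 2 * h"
proof -
  obtain c where c: "c \<in> nbrs x (P l)"
    using ne by blast
  define Q where "Q = nbrs x (P j) \<inter> nbrs y (P j)"
  have "card Q \<le> card (nbrs c Q) + h"
    using c idx by (intro card_nbrs_sub[of l j]) (auto simp: Q_def)
  then have "0 < real (card (nbrs c Q))"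
    using common unfolding Q_def by linarith
  then obtain b where b: "b \<in> nbrs c Q"
    using ex_elem by blast
  have "d = c" if "d \<in> nbrs b (nbrs y (P l))" for d
    using no_distinct_reps[OF idx xy, of b c d] b c that adj_sym[of c b] by (auto simp: Q_def)
  then have "nbrs b (nbrs y (P l)) \<subseteq> {c}"
    by blast
  then have "card (nbrs b (nbrs y (P l))) \<le> 1"
    using card_mono[of "{c}" "nbrs b (nbrs y (P l))"] by simp
  moreover have "card (nbrs y (P l)) \<le> card (nbrs b (nbrs y (P l))) + h"
    using b idx by (intro card_nbrs_sub[of j l]) (auto simp: Q_def)
  ultimately show ?thesis
    using h_ge by linarith
qed

text \<open>Many common neighbours in one class force both vertices to have few neighbours in the
  other; this case gives the \<open>8 * h\<close>. With few common neighbours in both classes,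
  inclusion-exclusion bounds the degrees.\<close>

lemma twin_degrees:
  assumes idx: "i < 3" "j < 3" "l < 3" "i \<noteq> j" "i \<noteq> l" "j \<noteq> l"
    and xy: "x \<in> X" "y \<in> X" "adj x y" "nbrs x (P i) = {}" "nbrs y (P i) = {}"
    and ne: "nbrs x (P j) \<noteq> {}" "nbrs x (P l) \<noteq> {}" "nbrs y (P j) \<noteq> {}" "nbrs y (P l) \<noteq> {}"
  shows "card (nbrs x V) + card (nbrs y V) \<le> 2 / 3 * n + 8 * h"
proof -
  have idx': "i < 3" "l < 3" "j < 3" "i \<noteq> l" "i \<noteq> j" "l \<noteq> j"
    using idx by auto
  have deg: "card (nbrs x V) \<le> card (nbrs x (P j)) + card (nbrs x (P l)) + h"
     "card (nbrs y V) \<le> card (nbrs y (P j)) + card (nbrs y (P l)) + h"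
    using degree_le[OF idx, of x] degree_le[OF idx, of y] xy by auto
  note adj_yx = adj_sym[OF xy(3)]
  have comm: "nbrs y Q \<inter> nbrs x Q = nbrs x Q \<inter> nbrs y Q" for Q
    by blast
  show ?thesis
  proof (cases "h < card (nbrs x (P j) \<inter> nbrs y (P j))")
    case True
    then have "card (nbrs y (P l)) \<le> 2 * h" "card (nbrs x (P l)) \<le> 2 * h"
      using few_common_or_low[OF idx xy(1-3) ne(2)] few_common_or_low[OF idx xy(2,1) adj_yx ne(4)]
      by (auto simp: comm)
    then show ?thesis
      using deg card_nbrs_P_le[OF idx(2), of x] card_nbrs_P_le[OF idx(2), of y] by linarith
  next
    case j: False
    show ?thesis
    proof (cases "h < card (nbrs x (P l) \<inter> nbrs y (P l))")
      case True
      then have "card (nbrs y (P j)) \<le> 2 * h" "card (nbrs x (P j)) \<le> 2 * h"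
        using few_common_or_low[OF idx' xy(1-3) ne(1)] few_common_or_low[OF idx' xy(2,1) adj_yx ne(3)]
        by (auto simp: comm)
      then show ?thesis
        using deg card_nbrs_P_le[OF idx(3), of x] card_nbrs_P_le[OF idx(3), of y] by linarith
    next
      case False
      then show ?thesis
        using j deg card_union_inter_nbrs[OF idx(2), of x y] card_union_inter_nbrs[OF idx(3), of x y]
          h_ge by linarith
    qed
  qed
qed

text \<open>Otherwise \<open>b\<close> sees a neighbour \<open>a\<close> of \<open>w\<close> in
  \<open>P i\<close>, and among more than \<open>2 * h\<close> neighbours of \<open>v\<close> in
  \<open>P l\<close> there is one adjacent to both \<open>a\<close> and \<open>b\<close>, against
  \<open>no_fan\<close>.\<close>

lemma fan_low:
  assumes idx: "i < 3" "j < 3" "l < 3" "i \<noteq> j" "i \<noteq> l" "j \<noteq> l"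
    and X: "u \<in> X" "v \<in> X" "w \<in> X" "v \<noteq> w" "adj u v" "adj u w"
    and b: "b \<in> P j" "adj u b" "adj v b" "adj w b"
    and big: "2 * h < card (nbrs v (P l))"
  shows "card (nbrs w (P i)) \<le> h"
proof -
  have "nbrs b (nbrs w (P i)) = {}"
  proof (rule ccontr)
    assume "\<not> ?thesis"
    then obtain a where a: "a \<in> nbrs b (nbrs w (P i))"
      by blast
    have "card (nbrs v (P l)) \<le> card (nbrs b (nbrs v (P l))) + h"
      using b idx by (intro card_nbrs_sub[of j l]) auto
    moreover have "card (nbrs b (nbrs v (P l))) \<le> card (nbrs a (nbrs b (nbrs v (P l)))) + h"
      using a idx by (intro card_nbrs_sub[of i l]) auto
    ultimately have "0 < real (card (nbrs a (nbrs b (nbrs v (P l)))))"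
      using big by linarith
    then obtain c where c: "c \<in> nbrs a (nbrs b (nbrs v (P l)))"
      using ex_elem by blast
    show False
      using no_fan[OF idx X b, of c a] a c adj_sym[of a c] by auto
  qed
  moreover have "card (nbrs w (P i)) \<le> card (nbrs b (nbrs w (P i))) + h"
    using b idx by (intro card_nbrs_sub[of j i]) auto
  ultimately show ?thesis
    by simp
qed

text \<open>Both ends of the edge \<open>u v\<close> can be placed in class \<open>i\<close>
  only.\<close>

definition edge_config :: "'a \<Rightarrow> 'a \<Rightarrow> nat \<Rightarrow> nat \<Rightarrow> nat \<Rightarrow> bool" where
  "edge_config u v i j l \<longleftrightarrow> i < 3 \<and> j < 3 \<and> l < 3 \<and> i \<noteq> j \<and> i \<noteq> l \<and> j \<noteq> l \<and>
     X = {u, v} \<and> adj u v \<and> nbrs u (P i) = {} \<and> nbrs v (P i) = {} \<and>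
     nbrs u (P j) \<noteq> {} \<and> nbrs u (P l) \<noteq> {} \<and> nbrs v (P j) \<noteq> {} \<and> nbrs v (P l) \<noteq> {} \<and>
     7 * h < card (nbrs u V) \<and> 7 * h < card (nbrs v V)"

text \<open>The vertex \<open>u\<close> could go to class \<open>i\<close> or \<open>l\<close>, but
  its neighbours \<open>v\<close> and \<open>w\<close> are confined to \<open>i\<close> and
  \<open>l\<close> respectively. If the last condition fails, \<open>fan_low\<close> gives two
  vertices of small degree sum instead.\<close>

definition path_config :: "'a \<Rightarrow> 'a \<Rightarrow> 'a \<Rightarrow> nat \<Rightarrow> nat \<Rightarrow> nat \<Rightarrow> bool" where
  "path_config u v w i j l \<longleftrightarrow> i < 3 \<and> j < 3 \<and> l < 3 \<and> i \<noteq> j \<and> i \<noteq> l \<and> j \<noteq> l \<and>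
     X = {u, v, w} \<and> v \<noteq> w \<and> adj u v \<and> adj u w \<and>
     nbrs u (P i) = {} \<and> nbrs u (P l) = {} \<and> nbrs u (P j) \<noteq> {} \<and>
     nbrs v (P i) = {} \<and> nbrs v (P j) \<noteq> {} \<and> nbrs v (P l) \<noteq> {} \<and>
     nbrs w (P l) = {} \<and> nbrs w (P i) \<noteq> {} \<and> nbrs w (P j) \<noteq> {} \<and>
     nbrs u (P j) \<inter> nbrs v (P j) \<inter> nbrs w (P j) = {}"

definition core_config :: bool where
  "core_config \<longleftrightarrow> (\<exists>x. X = {x}) \<or> (\<exists>u v i j l. edge_config u v i j l) \<or>
     (\<exists>u v w i j l. path_config u v w i j l)"

lemma sum_card_three_le:
  assumes "finite S" "A \<subseteq> S" "B \<subseteq> S" "C \<subseteq> S" "A \<inter> B \<inter> C = {}"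
  shows "card A + card B + card C \<le> 2 * card S"
proof -
  have fin: "finite A" "finite B" "finite C"
    using assms(1-4) by (meson finite_subset)+
  have "card A + card B = card (A \<union> B) + card (A \<inter> B)"
    using fin(1,2) by (rule card_Un_Int)
  moreover have "card (A \<union> B) \<le> card S"
    using assms by (intro card_mono) auto
  moreover have "card (A \<inter> B) + card C = card (A \<inter> B \<union> C)"
    using fin assms by (simp add: card_Un_disjoint)
  moreover have "card (A \<inter> B \<union> C) \<le> card S"
    using assms by (intro card_mono) auto
  ultimately show ?thesis
    by linarith
qed

text \<open>The set \<open>L x\<close> of classes missed by \<open>x\<close> is its list of
  admissible colours. The degree sum required by \<open>shrink_exceptional_set\<close> is found on a
  vertex of tiny degree, on two vertices with two colours each, on adjacent vertices confined to the
  same class, or on a vertex with two colours together with one or both of the neighbours blocking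
  them.\<close>

lemma core_exceptional_set:
  "\<exists>U P'. U \<subseteq> X \<and> card U \<le> 3 \<and> near_tripartite (20 * \<eta>) V U P' \<and> (U = X \<longrightarrow> core_config)"
proof -
  have found: ?thesis
    if "U \<subseteq> X" "card U \<le> 3" "deg_sum U V \<le> 2 / 3 * (real (card U) - 1) * n + 8 * h" "U = X \<Longrightarrow> core_config" for U
    using shrink_exceptional_set[OF that(1-3)] that by blast
  have found2: ?thesis
    if "u \<in> X" "v \<in> X" "u \<noteq> v" "card (nbrs u V) + card (nbrs v V) \<le> 2 / 3 * n + 8 * h"
      "X = {u, v} \<Longrightarrow> core_config" for u v
    using that by (intro found[of "{u, v}"]) (auto simp: deg_sum_def)
  show ?thesis
  proof (cases "\<exists>x\<in>X. card (nbrs x V) \<le> 7 * h")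
    case True
    then obtain x where "x \<in> X" "card (nbrs x V) \<le> 7 * h"
      by blast
    then show ?thesis
      using h_ge by (intro found[of "{x}"]) (auto simp: deg_sum_def core_config_def)
  next
    case False
    then have high: "7 * h < card (nbrs x V)" if "x \<in> X" for x
      using that by (meson not_le)
    have some: "\<exists>i<3. nbrs x (P i) = {}" if "x \<in> X" for x
      using empty_or_low[OF that] high[OF that] by (metis not_le)
    have third: "nbrs x (P l) \<noteq> {}"
      if x: "x \<in> X" "nbrs x (P i) = {}" "nbrs x (P j) = {}"
        and idx: "i < 3" "j < 3" "l < 3" "i \<noteq> j" "i \<noteq> l" "j \<noteq> l" for x i j l
      using degree_le[OF idx, of x] high[OF x(1)] x h_ge by fastforce
    define L where "L x = {i. i < 3 \<and> nbrs x (P i) = {}}" for x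
    have L3: "L x \<subseteq> {..<3}" "finite (L x)" for x
      by (auto simp: L_def)
    show ?thesis
    proof (cases "\<exists>x\<in>X. \<exists>y\<in>X. x \<noteq> y \<and> 2 \<le> card (L x) \<and> 2 \<le> card (L y)")
      case True
      then obtain x y where xy: "x \<in> X" "y \<in> X" "x \<noteq> y" "2 \<le> card (L x)" "2 \<le> card (L y)"
        by blast
      have deg: "card (nbrs z V) \<le> n / 3 + 2 * h" if "2 \<le> card (L z)" for z
      proof -
        obtain T where "T \<subseteq> L z" "card T = 2"
          using \<open>2 \<le> card (L z)\<close> by (meson obtain_subset_with_card_n)
        then obtain i j where ij: "i \<in> L z" "j \<in> L z" "i \<noteq> j"
          by (auto simp: card_2_iff)
        then obtain l where l: "l < 3" "i \<noteq> l" "j \<noteq> l"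
          using third_index by blast
        have "i < 3" "j < 3" "nbrs z (P i) = {}" "nbrs z (P j) = {}"
          using ij by (auto simp: L_def)
        then show ?thesis
          using degree_le[of i j l z] card_nbrs_P_le[of l z] l ij by auto
      qed
      show ?thesis
      proof (rule found2[OF xy(1-3)])
        show "card (nbrs x V) + card (nbrs y V) \<le> 2 / 3 * n + 8 * h"
          using deg[OF xy(4)] deg[OF xy(5)] h_ge by linarith
        \<comment> \<open>Two vertices with two admissible colours each can be coloured differently,
          so \<open>X\<close> cannot consist of just these two.\<close>
        assume X: "X = {x, y}"
        obtain i where i: "i \<in> L x"
          using xy(4) by fastforce
        have "\<not> L y \<subseteq> {i}"
          using xy(5) card_mono[of "{i}" "L y"] by fastforce
        then obtain j where j: "j \<in> L y" "j \<noteq> i"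
          by blast
        have "\<exists>a\<in>X. \<exists>b\<in>X. adj a b \<and> (if a = x then i else j) = (if b = x then i else j)"
          using i j X xy(3) by (intro monochromatic_edge) (auto simp: L_def)
        then show core_config
          using X j(2) adj_irrefl by (auto split: if_splits)
      qed
    next
      case one: False
      have ex_g: "\<exists>i. i \<in> L x" if "x \<in> X" for x
        using some[OF that] by (auto simp: L_def)
      define g where "g x = (SOME i. i \<in> L x)" for x
      have g: "g x \<in> L x" if "x \<in> X" for x
        unfolding g_def using ex_g[OF that] by (rule someI_ex)
      have g': "g x < 3 \<and> nbrs x (P (g x)) = {}" if "x \<in> X" for x
        using g[OF that] by (simp add: L_def)
      have single: "L x = {i}" if "x \<in> X" "\<not> 2 \<le> card (L x)" "i \<in> L x" for x i
      proof -
        have "card (L x) \<le> card {i}"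
          using that by simp
        then show ?thesis
          using card_subset_eq[of "L x" "{i}"] that L3 card_seteq[of "L x" "{i}"] by auto
      qed
      have twins: ?thesis
        if xy: "x \<in> X" "y \<in> X" "adj x y" "L x = {i}" "L y = {i}" for x y i
      proof -
        have i: "i < 3" "nbrs x (P i) = {}" "nbrs y (P i) = {}"
          using xy(4,5) by (auto simp: L_def)
        obtain j l where "j < 3" "l < 3" "i \<noteq> j" "i \<noteq> l" "j \<noteq> l"
          using other_indices[OF i(1)] by blast
        then have idx: "i < 3" "j < 3" "l < 3" "i \<noteq> j" "i \<noteq> l" "j \<noteq> l"
          using i by auto
        have ne: "nbrs x (P j) \<noteq> {}" "nbrs x (P l) \<noteq> {}" "nbrs y (P j) \<noteq> {}" "nbrs y (P l) \<noteq> {}"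
          using xy(4,5) idx by (auto simp: L_def)
        have "x \<noteq> y"
          using xy(3) adj_irrefl by blast
        show ?thesis
        proof (rule found2[OF xy(1,2) \<open>x \<noteq> y\<close>])
          show "card (nbrs x V) + card (nbrs y V) \<le> 2 / 3 * n + 8 * h"
            by (rule twin_degrees[OF idx xy(1-3) i(2,3) ne])
          assume "X = {x, y}"
          then have "edge_config x y i j l"
            unfolding edge_config_def using idx xy(3) i ne high[OF xy(1)] high[OF xy(2)] by blast
          then show core_config
            unfolding core_config_def by blast
        qed
      qed
      show ?thesis
      proof (cases "\<exists>u\<in>X. 2 \<le> card (L u)")
        case False
        obtain x y where xy: "x \<in> X" "y \<in> X" "adj x y" "g x = g y"
          using monochromatic_edge[OF g'] by blast
        have "L x = {g x}" "L y = {g x}"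
          using single[of x "g x"] single[of y "g x"] g[OF xy(1)] g[OF xy(2)] xy False by auto
        then show ?thesis
          using twins xy by blast
      next
        case True
        then obtain u where u: "u \<in> X" "2 \<le> card (L u)"
          by blast
        have other: "L x = {i}" if "x \<in> X" "x \<noteq> u" "i \<in> L x" for x i
          using single[OF that(1) _ that(3)] one u that by blast
        have "\<exists>T\<subseteq>L u. card T = 2"
          using u(2) by (meson obtain_subset_with_card_n)
        then obtain i l where il: "i \<in> L u" "l \<in> L u" "i \<noteq> l"
          by (auto simp: card_2_iff)
        obtain j where j: "j < 3" "i \<noteq> j" "l \<noteq> j"
          using third_index by blast
        have idx: "i < 3" "j < 3" "l < 3" "i \<noteq> j" "i \<noteq> l" "j \<noteq> l"
          using il j by (auto simp: L_def)
        \<comment> \<open>Giving \<open>u\<close> the colour \<open>m\<close> still leaves an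
          equally coloured edge. If it avoids \<open>u\<close>, both its ends are confined to one
          class and \<open>twins\<close> applies; otherwise its other end blocks
          \<open>m\<close>.\<close>
        have step: "(\<exists>v\<in>X. v \<noteq> u \<and> adj u v \<and> L v = {m}) \<or> ?thesis" if m: "m \<in> L u" for m
        proof -
          have "\<exists>x\<in>X. \<exists>y\<in>X. adj x y \<and> (g(u := m)) x = (g(u := m)) y"
            using g' m by (intro monochromatic_edge) (auto simp: L_def)
          then obtain x y where xy: "x \<in> X" "y \<in> X" "adj x y" "(g(u := m)) x = (g(u := m)) y"
            by blast
          have "x \<noteq> y"
            using xy(3) adj_irrefl by blast
          consider "x = u" "y \<noteq> u" | "y = u" "x \<noteq> u" | "x \<noteq> u" "y \<noteq> u"
            using \<open>x \<noteq> y\<close> by blast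
          then show ?thesis
          proof cases
            case 1
            then have "L y = {m}"
              using other[OF xy(2)] g[OF xy(2)] xy(4) by auto
            then show ?thesis
              using 1 xy by blast
          next
            case 2
            then have "L x = {m}"
              using other[OF xy(1)] g[OF xy(1)] xy(4) by auto
            then show ?thesis
              using 2 xy adj_sym by blast
          next
            case 3
            then have "L x = {g x}" "L y = {g x}"
              using other[OF xy(1), of "g x"] other[OF xy(2), of "g y"] g[OF xy(1)] g[OF xy(2)] xy(4)
              by auto
            then show ?thesis
              using twins[OF xy(1-3)] by blast
          qed
        qed
        show ?thesis
        proof (rule ccontr)
          assume contra: "\<not> ?thesis"
          obtain v where v: "v \<in> X" "v \<noteq> u" "adj u v" "L v = {i}"
            using step[OF il(1)] contra by blast
          obtain w where w: "w \<in> X" "w \<noteq> u" "adj u w" "L w = {l}"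
            using step[OF il(2)] contra by blast
          have vw: "v \<noteq> w"
            using v w il(3) by auto
          have u_N: "nbrs u (P i) = {}" "nbrs u (P l) = {}" "nbrs u (P j) \<noteq> {}"
            using il third[OF u(1), of i l j] idx by (auto simp: L_def)
          have v_N: "nbrs v (P i) = {}" "nbrs v (P j) \<noteq> {}" "nbrs v (P l) \<noteq> {}"
            using v(4) idx by (auto simp: L_def)
          have w_N: "nbrs w (P l) = {}" "nbrs w (P j) \<noteq> {}" "nbrs w (P i) \<noteq> {}"
            using w(4) idx by (auto simp: L_def)
          have deg: "card (nbrs u V) \<le> card (nbrs u (P j)) + h"
            "card (nbrs v V) \<le> card (nbrs v (P j)) + card (nbrs v (P l)) + h"
            "card (nbrs w V) \<le> card (nbrs w (P i)) + card (nbrs w (P j)) + h"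
            using degree_le[OF idx, of u] degree_le[OF idx, of v] degree_le[OF idx, of w] u_N v_N w_N
            by auto
          note le = card_nbrs_P_le[OF idx(2), of u] card_nbrs_P_le[OF idx(2), of v]
            card_nbrs_P_le[OF idx(2), of w] card_nbrs_P_le[OF idx(3), of v] card_nbrs_P_le[OF idx(1), of w]
          show False
          proof (cases "nbrs u (P j) \<inter> nbrs v (P j) \<inter> nbrs w (P j) = {}")
            case False
            then obtain b where b: "b \<in> P j" "adj u b" "adj v b" "adj w b"
              by auto
            show False
            proof (cases "2 * h < card (nbrs v (P l))")
              case True
              have "card (nbrs w (P i)) \<le> h"
                by (rule fan_low[OF idx u(1) v(1) w(1) vw v(3) w(3) b True])
              then have "card (nbrs u V) + card (nbrs w V) \<le> 2 / 3 * n + 8 * h"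
                using deg le h_ge by linarith
              then show False
                using found2[OF u(1) w(1)] w(2) v vw contra by blast
            next
              case False
              then have "card (nbrs u V) + card (nbrs v V) \<le> 2 / 3 * n + 8 * h"
                using deg le h_ge by linarith
              then show False
                using found2[OF u(1) v(1)] v(2) w vw contra by blast
            qed
          next
            case True
            \<comment> \<open>No vertex of \<open>P j\<close> is adjacent to all three, so it is
              counted at most twice; this brings the degree sum of the path down to
              \<open>4 / 3 * n + 8 * h\<close>.\<close>
            have "card (nbrs u (P j)) + card (nbrs v (P j)) + card (nbrs w (P j)) \<le> 2 * card (P j)"
              using finite_parts idx True by (intro sum_card_three_le) auto
            then have "real (card (nbrs u V)) + card (nbrs v V) + card (nbrs w V) \<le> 4 / 3 * n + 8 * h"
              using deg le card_P(2)[OF idx(2)] h_ge by linarith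
            moreover have "card {u, v, w} = 3"
              using v(2) w(2) vw by auto
            moreover have "deg_sum {u, v, w} V = card (nbrs u V) + card (nbrs v V) + card (nbrs w V)"
              using v(2) w(2) vw by (auto simp: deg_sum_def)
            moreover have config: core_config if "{u, v, w} = X"
            proof -
              have "path_config u v w i j l"
                unfolding path_config_def using idx that[symmetric] vw v(3) w(3) u_N v_N w_N True by blast
              then show ?thesis
                unfolding core_config_def by blast
            qed
            moreover have "{u, v, w} \<subseteq> X"
              using u(1) v(1) w(1) by blast
            ultimately have "deg_sum {u, v, w} V \<le> 2 / 3 * (real (card {u, v, w}) - 1) * n + 8 * h"
              by simp
            from found[OF \<open>{u, v, w} \<subseteq> X\<close> _ this] show False
              using contra \<open>card {u, v, w} = 3\<close> config by simp
          qed
        qed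
      qed
    qed
  qed
qed

end

section \<open>Reducing the exceptional set to an obstruction\<close>

context dense_wheel_free
begin

text \<open>Each application of \<open>core_exceptional_set\<close> either stops at an obstruction
  or makes \<open>X\<close> strictly smaller at the price of a factor 20 in \<open>\<eta>\<close>.
  An empty \<open>X\<close> contradicts \<open>monochromatic_edge\<close>.\<close>

lemma near_partition_with_core_aux:
  assumes "near_tripartite \<eta> V X P" "card X \<le> m" "\<epsilon> \<le> \<eta>" "\<eta> * 20 ^ m \<le> 1 / 1000"
  shows "\<exists>\<eta>' X' P'. near_partition adj k V \<epsilon> \<eta>' X' P' \<and> near_partition.core_config adj V \<eta>' X' P'"
  using assms
proof (induction m arbitrary: \<eta> X P)
  case 0
  then interpret near_partition adj k V \<epsilon> \<eta> X P
    by unfold_locales auto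
  have "X = {}"
    using 0 finite_parts by auto
  then show ?case
    using monochromatic_edge[of "\<lambda>_. 0"] by auto
next
  case (Suc m)
  have pos: "0 < \<eta>"
    using Suc.prems slack_pos by linarith
  then have "\<eta> * 1 \<le> \<eta> * 20 ^ Suc m"
    by (intro mult_left_mono one_le_power) auto
  then have "\<eta> \<le> 1 / 1000"
    using Suc.prems(4) by linarith
  then interpret near_partition adj k V \<epsilon> \<eta> X P
    using Suc.prems(1,3) by unfold_locales
  obtain U P' where U: "U \<subseteq> X" "card U \<le> 3" "near_tripartite (20 * \<eta>) V U P'" "U = X \<longrightarrow> core_config"
    using core_exceptional_set by blast
  show ?case
  proof (cases "U = X")
    case True
    then show ?thesis
      using U near_partition_axioms by blast
  next
    case False
    then have "card U < card X"
      using U finite_parts by (intro psubset_card_mono) auto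
    then show ?thesis
      using Suc.prems pos by (intro Suc.IH[OF U(3)]) auto
  qed
qed

text \<open>One application brings \<open>X\<close>, of unbounded size, down to three vertices,
  after which at most three more follow; 160000 is \<open>20 ^ 4\<close>.\<close>

lemma near_partition_with_core:
  assumes near: "near_tripartite \<eta> V X P" and "\<epsilon> \<le> \<eta>" "\<eta> * 160000 \<le> 1 / 1000"
  shows "\<exists>\<eta>' X' P'. near_partition adj k V \<epsilon> \<eta>' X' P' \<and> near_partition.core_config adj V \<eta>' X' P'"
proof -
  have pos: "0 < \<eta>"
    using assms slack_pos by linarith
  have "\<eta> \<le> 1 / 1000"
    using assms(3) pos by linarith
  interpret near_partition adj k V \<epsilon> \<eta> X P
    by unfold_locales fact+
  obtain U P' where U: "card U \<le> 3" "near_tripartite (20 * \<eta>) V U P'"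
    using core_exceptional_set by blast
  show ?thesis
    using U assms pos by (intro near_partition_with_core_aux[of "20 * \<eta>" U P' 3]) auto
qed

end

section \<open>Counting missing edges\<close>

lemma edges_between_commute: "edges_between A B = edges_between B A"
  unfolding edges_between_def by (metis (no_types, opaque_lifting) insert_commute)

lemma mem_edges_between:
  "{x, y} \<in> edges_between A B \<longleftrightarrow> x \<in> A \<and> y \<in> B \<or> x \<in> B \<and> y \<in> A"
  by (auto simp: edges_between_def doubleton_eq_iff)

lemma edges_betweenE:
  assumes "e \<in> edges_between A B"
  obtains x y where "e = {x, y}" "x \<in> A" "y \<in> B"
  using assms by (auto simp: edges_between_def)

lemma card_edges_between:
  assumes "finite A" "finite B" "A \<inter> B = {}"
  shows "card (edges_between A B) = card A * card B" "finite (edges_between A B)"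
proof -
  have eq: "edges_between A B = (\<lambda>(x, y). {x, y}) ` (A \<times> B)"
    by (auto simp: edges_between_def)
  have "inj_on (\<lambda>(x, y). {x, y}) (A \<times> B)"
    using assms(3) by (auto simp: inj_on_def doubleton_eq_iff)
  then show "card (edges_between A B) = card A * card B"
    unfolding eq by (simp add: card_image card_cartesian_product)
  show "finite (edges_between A B)"
    unfolding eq using assms by simp
qed

lemma edges_complete_tripartite:
  "edges (complete_tripartite A B C) = edges_between A B \<union> edges_between A C \<union> edges_between B C"
  by (simp add: complete_tripartite_def)

lemma edges_complete_tripartite_swap:
  "edges (complete_tripartite A B C) = edges (complete_tripartite A C B)"
  unfolding edges_complete_tripartite using edges_between_commute[of B C] by auto

lemma card_edges_complete_tripartite:
  assumes "finite A" "finite B" "finite C" "A \<inter> B = {}" "A \<inter> C = {}" "B \<inter> C = {}"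
  shows "card (edges (complete_tripartite A B C)) = card A * card B + card A * card C + card B * card C"
    "finite (edges (complete_tripartite A B C))"
proof -
  have d: "edges_between A B \<inter> edges_between A C = {}"
    "(edges_between A B \<union> edges_between A C) \<inter> edges_between B C = {}"
    using assms(4-6) by (auto elim!: edges_betweenE simp: mem_edges_between doubleton_eq_iff)
  show "card (edges (complete_tripartite A B C)) = card A * card B + card A * card C + card B * card C"
    "finite (edges (complete_tripartite A B C))"
    unfolding edges_complete_tripartite
    using assms d by (simp_all add: card_Un_disjoint card_edges_between)
qed

lemma tripartite_product_le: "a * b + a * c + b * c \<le> (a + b + c)\<^sup>2 div 3" for a b c :: nat
proof -
  have "0 \<le> (int a - int b)\<^sup>2 + (int a - int c)\<^sup>2 + (int b - int c)\<^sup>2"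
    by simp
  then have "int (3 * (a * b + a * c + b * c)) \<le> int ((a + b + c)\<^sup>2)"
    by (simp add: power2_eq_square algebra_simps)
  then have "3 * (a * b + a * c + b * c) \<le> (a + b + c)\<^sup>2"
    by (simp only: of_nat_le_iff)
  then show ?thesis
    by (simp add: less_eq_div_iff_mult_less_eq mult.commute)
qed

text \<open>Two different elements give the same pair only if \<open>p\<close> exchanges them. The
  lemma serves to assign distinct missing edges to distinct vertices.\<close>

lemma inj_on_pairs:
  assumes "\<And>d d'. d \<in> D \<Longrightarrow> d' \<in> D \<Longrightarrow> d \<noteq> d' \<Longrightarrow> p d = d' \<Longrightarrow> p d' \<noteq> d"
  shows "inj_on (\<lambda>d. {d, p d}) D"
  using assms by (intro inj_onI) (metis doubleton_eq_iff)

context dense_wheel_free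
begin

definition edge_set :: "'a set set" where
  "edge_set = {{x, y} | x y. x \<in> V \<and> y \<in> V \<and> adj x y}"

lemma mem_edge_set: "{x, y} \<in> edge_set \<longleftrightarrow> x \<in> V \<and> y \<in> V \<and> adj x y"
  by (auto simp: edge_set_def doubleton_eq_iff adj_commute)

lemma finite_edge_set: "finite edge_set"
proof (rule finite_subset)
  show "edge_set \<subseteq> Pow V"
    by (auto simp: edge_set_def)
qed (simp add: finite_V)

text \<open>Here \<open>K\<close> is a complete tripartite edge set, \<open>M\<close> consists of
  edges known to be missing, and \<open>I\<close> contains all edges outside \<open>K\<close>. By
  the second part, equality leaves no other edge missing, and from this the extremal structure is
  read off.\<close>

lemma missing_edges_bound:
  assumes "finite K" "finite I" "M \<subseteq> K - edge_set" "edge_set - K \<subseteq> I"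
  shows "card edge_set + card M \<le> card K + card I"
    "card K + card I \<le> card edge_set + card M \<Longrightarrow> K - edge_set = M"
proof -
  have fin: "finite M" "finite (K - edge_set)" "finite (edge_set - K)"
    using assms(1) finite_edge_set by (auto intro: finite_subset[OF assms(3)])
  have "card edge_set = card (edge_set \<inter> K) + card (edge_set - K)"
    using finite_edge_set by (metis card_Diff_subset_Int card_mono Int_lower1 finite_Int le_add_diff_inverse)
  moreover have "card K = card (edge_set \<inter> K) + card (K - edge_set)"
    using assms(1) by (metis Int_commute card_Diff_subset_Int card_mono Int_lower1 finite_Int le_add_diff_inverse)
  moreover have M: "card M \<le> card (K - edge_set)"
    using assms fin by (intro card_mono)
  moreover have "card (edge_set - K) \<le> card I"
    using assms by (intro card_mono)
  ultimately have bound: "card edge_set + card M \<le> card K + card I"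
    and tight: "card K + card I \<le> card edge_set + card M \<Longrightarrow> card (K - edge_set) \<le> card M"
    by linarith+
  show "card edge_set + card M \<le> card K + card I"
    by (rule bound)
  show "K - edge_set = M" if "card K + card I \<le> card edge_set + card M"
    using card_seteq[OF fin(2) assms(3) tight[OF that]] by simp
qed

text \<open>One vertex of \<open>W1\<close> accounts for \<open>card W2 + card W3\<close> edges of
  the complete tripartite graph; all but one of these are offset by \<open>M\<close>, and
  \<open>u v\<close> adds one. So the graph has at most 2 edges more than the best tripartite graph
  of order \<open>card V - 1\<close>, and \<open>many\<close> turns every estimate into an
  equality.\<close>

lemma tight_partition:
  assumes many: "(card V - 1)\<^sup>2 div 3 + 2 \<le> card edge_set"
    and V: "V = W1 \<union> W2 \<union> W3" "W1 \<inter> W2 = {}" "W1 \<inter> W3 = {}" "W2 \<inter> W3 = {}"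
    and uv: "u \<in> W1" "v \<in> W1"
    and indep: "\<And>x y. x \<in> W1 \<Longrightarrow> y \<in> W1 \<Longrightarrow> adj x y \<Longrightarrow> {x, y} = {u, v}"
      "\<And>x y. x \<in> W2 \<Longrightarrow> y \<in> W2 \<Longrightarrow> \<not> adj x y" "\<And>x y. x \<in> W3 \<Longrightarrow> y \<in> W3 \<Longrightarrow> \<not> adj x y"
    and M: "M \<subseteq> edges (complete_tripartite W1 W2 W3) - edge_set" "card W2 + card W3 \<le> card M + 1"
  shows "edges (complete_tripartite W1 W2 W3) - edge_set = M"
    and "card M + 1 = card W2 + card W3"
    and "(card V - 1)\<^sup>2 div 3 \<le> (card W1 - 1) * card W2 + (card W1 - 1) * card W3 + card W2 * card W3"
proof -
  define K where "K = edges (complete_tripartite W1 W2 W3)"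
  have fin: "finite W1" "finite W2" "finite W3"
    using finite_V V by auto
  have K: "card K = card W1 * card W2 + card W1 * card W3 + card W2 * card W3" "finite K"
    unfolding K_def using card_edges_complete_tripartite[OF fin V(2-4)] by auto
  have "edge_set - K \<subseteq> {{u, v}}"
  proof
    fix e assume e: "e \<in> edge_set - K"
    then obtain x y where xy: "e = {x, y}" "x \<in> V" "y \<in> V" "adj x y"
      by (auto simp: edge_set_def)
    have "x \<in> W1 \<and> y \<in> W1"
      using e xy V(1) indep(2,3)[of x y] unfolding K_def edges_complete_tripartite xy(1)
      by (auto simp: mem_edges_between)
    then show "e \<in> {{u, v}}"
      using indep(1)[of x y] xy by auto
  qed
  note bound = missing_edges_bound[OF K(2) _ M(1)[folded K_def] this]
  obtain a where a: "card W1 = Suc a"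
    using uv fin by (metis card_gt_0_iff empty_iff gr0_implies_Suc)
  have "card V = card W1 + card W2 + card W3"
    using V fin by (auto simp: card_Un_disjoint Int_Un_distrib2)
  then have cV: "card V - 1 = a + card W2 + card W3"
    using a by simp
  have le: "a * card W2 + a * card W3 + card W2 * card W3 \<le> (card V - 1)\<^sup>2 div 3"
    unfolding cV by (rule tripartite_product_le)
  have cK: "card K = a * card W2 + a * card W3 + card W2 * card W3 + (card W2 + card W3)"
    using K(1) a by simp
  show "edges (complete_tripartite W1 W2 W3) - edge_set = M"
    using bound(2) cK le many M(2) unfolding K_def by simp
  show "card M + 1 = card W2 + card W3"
    using bound(1) cK le many M(2) by simp
  show "(card V - 1)\<^sup>2 div 3 \<le> (card W1 - 1) * card W2 + (card W1 - 1) * card W3 + card W2 * card W3"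
    using bound(1) cK many M(2) a by simp
qed

text \<open>The last conjunct says in product form that \<open>V1\<close> without a vertex,
  \<open>V2\<close> and \<open>V3\<close> are balanced; \<open>balanced_if_product_large\<close>
  turns it into the sizes demanded by \<open>G_family\<close>.\<close>

definition balanced_Gstar :: bool where
  "balanced_Gstar \<longleftrightarrow> (\<exists>V1 V2 V3 u v w S. (V, edge_set) = Gstar V1 V2 V3 u v w S \<and>
     V1 \<inter> V2 = {} \<and> V1 \<inter> V3 = {} \<and> V2 \<inter> V3 = {} \<and> u \<in> V1 \<and> v \<in> V1 \<and> u \<noteq> v \<and> w \<in> V3 \<and>
     S \<subset> V2 \<and> S \<noteq> {} \<and>
     (card V - 1)\<^sup>2 div 3 \<le> (card V1 - 1) * card V2 + (card V1 - 1) * card V3 + card V2 * card V3)"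

lemma balanced_GstarI:
  assumes V: "V = V1 \<union> V2 \<union> V3" "V1 \<inter> V2 = {}" "V1 \<inter> V3 = {}" "V2 \<inter> V3 = {}"
    and uv: "u \<in> V1" "v \<in> V1" "adj u v"
    and indep: "\<And>x y. x \<in> V1 \<Longrightarrow> y \<in> V1 \<Longrightarrow> adj x y \<Longrightarrow> {x, y} = {u, v}"
      "\<And>x y. x \<in> V2 \<Longrightarrow> y \<in> V2 \<Longrightarrow> \<not> adj x y" "\<And>x y. x \<in> V3 \<Longrightarrow> y \<in> V3 \<Longrightarrow> \<not> adj x y"
    and missing: "edges (complete_tripartite V1 V2 V3) - edge_set =
      edges_between (V2 - S) {v} \<union> edges_between (V3 - {w}) {u} \<union> edges_between S {w}"
    and "w \<in> V3" "S \<subset> V2" "S \<noteq> {}"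
    and size: "(card V - 1)\<^sup>2 div 3 \<le> (card V1 - 1) * card V2 + (card V1 - 1) * card V3 + card V2 * card V3"
  shows balanced_Gstar
proof -
  define K where "K = edges (complete_tripartite V1 V2 V3)"
  have sub: "edge_set \<subseteq> insert {u, v} K"
  proof
    fix e assume e: "e \<in> edge_set"
    then obtain x y where xy: "e = {x, y}" "x \<in> V" "y \<in> V" "adj x y"
      by (auto simp: edge_set_def)
    show "e \<in> insert {u, v} K"
    proof (cases "x \<in> V1 \<and> y \<in> V1")
      case True
      then show ?thesis
        using indep(1)[of x y] xy by auto
    next
      case False
      then show ?thesis
        using xy V(1) indep(2,3)[of x y] unfolding K_def edges_complete_tripartite xy(1)
        by (auto simp: mem_edges_between)
    qed
  qed
  have uvE: "{u, v} \<in> edge_set"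
    unfolding mem_edge_set using uv V(1) by blast
  have "edge_set = insert {u, v} K - (K - edge_set)"
    using sub uvE by blast
  then have "(V, edge_set) = Gstar V1 V2 V3 u v w S"
    unfolding Gstar_def using V(1) missing unfolding K_def by simp
  moreover have "u \<noteq> v"
    using uv adj_irrefl by blast
  ultimately show ?thesis
    unfolding balanced_Gstar_def using assms by blast
qed

end

section \<open>Excluding a single exceptional vertex\<close>

context near_partition
begin

text \<open>By \<open>no_cherry\<close> each neighbour of \<open>x\<close> in a class misses all
  neighbours of \<open>x\<close> in one of the other two classes. This yields a missing edge for
  every neighbour of \<open>x\<close> but one, so \<open>x\<close> brings a net gain of at most one
  edge over order \<open>card V - 1\<close>, not the required two.\<close>

lemma not_singleton_core:
  assumes many: "(card V - 1)\<^sup>2 div 3 + 2 \<le> card edge_set" and X: "X = {x}"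
  shows False
proof -
  have ne: "nbrs x (P i) \<noteq> {}" if "i < 3" for i
    using monochromatic_edge[of "\<lambda>_. i"] X that adj_irrefl by auto
  define N where "N i = nbrs x (P i)" for i
  have N: "N i \<noteq> {}" "N i \<subseteq> P i" "finite (N i)" if "i < 3" for i
    using ne that finite_parts by (auto simp: N_def)
  have N_disj: "N i \<inter> N j = {}" if "i < 3" "j < 3" "i \<noteq> j" for i j
    using N P_disjoint that by blast
  have misses: "(\<forall>b\<in>N j. \<not> adj a b) \<or> (\<forall>c\<in>N l. \<not> adj a c)"
    if "i < 3" "j < 3" "l < 3" "i \<noteq> j" "i \<noteq> l" "j \<noteq> l" "a \<in> N i" for a i j l
    using no_cherry[OF that(1-6), of x a] that(7) X unfolding N_def by blast
  obtain a0 where a0: "a0 \<in> N 0"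
    using N[of 0] by auto
  \<comment> \<open>The other two classes are named so that \<open>a0\<close> misses all of
    \<open>N j\<close>.\<close>
  have "\<exists>j l. j < 3 \<and> l < 3 \<and> 0 \<noteq> j \<and> 0 \<noteq> l \<and> j \<noteq> l \<and> (\<forall>b\<in>N j. \<not> adj a0 b)"
  proof (cases "\<forall>b\<in>N 1. \<not> adj a0 b")
    case True
    then show ?thesis
      by (intro exI[of _ 1] exI[of _ 2]) auto
  next
    case False
    then have "\<forall>c\<in>N 2. \<not> adj a0 c"
      using misses[of 0 1 2 a0] a0 by auto
    then show ?thesis
      by (intro exI[of _ 2] exI[of _ 1]) auto
  qed
  then obtain j l where idx: "(0::nat) < 3" "j < 3" "l < 3" "0 \<noteq> j" "0 \<noteq> l" "j \<noteq> l"
    and a0j: "\<And>b. b \<in> N j \<Longrightarrow> \<not> adj a0 b"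
    by auto
  obtain b0 where b0: "b0 \<in> N j"
    using N idx by blast
  obtain c0 where c0: "c0 \<in> N l"
    using N idx by blast
  \<comment> \<open>Every neighbour \<open>d\<close> of \<open>x\<close> except \<open>a0\<close> gets its own missing edge \<open>{d, p d}\<close>.\<close>
  define p where "p d = (if d \<in> N j then a0 else if d \<in> N l then (if adj d a0 then b0 else a0)
      else (if adj d b0 then c0 else b0))" for d
  \<comment> \<open>The pair \<open>{a0, b0}\<close> already belongs to \<open>b0\<close>, so
    \<open>a0\<close> has to be left out.\<close>
  define D where "D = (N 0 - {a0}) \<union> N j \<union> N l"
  have disj: "N 0 \<inter> N j = {}" "N 0 \<inter> N l = {}" "N j \<inter> N l = {}"
    using N_disj idx by blast+
  have finD: "finite D"
    using N idx by (auto simp: D_def)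
  have p_nonadj: "\<not> adj d (p d)" if d: "d \<in> D" for d
  proof -
    consider (j) "d \<in> N j" | (l) "d \<in> N l" "d \<notin> N j" | (i) "d \<in> N 0" "d \<notin> N j" "d \<notin> N l"
      using d unfolding D_def by blast
    then show ?thesis
    proof cases
      case j
      then show ?thesis
        using a0j adj_sym by (auto simp: p_def)
    next
      case l
      then show ?thesis
        using misses[of l 0 j d] idx a0 b0 by (auto simp: p_def)
    next
      case i
      then show ?thesis
        using misses[of 0 j l d] idx b0 c0 by (auto simp: p_def)
    qed
  qed
  have inj: "inj_on (\<lambda>d. {d, p d}) D"
    by (rule inj_on_pairs) (use disj a0 b0 c0 in \<open>auto simp: p_def D_def split: if_splits\<close>)
  define K where "K = edges (complete_tripartite (P 0) (P j) (P l))"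
  have Pdisj: "P 0 \<inter> P j = {}" "P 0 \<inter> P l = {}" "P j \<inter> P l = {}"
    using P_disjoint idx by blast+
  have finP: "finite (P 0)" "finite (P j)" "finite (P l)"
    using finite_parts idx by auto
  have K: "card K = card (P 0) * card (P j) + card (P 0) * card (P l) + card (P j) * card (P l)" "finite K"
    unfolding K_def using card_edges_complete_tripartite[OF finP Pdisj] by auto
  have V3: "V = insert x (P 0 \<union> P j \<union> P l)"
    using V_eq unfolding three_indices[OF idx] X by blast
  have xP: "x \<notin> P 0 \<union> P j \<union> P l"
    using P_X_disjoint X idx by blast
  have "nbrs x V = N 0 \<union> N j \<union> N l"
    using V3 adj_irrefl by (auto simp: N_def)
  then have "nbrs x V = insert a0 D" "a0 \<notin> D"
    using a0 disj by (auto simp: D_def)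
  then have cN: "card (nbrs x V) = Suc (card D)"
    using finD by simp
  have "(\<lambda>d. {d, p d}) ` D \<subseteq> K - edge_set"
  proof (intro image_subsetI DiffI)
    fix d assume d: "d \<in> D"
    show "{d, p d} \<notin> edge_set"
      using p_nonadj[OF d] by (simp add: mem_edge_set)
    show "{d, p d} \<in> K"
      unfolding K_def edges_complete_tripartite
    proof -
      have P: "a0 \<in> P 0" "b0 \<in> P j" "c0 \<in> P l"
        using a0 b0 c0 N(2) idx by blast+
      consider (j) "d \<in> N j" | (l) "d \<in> N l" "d \<notin> N j" | (i) "d \<in> N 0" "d \<notin> N j" "d \<notin> N l"
        using d unfolding D_def by blast
      then show "{d, p d} \<in> edges_between (P 0) (P j) \<union> edges_between (P 0) (P l) \<union> edges_between (P j) (P l)"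
      proof cases
        case j
        then have "d \<in> P j" "p d = a0"
          using N(2) idx by (auto simp: p_def)
        then show ?thesis
          using P by (simp add: mem_edges_between)
      next
        case l
        then have "d \<in> P l" "p d = a0 \<or> p d = b0"
          using N(2) idx by (auto simp: p_def)
        then show ?thesis
          using P by (auto simp: mem_edges_between)
      next
        case i
        then have "d \<in> P 0" "p d = b0 \<or> p d = c0"
          using N(2)[OF idx(1)] by (auto simp: p_def)
        then show ?thesis
          using P by (auto simp: mem_edges_between)
      qed
    qed
  qed
  moreover have "edge_set - K \<subseteq> (\<lambda>y. {x, y}) ` nbrs x V"
  proof
    fix e assume e: "e \<in> edge_set - K"
    then obtain y z where yz: "e = {y, z}" "y \<in> V" "z \<in> V" "adj y z"
      by (auto simp: edge_set_def)
    have "y = x \<or> z = x"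
      using e yz V3 P_indep[OF idx(1), of y z] P_indep[OF idx(2), of y z] P_indep[OF idx(3), of y z]
      unfolding K_def edges_complete_tripartite yz(1) by (auto simp: mem_edges_between)
    then show "e \<in> (\<lambda>y. {x, y}) ` nbrs x V"
      using yz adj_sym[OF yz(4)] by (auto simp: insert_commute)
  qed
  ultimately have "card edge_set + card ((\<lambda>d. {d, p d}) ` D) \<le> card K + card ((\<lambda>y. {x, y}) ` nbrs x V)"
    using missing_edges_bound(1)[OF K(2)] finite_V by simp
  moreover have "card ((\<lambda>y. {x, y}) ` nbrs x V) \<le> card (nbrs x V)"
    using finite_V by (intro card_image_le) simp
  moreover have "card V - 1 = card (P 0) + card (P j) + card (P l)"
    unfolding V3 using finP Pdisj xP by (simp add: card_Un_disjoint Int_Un_distrib2)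
  then have "card K \<le> (card V - 1)\<^sup>2 div 3"
    using tripartite_product_le[of "card (P 0)" "card (P j)" "card (P l)"] K(1) by simp
  ultimately show False
    using many cN by (simp add: card_image[OF inj])
qed

end

section \<open>Exact structure when the exceptional set is an edge or a path\<close>

context near_partition
begin

lemma parts_cover:
  assumes "i < 3" "j < 3" "l < 3" "i \<noteq> j" "i \<noteq> l" "j \<noteq> l"
  shows "V = X \<union> P i \<union> P j \<union> P l" "P i \<inter> P j = {}" "P i \<inter> P l = {}" "P j \<inter> P l = {}"
    "X \<inter> P i = {}" "X \<inter> P j = {}" "X \<inter> P l = {}"
  using V_eq P_disjoint P_X_disjoint assms unfolding three_indices[OF assms] by blast+

lemma ex_adj_in_part:
  assumes "i < 3" "j < 3" "i \<noteq> j" "x \<in> P i"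
  shows "\<exists>y\<in>P j. adj x y"
proof -
  have "0 < real (card (nbrs x (P j)))"
    using card_nbrs_P[OF assms] card_P(1)[OF assms(2)] h_le h_ge by linarith
  then show ?thesis
    using ex_elem by fastforce
qed

text \<open>Every \<open>d\<close> in \<open>P j\<close> or \<open>P l\<close> except
  \<open>c0\<close> gets its own missing edge: to \<open>u\<close> or \<open>v\<close> if it misses
  one of them, otherwise to \<open>c0\<close> or \<open>b0\<close> by \<open>I\<close> and
  \<open>J\<close>. This is just enough for \<open>tight_partition\<close>, so every cross pair not
  of the form \<open>{d, p d}\<close> is an edge, which determines the graph.\<close>

lemma edge_core_exact:
  assumes many: "(card V - 1)\<^sup>2 div 3 + 2 \<le> card edge_set"
    and idx: "i < 3" "j < 3" "l < 3" "i \<noteq> j" "i \<noteq> l" "j \<noteq> l"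
    and X: "X = {u, v}" "adj u v" "nbrs u (P i) = {}" "nbrs v (P i) = {}"
    and b0: "b0 \<in> nbrs u (P j)" "b0 \<in> nbrs v (P j)"
    and c0: "c0 \<in> nbrs u (P l)" "c0 \<in> nbrs v (P l)"
    and I: "\<And>b c. b \<in> nbrs u (P j) \<Longrightarrow> b \<in> nbrs v (P j) \<Longrightarrow> c \<in> nbrs u (P l) \<Longrightarrow> \<not> adj b c"
    and J: "\<And>b c. c \<in> nbrs u (P l) \<Longrightarrow> c \<in> nbrs v (P l) \<Longrightarrow> b \<in> nbrs v (P j) \<Longrightarrow> \<not> adj c b"
  shows balanced_Gstar
proof -
  note cover = parts_cover[OF idx]
  have uv: "u \<noteq> v" "u \<notin> P i" "u \<notin> P j" "u \<notin> P l" "v \<notin> P i" "v \<notin> P j" "v \<notin> P l"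
    using X(1,2) cover(5-7) adj_irrefl by blast+
  define W where "W = {u, v} \<union> P i"
  define K where "K = edges (complete_tripartite W (P j) (P l))"
  define p where "p d = (if \<not> adj u d then u else if \<not> adj v d then v else if d \<in> P j then c0 else b0)" for d
  \<comment> \<open>The pair \<open>{b0, c0}\<close> is already the missing edge of
    \<open>b0\<close>, so \<open>c0\<close> is left out.\<close>
  define D where "D = P j \<union> (P l - {c0})"
  define M where "M = (\<lambda>d. {d, p d}) ` D"
  have bc: "b0 \<in> P j" "c0 \<in> P l" "b0 \<notin> P l" "c0 \<notin> P j"
    using b0 c0 cover(4) by auto
  have fin: "finite (P j)" "finite (P l)"
    using finite_parts idx by auto
  have inj: "inj_on (\<lambda>d. {d, p d}) D"
    by (rule inj_on_pairs) (use uv bc cover(4) in \<open>auto simp: p_def D_def split: if_splits\<close>)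
  have "card D + 1 = card (P j) + card (P l)"
  proof -
    have "card D = card (P j) + card (P l - {c0})"
      unfolding D_def using fin cover(4) by (intro card_Un_disjoint) auto
    moreover have "card (P l) = Suc (card (P l - {c0}))"
      using card_Suc_Diff1[OF fin(2) bc(2)] by simp
    ultimately show ?thesis by simp
  qed
  then have cM: "card (P j) + card (P l) \<le> card M + 1"
    unfolding M_def by (simp add: card_image[OF inj])
  have K_iff: "{x, y} \<in> K \<longleftrightarrow> x \<in> W \<and> y \<in> P j \<or> x \<in> P j \<and> y \<in> W \<or> x \<in> W \<and> y \<in> P l \<or> x \<in> P l \<and> y \<in> W
      \<or> x \<in> P j \<and> y \<in> P l \<or> x \<in> P l \<and> y \<in> P j" for x y
    unfolding K_def edges_complete_tripartite by (auto simp: mem_edges_between)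
  have "M \<subseteq> K - edge_set"
    unfolding M_def
  proof (intro image_subsetI DiffI)
    fix d assume d: "d \<in> D"
    show "{d, p d} \<in> K"
      using d bc unfolding K_iff by (auto simp: D_def p_def W_def)
    have "\<not> adj d (p d)"
    proof (cases "adj u d \<and> adj v d")
      case True
      show ?thesis
      proof (cases "d \<in> P j")
        case dj: True
        then show ?thesis
          using True I[of d c0] c0 by (auto simp: p_def)
      next
        case False
        then show ?thesis
          using True J[of d b0] b0 d by (auto simp: p_def D_def)
      qed
    next
      case False
      then show ?thesis
        using adj_sym by (auto simp: p_def)
    qed
    then show "{d, p d} \<notin> edge_set"
      by (simp add: mem_edge_set)
  qed
  have V: "V = W \<union> P j \<union> P l" "W \<inter> P j = {}" "W \<inter> P l = {}"
    using cover X(1) by (auto simp: W_def)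
  have indep: "{x, y} = {u, v}" if "x \<in> W" "y \<in> W" "adj x y" for x y
    using that X(3,4) P_indep[OF idx(1), of x y] adj_sym[OF that(3)] adj_irrefl by (auto simp: W_def)
  have indep': "\<not> adj x y" if "x \<in> P j" "y \<in> P j" for x y
    using that P_indep[OF idx(2)] by blast
  have indep'': "\<not> adj x y" if "x \<in> P l" "y \<in> P l" for x y
    using that P_indep[OF idx(3)] by blast
  have uW: "u \<in> W" "v \<in> W"
    by (auto simp: W_def)
  note tight = tight_partition[OF many V cover(4) uW indep indep' indep'' _ cM]
  have KM: "K - edge_set = M"
    unfolding K_def using tight(1) \<open>M \<subseteq> K - edge_set\<close> unfolding K_def by blast
  have size: "(card V - 1)\<^sup>2 div 3 \<le> (card W - 1) * card (P j) + (card W - 1) * card (P l) + card (P j) * card (P l)"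
    using tight(3) \<open>M \<subseteq> K - edge_set\<close> unfolding K_def by blast
  have missing: "x \<in> D \<and> p x = y \<or> y \<in> D \<and> p y = x" if "{x, y} \<in> K" "\<not> adj x y" for x y
  proof -
    have "{x, y} \<in> M"
      using KM that by (auto simp: mem_edge_set)
    then show ?thesis
      by (auto simp: M_def doubleton_eq_iff)
  qed
  \<comment> \<open>If \<open>r\<close> missed \<open>u\<close>, its assigned edge would be
    \<open>{r, u}\<close>; but \<open>J\<close> makes \<open>{c0, r}\<close> missing as well, and
    that pair is assigned to nobody.\<close>
  have RA: "adj u r" if r: "r \<in> P j" "adj v r" for r
  proof (rule ccontr)
    assume "\<not> adj u r"
    then show False
      using missing[of c0 r] J[of c0 r] c0 r bc uv by (auto simp: K_iff p_def D_def)
  qed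
  have QT: "adj v q" if q: "q \<in> P l" "adj u q" for q
  proof (rule ccontr)
    assume nv: "\<not> adj v q"
    then have "q \<noteq> c0"
      using c0 by auto
    then show False
      using missing[of b0 q] I[of b0 q] b0 q bc uv nv by (auto simp: K_iff p_def D_def)
  qed
  have A: "adj u b" if b: "b \<in> P j" for b
  proof (rule ccontr)
    assume nu: "\<not> adj u b"
    then have "\<not> adj v b"
      using RA b by blast
    then show False
      using missing[of v b] b uv nu by (auto simp: K_iff p_def D_def W_def)
  qed
  have T: "adj v c" if c: "c \<in> P l" for c
  proof (rule ccontr)
    assume nv: "\<not> adj v c"
    then have "\<not> adj u c"
      using QT c by blast
    then show False
      using missing[of v c] c uv nv by (auto simp: K_iff p_def D_def W_def)
  qed
  define R where "R = nbrs v (P j)"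
  define Q where "Q = nbrs u (P l)"
  have RQ: "R \<subseteq> P j" "Q \<subseteq> P l" "b0 \<in> R" "c0 \<in> Q"
    using b0 c0 by (auto simp: R_def Q_def)
  have nonadj: "\<not> adj b c" if "b \<in> R" "c \<in> Q" for b c
    using I[of b c] that A by (auto simp: R_def Q_def)
  \<comment> \<open>For \<open>b\<close> in \<open>R\<close> and \<open>c\<close> in
    \<open>Q\<close>, other than \<open>b0\<close> and \<open>c0\<close>, the pair
    \<open>{b, c}\<close> is missing but unassigned, since \<open>p b = c0\<close> and
    \<open>p c = b0\<close>.\<close>
  have one: "R = {b0} \<or> Q = {c0}"
  proof (rule ccontr)
    assume "\<not> ?thesis"
    then obtain b c where "b \<in> R" "b \<noteq> b0" "c \<in> Q" "c \<noteq> c0"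
      using RQ by blast
    moreover from this have "c \<notin> P j"
      using RQ cover(4) by blast
    ultimately show False
      using missing[of b c] nonadj[of b c] RQ A T
      by (auto simp: K_iff p_def D_def R_def Q_def)
  qed
  have miss_iff: "e \<in> K - edge_set \<longleftrightarrow>
     e \<in> edges_between (P j - R) {v} \<union> edges_between (P l - Q) {u} \<union> edges_between R Q" for e
  proof
    assume "e \<in> K - edge_set"
    then obtain d where d: "d \<in> D" "e = {d, p d}"
      unfolding KM M_def by blast
    then show "e \<in> edges_between (P j - R) {v} \<union> edges_between (P l - Q) {u} \<union> edges_between R Q"
      using A T RQ cover(4) by (auto simp: mem_edges_between D_def p_def R_def Q_def)
  next
    assume "e \<in> edges_between (P j - R) {v} \<union> edges_between (P l - Q) {u} \<union> edges_between R Q"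
    then consider b where "e = {b, v}" "b \<in> P j" "b \<notin> R" | c where "e = {c, u}" "c \<in> P l" "c \<notin> Q"
      | b c where "e = {b, c}" "b \<in> R" "c \<in> Q"
      by (auto simp: edges_between_def)
    then show "e \<in> K - edge_set"
    proof cases
      case 1
      then show ?thesis
        using adj_sym[of b v] by (auto simp: K_iff mem_edge_set W_def R_def)
    next
      case 2
      then show ?thesis
        using adj_sym[of c u] by (auto simp: K_iff mem_edge_set W_def Q_def)
    next
      case 3
      then show ?thesis
        using nonadj RQ by (auto simp: K_iff mem_edge_set)
    qed
  qed
  \<comment> \<open>The vertex \<open>c0\<close> or \<open>b0\<close> takes the place of
    \<open>w\<close> in \<open>Gstar\<close>; in the second case \<open>u\<close> and
    \<open>v\<close> as well as the two classes exchange their roles.\<close>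
  show ?thesis
    using one
  proof
    assume Q: "Q = {c0}"
    obtain y where "y \<in> P j" "adj c0 y"
      using ex_adj_in_part[of l j c0] idx bc by blast
    then have "R \<noteq> P j"
      using nonadj[of y c0] RQ adj_sym by blast
    show ?thesis
    proof (rule balanced_GstarI[OF V cover(4) uW X(2) indep indep' indep''])
      show "edges (complete_tripartite W (P j) (P l)) - edge_set =
        edges_between (P j - R) {v} \<union> edges_between (P l - {c0}) {u} \<union> edges_between R {c0}"
        using miss_iff unfolding Q K_def by blast
    qed (use size RQ bc \<open>R \<noteq> P j\<close> in auto)
  next
    assume R: "R = {b0}"
    obtain y where "y \<in> P l" "adj b0 y"
      using ex_adj_in_part[of j l b0] idx bc by blast
    then have "Q \<noteq> P l"
      using nonadj[of b0 y] RQ by blast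
    show ?thesis
    proof (rule balanced_GstarI[of W "P l" "P j" v u Q b0])
      show "edges (complete_tripartite W (P l) (P j)) - edge_set =
        edges_between (P l - Q) {u} \<union> edges_between (P j - {b0}) {v} \<union> edges_between Q {b0}"
        using miss_iff edges_between_commute[of Q "{b0}"]
        unfolding R K_def edges_complete_tripartite_swap[of W "P l" "P j"] by blast
      show "(card V - 1)\<^sup>2 div 3 \<le> (card W - 1) * card (P l) + (card W - 1) * card (P j) + card (P l) * card (P j)"
        using size by (simp add: algebra_simps)
      show "{x, y} = {v, u}" if "x \<in> W" "y \<in> W" "adj x y" for x y
        using indep[OF that] by blast
    qed (use V cover uW adj_sym[OF X(2)] indep' indep'' RQ bc \<open>Q \<noteq> P l\<close> in auto)
  qed
qed

text \<open>If there were no common neighbour in \<open>P l\<close>, nobody would be left out of the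
  injection: each vertex of \<open>P l\<close> misses \<open>u\<close> or \<open>v\<close>, and a
  common neighbour \<open>b\<close> in \<open>P j\<close> misses some \<open>g b\<close> in
  \<open>P l\<close> by \<open>no_distinct_reps\<close>. This is one missing edge more than
  \<open>tight_partition\<close> permits.\<close>

lemma edge_core_common:
  assumes many: "(card V - 1)\<^sup>2 div 3 + 2 \<le> card edge_set"
    and idx: "i < 3" "j < 3" "l < 3" "i \<noteq> j" "i \<noteq> l" "j \<noteq> l"
    and X: "X = {u, v}" "adj u v" "nbrs u (P i) = {}" "nbrs v (P i) = {}"
      "nbrs u (P l) \<noteq> {}" "nbrs v (P l) \<noteq> {}"
  shows "nbrs u (P l) \<inter> nbrs v (P l) \<noteq> {}"
proof
  assume empty: "nbrs u (P l) \<inter> nbrs v (P l) = {}"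
  note cover = parts_cover[OF idx]
  have uv: "u \<noteq> v" "u \<notin> P i" "u \<notin> P j" "u \<notin> P l" "v \<notin> P i" "v \<notin> P j" "v \<notin> P l"
    using X(1,2) cover(5-7) adj_irrefl by blast+
  have "\<exists>c\<in>P l. \<not> adj b c" if b: "b \<in> P j" "adj u b" "adj v b" for b
  proof -
    obtain q t where qt: "q \<in> nbrs u (P l)" "t \<in> nbrs v (P l)"
      using X(5,6) by blast
    then have "q \<noteq> t"
      using empty by blast
    then show ?thesis
      using no_distinct_reps[OF idx, of u v b q t] X(1,2) b qt by auto
  qed
  then obtain g where g: "g b \<in> P l" "\<not> adj b (g b)" if "b \<in> P j" "adj u b" "adj v b" for b
    by metis
  define W where "W = {u, v} \<union> P i"
  define K where "K = edges (complete_tripartite W (P j) (P l))"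
  define p where "p d = (if \<not> adj u d then u else if \<not> adj v d then v else g d)" for d
  define M where "M = (\<lambda>d. {d, p d}) ` (P j \<union> P l)"
  have fin: "finite (P j)" "finite (P l)"
    using finite_parts idx by auto
  have not_both: "\<not> (adj u c \<and> adj v c)" if "c \<in> P l" for c
    using empty that by auto
  have p_l: "p c = u \<or> p c = v" if "c \<in> P l" for c
    using not_both[OF that] by (auto simp: p_def)
  have p_j: "p b = u \<or> p b = v \<or> p b \<in> P l" if "b \<in> P j" for b
    using g(1)[OF that] by (auto simp: p_def)
  have inj: "inj_on (\<lambda>d. {d, p d}) (P j \<union> P l)"
  proof (rule inj_on_pairs)
    fix d d' assume d: "d \<in> P j \<union> P l" "d' \<in> P j \<union> P l" "p d = d'"
    have "d' \<in> P l"
      using d p_l[of d] p_j[of d] uv by auto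
    then show "p d' \<noteq> d"
      using d p_l[of d'] uv by auto
  qed
  have cM: "card (P j) + card (P l) = card M"
    unfolding M_def card_image[OF inj] using fin cover(4) by (simp add: card_Un_disjoint)
  then have cM': "card (P j) + card (P l) \<le> card M + 1"
    by simp
  have K_iff: "{x, y} \<in> K \<longleftrightarrow> x \<in> W \<and> y \<in> P j \<or> x \<in> P j \<and> y \<in> W \<or> x \<in> W \<and> y \<in> P l \<or> x \<in> P l \<and> y \<in> W
      \<or> x \<in> P j \<and> y \<in> P l \<or> x \<in> P l \<and> y \<in> P j" for x y
    unfolding K_def edges_complete_tripartite by (auto simp: mem_edges_between)
  have "M \<subseteq> K - edge_set"
    unfolding M_def
  proof (intro image_subsetI DiffI)
    fix d assume d: "d \<in> P j \<union> P l"
    show "{d, p d} \<in> K"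
      using d p_l[of d] p_j[of d] unfolding K_iff by (auto simp: W_def)
    have "\<not> adj d (p d)"
      using d g(2)[of d] not_both[of d] adj_sym[of d u] adj_sym[of d v] by (auto simp: p_def)
    then show "{d, p d} \<notin> edge_set"
      by (simp add: mem_edge_set)
  qed
  moreover have V: "V = W \<union> P j \<union> P l" "W \<inter> P j = {}" "W \<inter> P l = {}"
    using cover X(1) by (auto simp: W_def)
  moreover have "{x, y} = {u, v}" if "x \<in> W" "y \<in> W" "adj x y" for x y
    using that X(3,4) P_indep[OF idx(1), of x y] adj_sym[OF that(3)] adj_irrefl by (auto simp: W_def)
  moreover have "u \<in> W" "v \<in> W"
    by (auto simp: W_def)
  ultimately have "card M + 1 = card (P j) + card (P l)"
    using tight_partition(2)[OF many V cover(4), of u v M] cM' P_indep[OF idx(2)] P_indep[OF idx(3)]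
    unfolding K_def by blast
  then show False
    using cM by simp
qed

text \<open>The two ends cannot both have many neighbours in the same class, so, up to exchanging
  them, \<open>u\<close> has many in \<open>P j\<close> and \<open>v\<close> many in
  \<open>P l\<close>. Then \<open>no_distinct_reps\<close> supplies the hypotheses \<open>I\<close>
  and \<open>J\<close> of \<open>edge_core_exact\<close>.\<close>

lemma edge_core_balanced:
  assumes many: "(card V - 1)\<^sup>2 div 3 + 2 \<le> card edge_set" and config: "edge_config u v i j l"
  shows balanced_Gstar
proof -
  have idx: "i < 3" "j < 3" "l < 3" "i \<noteq> j" "i \<noteq> l" "j \<noteq> l"
    and X: "X = {u, v}" "adj u v" "nbrs u (P i) = {}" "nbrs v (P i) = {}"
    and ne: "nbrs u (P j) \<noteq> {}" "nbrs u (P l) \<noteq> {}" "nbrs v (P j) \<noteq> {}" "nbrs v (P l) \<noteq> {}"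
    and high: "7 * h < card (nbrs u V)" "7 * h < card (nbrs v V)"
    using config unfolding edge_config_def by blast+
  have idx': "i < 3" "l < 3" "j < 3" "i \<noteq> l" "i \<noteq> j" "l \<noteq> j"
    using idx by auto
  obtain b0 where b0: "b0 \<in> nbrs u (P j)" "b0 \<in> nbrs v (P j)"
    using edge_core_common[OF many idx' X ne(1,3)] by blast
  obtain c0 where c0: "c0 \<in> nbrs u (P l)" "c0 \<in> nbrs v (P l)"
    using edge_core_common[OF many idx X ne(2,4)] by blast
  have disjoint_nbrs: "\<not> adj b c"
    if "i < 3" "j < 3" "l < 3" "i \<noteq> j" "i \<noteq> l" "j \<noteq> l" "X = {u, v}" "adj u v"
      and b: "b \<in> nbrs u (P j)" "b \<in> nbrs v (P j)" and c: "c \<in> nbrs u (P l)"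
      and big: "2 * h < card (nbrs v (P l))" for i j l u v b c
  proof
    assume bc: "adj b c"
    have "card (nbrs v (P l)) \<le> card (nbrs b (nbrs v (P l))) + h"
      using b that(1-6) by (intro card_nbrs_sub[of j l]) auto
    then have "1 < real (card (nbrs b (nbrs v (P l))))"
      using big h_ge by linarith
    then obtain d where d: "d \<in> nbrs b (nbrs v (P l))" "d \<noteq> c"
      using ex_other[of "nbrs b (nbrs v (P l))" c] by blast
    show False
      using no_distinct_reps[OF that(1-6), of u v b c d] that(7,8) b c d bc by auto
  qed
  have main: ?thesis
    if X: "X = {u, v}" "adj u v" "nbrs u (P i) = {}" "nbrs v (P i) = {}"
      and b0: "b0 \<in> nbrs u (P j)" "b0 \<in> nbrs v (P j)" and c0: "c0 \<in> nbrs u (P l)" "c0 \<in> nbrs v (P l)"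
      and big: "2 * h < card (nbrs u (P j))" "2 * h < card (nbrs v (P l))" for u v
  proof (rule edge_core_exact[OF many idx X b0 c0])
    show "\<not> adj b c" if "b \<in> nbrs u (P j)" "b \<in> nbrs v (P j)" "c \<in> nbrs u (P l)" for b c
      using disjoint_nbrs[OF idx X(1,2) that big(2)] .
    show "\<not> adj c b" if "c \<in> nbrs u (P l)" "c \<in> nbrs v (P l)" "b \<in> nbrs v (P j)" for b c
      using disjoint_nbrs[OF idx' _ adj_sym[OF X(2)] that(2,1,3) big(1)] X(1) by blast
  qed
  have deg: "card (nbrs u V) \<le> card (nbrs u (P j)) + card (nbrs u (P l)) + h"
     "card (nbrs v V) \<le> card (nbrs v (P j)) + card (nbrs v (P l)) + h"
    using degree_le[OF idx, of u] degree_le[OF idx, of v] X by auto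
  have not_both: "\<not> (2 * h < card (nbrs u (P l)) \<and> 2 * h < card (nbrs v (P l)))"
    "\<not> (2 * h < card (nbrs u (P j)) \<and> 2 * h < card (nbrs v (P j)))"
  proof -
    have False if idx: "i < 3" "j < 3" "l < 3" "i \<noteq> j" "i \<noteq> l" "j \<noteq> l" 
      and b: "b \<in> nbrs u (P j)" "b \<in> nbrs v (P j)"
      and big: "2 * h < card (nbrs u (P l))" "2 * h < card (nbrs v (P l))" for i j l b
    proof -
      have "card (nbrs u (P l)) \<le> card (nbrs b (nbrs u (P l))) + h"
        using b idx by (intro card_nbrs_sub[of j l]) auto
      then have "0 < real (card (nbrs b (nbrs u (P l))))"
        using big h_ge by linarith
      then obtain c where c: "c \<in> nbrs b (nbrs u (P l))"
        using ex_elem by blast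
      show False
        using disjoint_nbrs[OF idx X(1,2) b _ big(2), of c] c by auto
    qed
    then show "\<not> (2 * h < card (nbrs u (P l)) \<and> 2 * h < card (nbrs v (P l)))"
      "\<not> (2 * h < card (nbrs u (P j)) \<and> 2 * h < card (nbrs v (P j)))"
      using idx idx' b0 c0 by blast+
  qed
  show ?thesis
  proof (cases "2 * h < card (nbrs u (P j))")
    case True
    then have "2 * h < card (nbrs v (P l))"
      using not_both(2) deg(2) high(2) h_ge by linarith
    then show ?thesis
      using main[OF X b0 c0 True] by blast
  next
    case False
    then have "2 * h < card (nbrs u (P l))"
      using deg(1) high(1) h_ge by linarith
    moreover from this have "2 * h < card (nbrs v (P j))"
      using not_both(1) deg(2) high(2) h_ge by linarith
    ultimately show ?thesis
      using main[OF _ adj_sym[OF X(2)] X(4,3) b0(2,1) c0(2,1)] X(1) by blast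
  qed
qed

text \<open>With \<open>w\<close> added to the class \<open>P l\<close>, each vertex of
  \<open>P j\<close> and \<open>P l\<close> misses one of \<open>u\<close>, \<open>v\<close>,
  \<open>w\<close>. These missing edges are exactly as many as \<open>tight_partition\<close>
  allows, so there are no others. The remaining difficulty is to show that \<open>u\<close> is
  joined to all of \<open>P j\<close>.\<close>

lemma path_core_balanced:
  assumes many: "(card V - 1)\<^sup>2 div 3 + 2 \<le> card edge_set" and config: "path_config u v w i j l"
  shows balanced_Gstar
proof -
  have idx: "i < 3" "j < 3" "l < 3" "i \<noteq> j" "i \<noteq> l" "j \<noteq> l"
    and X: "X = {u, v, w}" "v \<noteq> w" "adj u v" "adj u w"
    and u: "nbrs u (P i) = {}" "nbrs u (P l) = {}" "nbrs u (P j) \<noteq> {}"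
    and v: "nbrs v (P i) = {}" "nbrs v (P j) \<noteq> {}" "nbrs v (P l) \<noteq> {}"
    and w: "nbrs w (P l) = {}" "nbrs w (P i) \<noteq> {}" "nbrs w (P j) \<noteq> {}"
    and triple: "nbrs u (P j) \<inter> nbrs v (P j) \<inter> nbrs w (P j) = {}"
    using config unfolding path_config_def by blast+
  note cover = parts_cover[OF idx]
  have uvw: "u \<noteq> v" "u \<noteq> w" "u \<notin> P i" "u \<notin> P j" "u \<notin> P l" "v \<notin> P i" "v \<notin> P j" "v \<notin> P l"
      "w \<notin> P i" "w \<notin> P j" "w \<notin> P l"
    using X cover(5-7) adj_irrefl by blast+
  define W where "W = {u, v} \<union> P i"
  define Z where "Z = insert w (P l)"
  define K where "K = edges (complete_tripartite W (P j) Z)"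
  define p where "p d = (if \<not> adj u d then u else if \<not> adj v d then v else w)" for d
  define M where "M = (\<lambda>d. {d, p d}) ` (P j \<union> P l)"
  have fin: "finite (P j)" "finite (P l)"
    using finite_parts idx by auto
  have p_cases: "p d = u \<or> p d = v \<or> p d = w" for d
    by (auto simp: p_def)
  have p_l: "p c = u" if "c \<in> P l" for c
    using u(2) that by (auto simp: p_def)
  have inj: "inj_on (\<lambda>d. {d, p d}) (P j \<union> P l)"
  proof (rule inj_on_pairs)
    fix d d' assume "d' \<in> P j \<union> P l" "p d = d'"
    then show "p d' \<noteq> d"
      using p_cases[of d] uvw by auto
  qed
  have "card M = card (P j) + card (P l)"
    unfolding M_def card_image[OF inj] using fin cover(4) by (simp add: card_Un_disjoint)
  then have cM: "card (P j) + card Z \<le> card M + 1"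
    using fin uvw by (simp add: Z_def)
  have K_iff: "{x, y} \<in> K \<longleftrightarrow> x \<in> W \<and> y \<in> P j \<or> x \<in> P j \<and> y \<in> W \<or> x \<in> W \<and> y \<in> Z \<or> x \<in> Z \<and> y \<in> W
      \<or> x \<in> P j \<and> y \<in> Z \<or> x \<in> Z \<and> y \<in> P j" for x y
    unfolding K_def edges_complete_tripartite by (auto simp: mem_edges_between)
  have sub: "M \<subseteq> K - edge_set"
    unfolding M_def
  proof (intro image_subsetI DiffI)
    fix d assume d: "d \<in> P j \<union> P l"
    then consider "d \<in> P j" | "d \<in> P l"
      by blast
    then show "{d, p d} \<in> K"
    proof cases
      case 1
      then show ?thesis
        using p_cases[of d] unfolding K_iff by (auto simp: W_def Z_def)
    next
      case 2
      then show ?thesis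
        using p_l[of d] unfolding K_iff by (auto simp: W_def Z_def)
    qed
    have "\<not> (adj u d \<and> adj v d \<and> adj w d)"
      using d triple u(2) by auto
    then have "\<not> adj d (p d)"
      using adj_sym[of d u] adj_sym[of d v] adj_sym[of d w] by (auto simp: p_def)
    then show "{d, p d} \<notin> edge_set"
      by (simp add: mem_edge_set)
  qed
  have V: "V = W \<union> P j \<union> Z" "W \<inter> P j = {}" "W \<inter> Z = {}" "P j \<inter> Z = {}"
    using cover X(1,2) uvw by (auto simp: W_def Z_def)
  have indep: "{x, y} = {u, v}" if "x \<in> W" "y \<in> W" "adj x y" for x y
    using that u(1) v(1) P_indep[OF idx(1), of x y] adj_sym[OF that(3)] adj_irrefl by (auto simp: W_def)
  have indep': "\<not> adj x y" if "x \<in> P j" "y \<in> P j" for x y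
    using that P_indep[OF idx(2)] by blast
  have indep'': "\<not> adj x y" if "x \<in> Z" "y \<in> Z" for x y
    using that P_indep[OF idx(3), of x y] w(1) adj_sym[of x y] adj_irrefl by (auto simp: Z_def)
  have uW: "u \<in> W" "v \<in> W"
    by (auto simp: W_def)
  note tight = tight_partition[OF many V uW indep indep' indep'' _ cM]
  have KM: "K - edge_set = M"
    unfolding K_def using tight(1) sub unfolding K_def by blast
  have size: "(card V - 1)\<^sup>2 div 3 \<le> (card W - 1) * card (P j) + (card W - 1) * card Z + card (P j) * card Z"
    using tight(3) sub unfolding K_def by blast
  have missing: "x \<in> P j \<union> P l \<and> p x = y \<or> y \<in> P j \<union> P l \<and> p y = x" if "{x, y} \<in> K" "\<not> adj x y" for x y
  proof -
    have "{x, y} \<in> M"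
      using KM that by (auto simp: mem_edge_set)
    then show ?thesis
      by (auto simp: M_def doubleton_eq_iff)
  qed
  have v_full: "adj v c" if "c \<in> P l" for c
    using missing[of v c] p_l[OF that] that uvw by (auto simp: K_iff W_def Z_def)
  have vw: "adj v w"
    using missing[of v w] uvw by (auto simp: K_iff W_def Z_def)
  have w_full: "adj w a" if a: "a \<in> P i" for a
    using missing[of w a] cover(2,3) uvw a by (auto simp: K_iff W_def Z_def)
  have not_u: "adj v b" "adj w b" if b: "b \<in> P j" "\<not> adj u b" for b
    using missing[of v b] missing[of w b] b uvw X(2) by (auto simp: K_iff W_def Z_def p_def)
  have not_v: "adj w b" if b: "b \<in> P j" "\<not> adj v b" for b
  proof -
    have "p b \<noteq> w"
      using b uvw X(2) by (simp add: p_def)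
    then show ?thesis
      using missing[of w b] b uvw by (auto simp: K_iff Z_def)
  qed
  have big: "k \<le> card (P j)"
    using card_P(1)[OF idx(2)] h_le h_ge by linarith
  \<comment> \<open>The hub is \<open>w\<close> and the rim is \<open>v\<close>, \<open>u\<close>
    and a path from \<open>c\<close> to \<open>b\<close> between the neighbours of \<open>w\<close>
    in \<open>P j\<close> and a class fully joined to \<open>w\<close>. It is stated for variable
    \<open>v\<close> and \<open>w\<close> because it is used with both assignments.\<close>
  have wheel: False
    if vw: "adj v w" "adj u v" "adj u w" "v \<in> X" "w \<in> X" "u \<in> X"
      and full: "\<And>a. a \<in> P i' \<Longrightarrow> adj w a" and i': "i' < 3" "i' \<noteq> j"
      and b: "b \<in> P j" "adj v b" "adj w b" and c: "c \<in> P j" "adj u c" "adj w c" "c \<noteq> b"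
      and large: "k \<le> card (nbrs w (P j))" for v w i' b c
  proof (rule no_wheel_two[of "nbrs w (P j)" "P i'" u v c b w])
    show "finite (nbrs w (P j))" "finite (P i')"
      using finite_parts i' idx by auto
    show "nbrs w (P j) \<inter> P i' = {}"
      using P_disjoint[OF i'(1) idx(2) i'(2)] by auto
    show "k - 1 \<le> card (nbrs p (P i') \<inter> nbrs p' (P i'))" if "p \<in> nbrs w (P j)" "p' \<in> nbrs w (P j)" for p p'
    proof -
      have "card (P i') \<le> card (nbrs p (P i') \<inter> nbrs p' (P i')) + 2 * h"
        using that idx i' by (intro card_common_nbrs_sub[of j i']) auto
      then show ?thesis
        using card_P(1)[OF i'(1)] h_le h_ge by linarith
    qed
    show "u \<notin> nbrs w (P j)" "u \<notin> P i'" "v \<notin> nbrs w (P j)" "v \<notin> P i'"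
      using vw P_X_disjoint[OF idx(2)] P_X_disjoint[OF i'(1)] by auto
  qed (use vw full b c large adj_sym in auto)
  \<comment> \<open>A vertex missed by \<open>u\<close> is adjacent to \<open>v\<close> and
    \<open>w\<close>. As each vertex of \<open>P j\<close> sees \<open>v\<close> or
    \<open>w\<close>, one of these, say \<open>w\<close>, has at least \<open>k\<close> neighbours
    there; \<open>wheel\<close> then joins \<open>v\<close> to all of \<open>P j\<close>. With the
    roles exchanged, a neighbour \<open>a\<close> of \<open>u\<close> sees all three, against
    \<open>triple\<close>.\<close>
  have A: "adj u b" if b: "b \<in> P j" for b
  proof (rule ccontr)
    assume nu: "\<not> adj u b"
    note vb = not_u[OF b nu]
    have inX: "u \<in> X" "v \<in> X" "w \<in> X"
      using X(1) by auto
    have use_w: "\<forall>c\<in>P j. adj u c \<longrightarrow> adj v c" if "k \<le> card (nbrs w (P j))"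
    proof (intro ballI impI)
      fix c assume c: "c \<in> P j" "adj u c"
      show "adj v c"
        using wheel[OF vw X(3,4) inX(2,3,1) w_full idx(1,4) b vb c _ _ that] not_v[OF c(1)] nu c by blast
    qed
    have use_v: "\<forall>c\<in>P j. adj u c \<longrightarrow> adj w c" if "k \<le> card (nbrs v (P j))"
    proof (intro ballI impI)
      fix c assume c: "c \<in> P j" "adj u c"
      show "adj w c"
        using wheel[OF adj_sym[OF vw] X(4,3) inX(3,2,1) v_full idx(3) idx(6)[symmetric] b vb(2,1) c _ _ that]
          not_v[OF c(1)] nu c by blast
    qed
    obtain a where a: "a \<in> P j" "adj u a"
      using u(3) by auto
    have "\<not> (adj v a \<and> adj w a)"
      using triple a by auto
    have "b \<in> nbrs v (P j) \<union> nbrs w (P j)" if "b \<in> P j" for b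
      using not_v[OF that] that by (cases "adj v b") auto
    then have "P j = nbrs v (P j) \<union> nbrs w (P j)"
      using nbrs_subset by blast
    then have "card (P j) \<le> card (nbrs v (P j)) + card (nbrs w (P j))"
      by (metis card_Un_le)
    moreover have "2 * k \<le> card (P j)"
      using card_P(1)[OF idx(2)] h_le h_ge by linarith
    ultimately consider "k \<le> card (nbrs w (P j))" | "k \<le> card (nbrs v (P j))"
      by linarith
    then show False
    proof cases
      case 1
      have "\<forall>c\<in>P j. adj v c"
        using use_w[OF 1] not_u by blast
      then have "nbrs v (P j) = P j"
        by auto
      then show False
        using use_v big a \<open>\<not> (adj v a \<and> adj w a)\<close> use_w[OF 1] by auto
    next
      case 2
      have "\<forall>c\<in>P j. adj w c"
        using use_v[OF 2] not_u by blast
      then have "nbrs w (P j) = P j"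
        by auto
      then show False
        using use_w big a \<open>\<not> (adj v a \<and> adj w a)\<close> use_v[OF 2] by auto
    qed
  qed
  define S where "S = nbrs v (P j)"
  have S_w: "\<not> adj w b" if "b \<in> S" for b
  proof
    assume "adj w b"
    then have "b \<in> nbrs u (P j) \<inter> nbrs v (P j) \<inter> nbrs w (P j)"
      using A that by (simp add: S_def)
    then show False
      using triple by blast
  qed
  show ?thesis
  proof (rule balanced_GstarI[OF V uW X(3) indep indep' indep''])
    have "e \<in> K - edge_set \<longleftrightarrow>
      e \<in> edges_between (P j - S) {v} \<union> edges_between (P l) {u} \<union> edges_between S {w}" for e
    proof
      assume "e \<in> K - edge_set"
      then obtain d where d: "d \<in> P j \<union> P l" "e = {d, p d}"
        unfolding KM M_def by blast
      then show "e \<in> edges_between (P j - S) {v} \<union> edges_between (P l) {u} \<union> edges_between S {w}"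
        using A p_l by (cases "d \<in> P l") (auto simp: mem_edges_between p_def S_def)
    next
      assume "e \<in> edges_between (P j - S) {v} \<union> edges_between (P l) {u} \<union> edges_between S {w}"
      then consider b where "e = {b, v}" "b \<in> P j" "b \<notin> S" | c where "e = {c, u}" "c \<in> P l"
        | b where "e = {b, w}" "b \<in> S"
        by (auto simp: edges_between_def)
      then show "e \<in> K - edge_set"
      proof cases
        case 1
        then show ?thesis
          using adj_sym[of b v] by (auto simp: K_iff mem_edge_set W_def S_def)
      next
        case 2
        then show ?thesis
          using adj_sym[of c u] u(2) by (auto simp: K_iff mem_edge_set W_def Z_def)
      next
        case 3
        then show ?thesis
          using adj_sym[of b w] S_w[of b] by (auto simp: K_iff mem_edge_set Z_def S_def)
      qed
    qed
    moreover have "Z - {w} = P l"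
      using uvw by (auto simp: Z_def)
    ultimately show "edges (complete_tripartite W (P j) Z) - edge_set =
        edges_between (P j - S) {v} \<union> edges_between (Z - {w}) {u} \<union> edges_between S {w}"
      unfolding K_def by auto
    show "w \<in> Z"
      by (simp add: Z_def)
    show "S \<noteq> {}"
      using v(2) by (simp add: S_def)
    show "S \<subset> P j"
    proof -
      obtain b where "b \<in> P j" "adj w b"
        using w(3) by auto
      then have "b \<in> P j - S"
        using S_w by blast
      then show ?thesis
        by (auto simp: S_def)
    qed
  qed (use size in auto)
qed

lemma core_balanced:
  assumes "(card V - 1)\<^sup>2 div 3 + 2 \<le> card edge_set" "core_config"
  shows balanced_Gstar
  using assms not_singleton_core edge_core_balanced path_core_balanced unfolding core_config_def by blast

end

section \<open>Turan numbers and wheels as subgraphs\<close>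

lemma div_three: "x = 3 * a \<Longrightarrow> x div 3 = a" "x = 3 * a + 1 \<Longrightarrow> x div 3 = a" for a x :: nat
  by simp_all

lemma card_residues:
  assumes "i < 3"
  shows "card {x. x < m \<and> x mod 3 = i} = (m + 2 - i) div 3"
proof (induction m)
  case 0
  then show ?case
    using assms by simp
next
  case (Suc m)
  have eq: "{x. x < Suc m \<and> x mod 3 = i} =
      (if m mod 3 = i then insert m {x. x < m \<and> x mod 3 = i} else {x. x < m \<and> x mod 3 = i})"
    by (auto simp: less_Suc_eq)
  have "card {x. x < Suc m \<and> x mod 3 = i} = (m + 2 - i) div 3 + (if m mod 3 = i then 1 else 0)"
    unfolding eq using Suc by simp
  also have "\<dots> = (Suc m + 2 - i) div 3"
  proof -
    define q where "q = m div 3"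
    have "m = 3 * q \<or> m = 3 * q + 1 \<or> m = 3 * q + 2"
      unfolding q_def by presburger
    moreover have "i = 0 \<or> i = 1 \<or> i = 2"
      using assms by auto
    ultimately show ?thesis
      by (elim disjE) (simp_all, presburger+)
  qed
  finally show ?case .
qed

text \<open>All counting arguments use this closed form, which needs no distinction by
  residues.\<close>

lemma num_edges_turan_graph: "num_edges (turan_graph m 3) = m\<^sup>2 div 3"
proof -
  define R where "R i = {x. x < m \<and> x mod 3 = i}" for i :: nat
  have "edges (turan_graph m 3) = edges (complete_tripartite (R 0) (R 1) (R 2))"
  proof (intro set_eqI iffI)
    fix e assume "e \<in> edges (turan_graph m 3)"
    then obtain x y where e: "e = {x, y}" "x < m" "y < m" "x mod 3 \<noteq> y mod 3"
      by (auto simp: turan_graph_def)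
    have "z mod 3 = 0 \<or> z mod 3 = 1 \<or> z mod 3 = 2" for z :: nat
      by presburger
    from this[of x] this[of y] show "e \<in> edges (complete_tripartite (R 0) (R 1) (R 2))"
      using e(2-4) unfolding e(1) edges_complete_tripartite by (auto simp: mem_edges_between R_def)
  next
    fix e assume "e \<in> edges (complete_tripartite (R 0) (R 1) (R 2))"
    then show "e \<in> edges (turan_graph m 3)"
      unfolding edges_complete_tripartite turan_graph_def by (fastforce simp: edges_between_def R_def)
  qed
  moreover have "finite (R i)" for i
    by (simp add: R_def)
  moreover have "R 0 \<inter> R 1 = {}" "R 0 \<inter> R 2 = {}" "R 1 \<inter> R 2 = {}"
    by (auto simp: R_def)
  ultimately have "num_edges (turan_graph m 3) =
      card (R 0) * card (R 1) + card (R 0) * card (R 2) + card (R 1) * card (R 2)"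
    unfolding num_edges_def using card_edges_complete_tripartite(1)[of "R 0" "R 1" "R 2"] by simp
  also have "\<dots> = (m + 2) div 3 * ((m + 1) div 3) + (m + 2) div 3 * (m div 3) + (m + 1) div 3 * (m div 3)"
    unfolding R_def using card_residues[of 0 m] card_residues[of 1 m] card_residues[of 2 m] by simp
  also have "(m + 2) div 3 * ((m + 1) div 3) + (m + 2) div 3 * (m div 3) + (m + 1) div 3 * (m div 3) = m\<^sup>2 div 3"
  proof -
    define q where "q = m div 3"
    have "m = 3 * q \<or> m = 3 * q + 1 \<or> m = 3 * q + 2"
      unfolding q_def by presburger
    then show ?thesis
    proof (elim disjE)
      assume m: "m = 3 * q"
      then have "m\<^sup>2 = 3 * (3 * q * q)"
        by (simp add: power2_eq_square)
      then have "m\<^sup>2 div 3 = 3 * q * q"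
        by (rule div_three)
      moreover have "(m + 2) div 3 = q" "(m + 1) div 3 = q" "m div 3 = q"
        using m by auto
      ultimately show ?thesis by simp
    next
      assume m: "m = 3 * q + 1"
      then have "m\<^sup>2 = 3 * (3 * q * q + 2 * q) + 1"
        by (simp add: power2_eq_square)
      then have "m\<^sup>2 div 3 = 3 * q * q + 2 * q"
        by (rule div_three)
      moreover have "(m + 2) div 3 = q + 1" "(m + 1) div 3 = q" "m div 3 = q"
        using m by auto
      ultimately show ?thesis by (simp add: algebra_simps)
    next
      assume m: "m = 3 * q + 2"
      then have "m\<^sup>2 = 3 * (3 * q * q + 4 * q + 1) + 1"
        by (simp add: power2_eq_square)
      then have "m\<^sup>2 div 3 = 3 * q * q + 4 * q + 1"
        by (rule div_three)
      moreover have "(m + 2) div 3 = q + 1" "(m + 1) div 3 = q + 1" "m div 3 = q"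
        using m by auto
      ultimately show ?thesis by (simp add: algebra_simps)
    qed
  qed
  finally show ?thesis .
qed

lemma turan_edge_difference:
  assumes "1 \<le> n"
  shows "int (n\<^sup>2 div 3) - (int n - \<lceil>real n / 3\<rceil>) = int ((n - 1)\<^sup>2 div 3)"
proof -
  define q where "q = (n - 1) div 3"
  have "n = 3 * q + 1 \<or> n = 3 * q + 2 \<or> n = 3 * q + 3"
    unfolding q_def using assms by presburger
  then show ?thesis
  proof (elim disjE)
    assume n: "n = 3 * q + 1"
    then have "n\<^sup>2 = 3 * (3 * q * q + 2 * q) + 1" "(n - 1)\<^sup>2 = 3 * (3 * q * q)"
      by (simp_all add: power2_eq_square algebra_simps)
    then have "n\<^sup>2 div 3 = 3 * q * q + 2 * q" "(n - 1)\<^sup>2 div 3 = 3 * q * q"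
      using div_three by blast+
    moreover have "\<lceil>real n / 3\<rceil> = int q + 1"
      using n by (intro ceiling_unique) auto
    ultimately show ?thesis
      using n by simp
  next
    assume n: "n = 3 * q + 2"
    then have "n\<^sup>2 = 3 * (3 * q * q + 4 * q + 1) + 1" "(n - 1)\<^sup>2 = 3 * (3 * q * q + 2 * q) + 1"
      by (simp_all add: power2_eq_square algebra_simps)
    then have "n\<^sup>2 div 3 = 3 * q * q + 4 * q + 1" "(n - 1)\<^sup>2 div 3 = 3 * q * q + 2 * q"
      using div_three by blast+
    moreover have "\<lceil>real n / 3\<rceil> = int q + 1"
      using n by (intro ceiling_unique) auto
    ultimately show ?thesis
      using n by simp
  next
    assume n: "n = 3 * q + 3"
    then have "n\<^sup>2 = 3 * (3 * q * q + 6 * q + 3)" "(n - 1)\<^sup>2 = 3 * (3 * q * q + 4 * q + 1) + 1"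
      by (simp_all add: power2_eq_square algebra_simps)
    then have "n\<^sup>2 div 3 = 3 * q * q + 6 * q + 3" "(n - 1)\<^sup>2 div 3 = 3 * q * q + 4 * q + 1"
      using div_three by blast+
    moreover have "\<lceil>real n / 3\<rceil> = int q + 1"
      using n by (intro ceiling_unique) auto
    ultimately show ?thesis
      using n by simp
  qed
qed

text \<open>With \<open>x\<close> and \<open>y\<close> the differences of \<open>a\<close> from
  \<open>b\<close> and \<open>c\<close>, \<open>2 * m\<^sup>2\<close> is six times the product sum
  plus \<open>x\<^sup>2 + y\<^sup>2 + (x - y)\<^sup>2\<close>. Rounding in \<open>div 3\<close>
  costs at most 2, so this form is at most 4, which leaves only differences of absolute value at
  most 1.\<close>

lemma balanced_if_product_large:
  fixes a b c m :: nat
  assumes m: "a + b + c = m" and le: "m\<^sup>2 div 3 \<le> a * b + a * c + b * c"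
  shows "int a = \<lceil>real m / 3\<rceil> \<or> int a = \<lfloor>real m / 3\<rfloor>" "\<bar>int b - int c\<bar> \<le> 1"
proof -
  define x y where "x = int a - int b" and "y = int a - int c"
  have "r \<le> 3 * s + 2" if "r div 3 \<le> s" for r s :: nat
    using that by linarith
  then have "m\<^sup>2 \<le> 3 * (a * b + a * c + b * c) + 2"
    using le by blast
  then have "int (m\<^sup>2) \<le> int (3 * (a * b + a * c + b * c) + 2)"
    by (simp only: of_nat_le_iff)
  moreover have "2 * int (m\<^sup>2) = 6 * int (a * b + a * c + b * c) + (x\<^sup>2 + y\<^sup>2 + (x - y)\<^sup>2)"
    unfolding m[symmetric] x_def y_def by (simp add: power2_eq_square algebra_simps)
  ultimately have sq: "x\<^sup>2 + y\<^sup>2 + (x - y)\<^sup>2 \<le> 4"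
    by simp
  have small: "\<bar>z\<bar> \<le> 2" if "z\<^sup>2 \<le> 4" for z :: int
    using that abs_le_square_iff[of z 2] by simp
  have "x\<^sup>2 \<le> 4" "y\<^sup>2 \<le> 4" "(x - y)\<^sup>2 \<le> 4"
    using sq zero_le_power2[of x] zero_le_power2[of y] zero_le_power2[of "x - y"] by linarith+
  then have "\<bar>x\<bar> \<le> 2" "\<bar>y\<bar> \<le> 2"
    using small by blast+
  then have "x \<in> {-2, -1, 0, 1, 2}" "y \<in> {-2, -1, 0, 1, 2}"
    by auto
  then have xy: "\<bar>x\<bar> \<le> 1 \<and> \<bar>y\<bar> \<le> 1 \<and> \<bar>x - y\<bar> \<le> 1"
    using sq by auto
  then show "\<bar>int b - int c\<bar> \<le> 1"
    unfolding x_def y_def by linarith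
  \<comment> \<open>So \<open>a\<close> deviates from \<open>m / 3\<close> by
    \<open>(x + y) / 3\<close>, less than 1 in absolute value, and the sign decides between ceiling
    and floor.\<close>
  have "3 * int a = int m + x + y"
    unfolding m[symmetric] x_def y_def by simp
  then have "real_of_int (3 * int a) = real_of_int (int m + x + y)"
    by (simp only:)
  then have a: "real a = real m / 3 + (x + y) / 3"
    by (simp add: field_simps)
  have "-2 \<le> x + y" "x + y \<le> 2"
    using xy by linarith+
  then have bounds: "-2 \<le> real_of_int (x + y)" "real_of_int (x + y) \<le> 2"
    by linarith+
  have nonneg: "s / 3 \<le> r \<and> r - 1 < s / 3" if "r = s / 3 + z / 3" "0 \<le> z" "z \<le> 2" for r s z :: real
    using that by simp
  have neg: "r \<le> s / 3 \<and> s / 3 < r + 1" if "r = s / 3 + z / 3" "z < 0" "-2 \<le> z" for r s z :: real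
    using that by simp
  show "int a = \<lceil>real m / 3\<rceil> \<or> int a = \<lfloor>real m / 3\<rfloor>"
  proof (cases "0 \<le> x + y")
    case True
    then have "0 \<le> real_of_int (x + y)"
      by (simp only: of_int_0_le_iff)
    then have "real m / 3 \<le> real a" "real a - 1 < real m / 3"
      using nonneg[OF a] bounds by blast+
    then have "\<lceil>real m / 3\<rceil> = int a"
      by (intro ceiling_unique) simp_all
    then show ?thesis by simp
  next
    case False
    then have "real_of_int (x + y) < 0"
      by (simp only: of_int_less_0_iff not_le)
    then have "real a \<le> real m / 3" "real m / 3 < real a + 1"
      using neg[OF a] bounds by blast+
    then have "\<lfloor>real m / 3\<rfloor> = int a"
      by (intro floor_unique) simp_all
    then show ?thesis by simp
  qed
qed

text \<open>The same quadratic form is now at most 2, so three times the product sum is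
  \<open>m\<^sup>2\<close> or \<open>m\<^sup>2 - 1\<close>.\<close>

lemma product_of_balanced:
  fixes a b c m :: nat
  assumes m: "a + b + c = m" and a: "int a = \<lceil>real m / 3\<rceil> \<or> int a = \<lfloor>real m / 3\<rfloor>"
    and bc: "\<bar>int b - int c\<bar> \<le> 1"
  shows "a * b + a * c + b * c = m\<^sup>2 div 3"
proof -
  have f: "real_of_int \<lfloor>real m / 3\<rfloor> \<le> real m / 3" "real m / 3 < \<lfloor>real m / 3\<rfloor> + 1"
    "real m / 3 \<le> \<lceil>real m / 3\<rceil>" "real_of_int \<lceil>real m / 3\<rceil> < real m / 3 + 1"
    by linarith+
  have "real m / 3 - 1 < real_of_int z \<and> real_of_int z < real m / 3 + 1"
    if "z = \<lceil>real m / 3\<rceil> \<or> z = \<lfloor>real m / 3\<rfloor>" for z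
    using that f by (elim disjE) linarith+
  from this[OF a] have "real m / 3 - 1 < real_of_int (int a)" "real_of_int (int a) < real m / 3 + 1"
    by blast+
  then have "int m - 3 < 3 * int a" "3 * int a < int m + 3"
    by linarith+
  define x y where "x = int a - int b" and "y = int a - int c"
  have xy: "\<bar>x - y\<bar> \<le> 1" "\<bar>x + y\<bar> \<le> 2"
    using bc \<open>int m - 3 < 3 * int a\<close> \<open>3 * int a < int m + 3\<close> m unfolding x_def y_def by linarith+
  then have "\<bar>x\<bar> \<le> 1" "\<bar>y\<bar> \<le> 1"
    by linarith+
  then have "x \<in> {-1, 0, 1}" "y \<in> {-1, 0, 1}"
    by auto
  then have "x\<^sup>2 + y\<^sup>2 + (x - y)\<^sup>2 \<le> 2"
    using xy by auto
  moreover have "2 * int (m\<^sup>2) = 6 * int (a * b + a * c + b * c) + (x\<^sup>2 + y\<^sup>2 + (x - y)\<^sup>2)"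
    unfolding m[symmetric] x_def y_def by (simp add: power2_eq_square algebra_simps)
  moreover have "0 \<le> x\<^sup>2 + y\<^sup>2 + (x - y)\<^sup>2"
    by simp
  ultimately have "int (m\<^sup>2) \<le> 3 * int (a * b + a * c + b * c) + 1" "3 * int (a * b + a * c + b * c) \<le> int (m\<^sup>2)"
    by linarith+
  then have "m\<^sup>2 \<le> 3 * (a * b + a * c + b * c) + 1" "3 * (a * b + a * c + b * c) \<le> m\<^sup>2"
    by linarith+
  moreover have "s = r div 3" if "r \<le> 3 * s + 1" "3 * s \<le> r" for r s :: nat
    using that by linarith
  ultimately show ?thesis
    by blast
qed

context symmetric_relation
begin

text \<open>The ordered adjacent pairs are grouped by the edge they span, two for each;
  \<open>Q e\<close> is the group of \<open>e\<close>.\<close>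

lemma deg_sum_eq_card_edges:
  assumes "finite V"
  shows "deg_sum V V = 2 * card {{x, y} | x y. x \<in> V \<and> y \<in> V \<and> adj x y}"
proof -
  define E where "E = {{x, y} | x y. x \<in> V \<and> y \<in> V \<and> adj x y}"
  define Q where "Q e = {(x, y). {x, y} = e}" for e :: "'a set"
  have finE: "finite E"
    by (rule finite_subset[of _ "Pow V"]) (use assms in \<open>auto simp: E_def\<close>)
  have Q2: "finite (Q e) \<and> card (Q e) = 2" if "e \<in> E" for e
  proof -
    obtain x y where xy: "e = {x, y}" "adj x y"
      using \<open>e \<in> E\<close> by (auto simp: E_def)
    then have "x \<noteq> y"
      using adj_irrefl by blast
    moreover have "Q e = {(x, y), (y, x)}"
      unfolding Q_def xy(1) by (auto simp: doubleton_eq_iff)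
    ultimately show ?thesis
      by simp
  qed
  have "deg_sum V V = card (SIGMA x:V. nbrs x V)"
    using assms by (simp add: deg_sum_def)
  also have "(SIGMA x:V. nbrs x V) = (\<Union>e\<in>E. Q e)"
  proof (intro set_eqI iffI)
    fix z assume "z \<in> (\<Union>e\<in>E. Q e)"
    then obtain x y a b where "z = (x, y)" "{x, y} = {a, b}" "a \<in> V" "b \<in> V" "adj a b"
      by (auto simp: E_def Q_def)
    then show "z \<in> (SIGMA x:V. nbrs x V)"
      using adj_sym[of a b] by (auto simp: doubleton_eq_iff)
  next
    fix z assume "z \<in> (SIGMA x:V. nbrs x V)"
    then obtain x y where xy: "z = (x, y)" "x \<in> V" "y \<in> V" "adj x y"
      by auto
    then have "{x, y} \<in> E"
      unfolding E_def by blast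
    then show "z \<in> (\<Union>e\<in>E. Q e)"
      using xy(1) by (auto simp: Q_def)
  qed
  also have "card (\<Union>e\<in>E. Q e) = (\<Sum>e\<in>E. card (Q e))"
    using finE Q2 by (intro card_UN_disjoint) (auto simp: Q_def)
  also have "\<dots> = 2 * card E"
    using Q2 by simp
  finally show ?thesis
    by (simp add: E_def)
qed

end

lemma successively_nth: "successively R xs \<Longrightarrow> Suc i < length xs \<Longrightarrow> R (xs ! i) (xs ! Suc i)"
proof (induction xs arbitrary: i rule: induct_list012)
  case (3 x y zs)
  then show ?case
    by (cases i) auto
qed auto

lemma graph_iso_image:
  assumes "inj_on g (verts H)" "\<And>e. e \<in> edges H \<Longrightarrow> e \<subseteq> verts H"
  shows "graph_iso (g ` verts H, (\<lambda>e. g ` e) ` edges H) H"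
  unfolding graph_iso_def
proof (intro exI conjI)
  show "bij_betw (the_inv_into (verts H) g) (verts (g ` verts H, (\<lambda>e. g ` e) ` edges H)) (verts H)"
    using assms(1) by (simp add: bij_betw_the_inv_into inj_on_imp_bij_betw)
  have "the_inv_into (verts H) g ` g ` e = e" if "e \<in> edges H" for e
  proof -
    have "the_inv_into (verts H) g (g x) = x" if "x \<in> e" for x
      using assms that \<open>e \<in> edges H\<close> by (intro the_inv_into_f_f) auto
    then show ?thesis
      by (auto simp: image_image)
  qed
  then show "edges H = (\<lambda>e. the_inv_into (verts H) g ` e) ` edges (g ` verts H, (\<lambda>e. g ` e) ` edges H)"
    by (simp add: image_image)
qed

lemma verts_wheel: "verts (wheel (2 * k + 2)) = {..<2 * k + 2}"
  by (auto simp: wheel_def cycle_graph_def)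

lemma edges_wheel:
  "edges (wheel (2 * k + 2)) = {{i, (i + 1) mod (2 * k + 1)} | i. i < 2 * k + 1} \<union> {{i, 2 * k + 1} | i. i < 2 * k + 1}"
  by (auto simp: wheel_def cycle_graph_def)

text \<open>A rim list and a hub define the map \<open>g\<close> on the vertices of
  \<open>wheel\<close>, injective since the hub is off the rim; its image would be a forbidden
  subgraph.\<close>

lemma wheel_free_adjacency:
  assumes G: "simple_graph G" "free_of (wheel (2 * k + 2)) G" and "2 \<le> k"
  shows "wheel_free (\<lambda>x y. {x, y} \<in> edges G) k"
proof
  show "2 \<le> k" by fact
  show "{y, x} \<in> edges G" if "{x, y} \<in> edges G" for x y
    using that by (simp add: insert_commute)
  show "{x, x} \<notin> edges G" for x
  proof
    assume "{x, x} \<in> edges G"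
    then have "card {x, x} = 2"
      using G(1) unfolding simple_graph_def by blast
    then show False by simp
  qed
  fix xs h
  assume xs: "distinct xs" "length xs = 2 * k + 1" "successively (\<lambda>x y. {x, y} \<in> edges G) xs"
    "{last xs, hd xs} \<in> edges G" "\<And>x. x \<in> set xs \<Longrightarrow> {h, x} \<in> edges G"
  define g where "g i = (if i < 2 * k + 1 then xs ! i else h)" for i
  have "h \<notin> set xs"
  proof
    assume "h \<in> set xs"
    then have "{h, h} \<in> edges G"
      using xs(5) by blast
    then have "card {h, h} = 2"
      using G(1) unfolding simple_graph_def by blast
    then show False by simp
  qed
  then have inj: "inj_on g (verts (wheel (2 * k + 2)))"
    unfolding verts_wheel g_def using xs(1,2) by (auto simp: inj_on_def nth_eq_iff_index_eq less_Suc_eq split: if_splits)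
  have sub: "e \<subseteq> verts (wheel (2 * k + 2))" if "e \<in> edges (wheel (2 * k + 2))" for e
  proof -
    consider i where "e = {i, (i + 1) mod (2 * k + 1)}" "i < 2 * k + 1" | i where "e = {i, 2 * k + 1}" "i < 2 * k + 1"
      using \<open>e \<in> edges (wheel (2 * k + 2))\<close> unfolding edges_wheel by blast
    then show ?thesis
    proof cases
      case (1 i)
      have "(i + 1) mod (2 * k + 1) < 2 * k + 2"
        by (rule less_trans[OF mod_less_divisor]) auto
      then show ?thesis
        using 1 unfolding verts_wheel by auto
    next
      case 2
      then show ?thesis
        unfolding verts_wheel by auto
    qed
  qed
  have img: "g ` e \<in> edges G" if "e \<in> edges (wheel (2 * k + 2))" for e
  proof -
    consider i where "e = {i, (i + 1) mod (2 * k + 1)}" "i < 2 * k + 1" | i where "e = {i, 2 * k + 1}" "i < 2 * k + 1"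
      using \<open>e \<in> edges (wheel (2 * k + 2))\<close> unfolding edges_wheel by blast
    then show ?thesis
    proof cases
      case (1 i)
      show ?thesis
      proof (cases "i = 2 * k")
        case True
        have "xs \<noteq> []" using xs(2) by auto
        then have "last xs = xs ! (2 * k)" "hd xs = xs ! 0"
          using xs(2) by (auto simp: last_conv_nth hd_conv_nth)
        then show ?thesis
          using xs(4) 1 True by (simp add: g_def)
      next
        case False
        then show ?thesis
          using successively_nth[OF xs(3), of i] 1 xs(2) by (simp add: g_def)
      qed
    next
      case (2 i)
      then show ?thesis
        using xs(5)[of "xs ! i"] xs(2) by (simp add: g_def insert_commute)
    qed
  qed
  have "is_subgraph (g ` verts (wheel (2 * k + 2)), (\<lambda>e. g ` e) ` edges (wheel (2 * k + 2))) G"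
    unfolding is_subgraph_def
  proof (intro conjI)
    have "\<exists>e\<in>edges (wheel (2 * k + 2)). i \<in> e" if "i \<in> verts (wheel (2 * k + 2))" for i
      using that unfolding verts_wheel edges_wheel by (cases "i = 2 * k + 1") (auto simp: less_Suc_eq)
    then show "verts (g ` verts (wheel (2 * k + 2)), (\<lambda>e. g ` e) ` edges (wheel (2 * k + 2))) \<subseteq> verts G"
      using img G(1) unfolding simple_graph_def by fastforce
    show "simple_graph (g ` verts (wheel (2 * k + 2)), (\<lambda>e. g ` e) ` edges (wheel (2 * k + 2)))"
      using img sub G(1) unfolding simple_graph_def verts_wheel by auto
  qed (use img in auto)
  moreover have "graph_iso (g ` verts (wheel (2 * k + 2)), (\<lambda>e. g ` e) ` edges (wheel (2 * k + 2))) (wheel (2 * k + 2))"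
    by (rule graph_iso_image[OF inj sub])
  ultimately show False
    using G(2) unfolding free_of_def by blast
qed

text \<open>The converse passage, from a wheel subgraph to a cyclic enumeration of its rim, in which
  form the extremal graphs are examined.\<close>

lemma rim_of_wheel:
  assumes "\<not> free_of (wheel (2 * k + 2)) G"
  shows "\<exists>h r. inj_on r {..<2 * k + 1} \<and> (\<forall>i<2 * k + 1. {r i, r ((i + 1) mod (2 * k + 1))} \<in> edges G \<and> {r i, h} \<in> edges G)"
proof -
  obtain S f where S: "is_subgraph S G" and f: "bij_betw f (verts S) (verts (wheel (2 * k + 2)))"
    "edges (wheel (2 * k + 2)) = (\<lambda>e. f ` e) ` edges S"
    using assms unfolding free_of_def graph_iso_def by blast
  define g where "g = the_inv_into (verts S) f"
  have injf: "inj_on f (verts S)"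
    using f(1) by (simp add: bij_betw_def)
  have g: "bij_betw g (verts (wheel (2 * k + 2))) (verts S)"
    unfolding g_def by (rule bij_betw_the_inv_into[OF f(1)])
  have gf: "g (f x) = x" if "x \<in> verts S" for x
    unfolding g_def using the_inv_into_f_f[OF injf that] .
  have edge: "{g a, g b} \<in> edges G" if ab: "{a, b} \<in> edges (wheel (2 * k + 2))" for a b
  proof -
    obtain e where e: "e \<in> edges S" "{a, b} = f ` e"
      using ab unfolding f(2) by auto
    have "e \<subseteq> verts S"
      using e(1) S unfolding is_subgraph_def simple_graph_def by blast
    then have "g ` f ` e = e"
      using gf by (force simp: image_image)
    then have "{g a, g b} = e"
      using e(2) by (metis image_empty image_insert)
    then show ?thesis
      using e(1) S unfolding is_subgraph_def by blast
  qed
  show ?thesis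
  proof (intro exI conjI allI impI)
    show "inj_on g {..<2 * k + 1}"
      using g unfolding verts_wheel bij_betw_def by (rule inj_on_subset[OF conjunct1]) auto
    fix i assume i: "i < 2 * k + 1"
    show "{g i, g ((i + 1) mod (2 * k + 1))} \<in> edges G"
      by (rule edge) (use i in \<open>unfold edges_wheel, blast\<close>)
    show "{g i, g (2 * k + 1)} \<in> edges G"
      by (rule edge) (use i in \<open>unfold edges_wheel, blast\<close>)
  qed
qed

text \<open>If membership in \<open>A\<close> changed at every step it would follow the parity of
  the index, yet the last index \<open>2 * k\<close> and the first index 0, also consecutive, are
  both even.\<close>

lemma odd_cycle_monochromatic:
  fixes r :: "nat \<Rightarrow> 'a"
  shows "\<exists>i<2 * k + 1. (r i \<in> A) = (r ((i + 1) mod (2 * k + 1)) \<in> A)"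
proof (rule ccontr)
  assume "\<not> ?thesis"
  then have step: "(r i \<in> A) \<noteq> (r ((i + 1) mod (2 * k + 1)) \<in> A)" if "i < 2 * k + 1" for i
    using that by blast
  have alt: "i < 2 * k + 1 \<Longrightarrow> (r i \<in> A) = ((r 0 \<in> A) = even i)" for i
  proof (induction i)
    case (Suc i)
    have "(i + 1) mod (2 * k + 1) = Suc i"
      using Suc.prems by simp
    then have "(r i \<in> A) \<noteq> (r (Suc i) \<in> A)"
      using step[of i] Suc.prems by (metis Suc_lessD)
    moreover have "(r i \<in> A) = ((r 0 \<in> A) = even i)"
      using Suc by simp
    ultimately show ?case
      unfolding even_Suc by blast
  qed simp
  have "(2 * k + 1) mod (2 * k + 1) = 0"
    by simp
  then have "(r (2 * k) \<in> A) \<noteq> (r 0 \<in> A)"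
    using step[of "2 * k"] by (metis less_add_one)
  then show False
    using alt[of "2 * k"] by simp
qed

text \<open>Successor and predecessor on the cycle, which differ since \<open>m\<close> is at least
  3.\<close>

lemma rim_vertex_two_neighbours:
  fixes i m :: nat
  assumes inj: "inj_on r {..<m}" and m: "3 \<le> m" and i: "i < m"
    and adj: "\<And>i. i < m \<Longrightarrow> {r i, r ((i + 1) mod m)} \<in> E"
  shows "\<exists>i'<m. \<exists>i''<m. r i' \<noteq> r i'' \<and> {r i, r i'} \<in> E \<and> {r i, r i''} \<in> E"
proof -
  define i' where "i' = (i + 1) mod m"
  define i'' where "i'' = (if i = 0 then m - 1 else i - 1)"
  have lt: "i' < m" "i'' < m"
    using m i by (auto simp: i'_def i''_def)
  have "(i'' + 1) mod m = i"
    using i m by (auto simp: i''_def)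
  then have "{r i'', r i} \<in> E"
    using adj[OF lt(2)] by simp
  moreover have "i' \<noteq> i''"
  proof (cases "i + 1 = m")
    case True
    then show ?thesis
      using m by (auto simp: i'_def i''_def)
  next
    case False
    then show ?thesis
      using m i by (auto simp: i'_def i''_def)
  qed
  then have "r i' \<noteq> r i''"
    using inj lt by (auto simp: inj_on_def)
  ultimately show ?thesis
    using lt adj[OF i] unfolding i'_def[symmetric] by (metis insert_commute)
qed

section \<open>The extremal family\<close>

locale gstar =
  fixes V1 V2 V3 :: "'a set" and u v w :: 'a and S :: "'a set"
  assumes finite: "finite V1" "finite V2" "finite V3"
    and disjoint: "V1 \<inter> V2 = {}" "V1 \<inter> V3 = {}" "V2 \<inter> V3 = {}"
    and uvw: "u \<in> V1" "v \<in> V1" "u \<noteq> v" "w \<in> V3"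
    and S: "S \<subset> V2" "S \<noteq> {}"
begin

abbreviation G :: "'a ugraph" where "G \<equiv> Gstar V1 V2 V3 u v w S"

lemma verts_G: "verts G = V1 \<union> V2 \<union> V3"
  by (simp add: Gstar_def)

lemma edges_G: "edges G = insert {u, v} (edges (complete_tripartite V1 V2 V3)) -
    (edges_between (V2 - S) {v} \<union> edges_between (V3 - {w}) {u} \<union> edges_between S {w})"
  by (simp add: Gstar_def)

lemma mem_G: "{x, y} \<in> edges G \<longleftrightarrow>
    ({x, y} = {u, v} \<or> {x, y} \<in> edges_between V1 V2 \<or> {x, y} \<in> edges_between V1 V3 \<or> {x, y} \<in> edges_between V2 V3) \<and>
    {x, y} \<notin> edges_between (V2 - S) {v} \<and> {x, y} \<notin> edges_between (V3 - {w}) {u} \<and> {x, y} \<notin> edges_between S {w}"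
  unfolding edges_G edges_complete_tripartite by blast

lemma S_V2: "x \<in> S \<Longrightarrow> x \<in> V2"
  using S by blast

lemma edge_uv: "{u, v} \<in> edges G"
  using uvw disjoint S unfolding mem_G mem_edges_between by blast

lemma edge_12: "x \<in> V1 \<Longrightarrow> y \<in> V2 \<Longrightarrow> (x = v \<Longrightarrow> y \<in> S) \<Longrightarrow> {x, y} \<in> edges G"
  using uvw disjoint S unfolding mem_G mem_edges_between by blast

lemma edge_13: "x \<in> V1 \<Longrightarrow> y \<in> V3 \<Longrightarrow> (x = u \<Longrightarrow> y = w) \<Longrightarrow> {x, y} \<in> edges G"
  using uvw disjoint S unfolding mem_G mem_edges_between by blast

lemma edge_23: "x \<in> V2 \<Longrightarrow> y \<in> V3 \<Longrightarrow> (y = w \<Longrightarrow> x \<notin> S) \<Longrightarrow> {x, y} \<in> edges G"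
  using uvw disjoint S unfolding mem_G mem_edges_between by blast

lemma edge_within_V1: "{x, y} \<in> edges G \<Longrightarrow> x \<in> V1 \<Longrightarrow> y \<in> V1 \<Longrightarrow> {x, y} = {u, v}"
  using disjoint unfolding mem_G mem_edges_between by blast

lemma no_edge_within:
  "x \<in> V2 \<Longrightarrow> y \<in> V2 \<Longrightarrow> {x, y} \<notin> edges G" "x \<in> V3 \<Longrightarrow> y \<in> V3 \<Longrightarrow> {x, y} \<notin> edges G"
  using disjoint uvw unfolding mem_G mem_edges_between doubleton_eq_iff by blast+

lemma edge_v: "{v, b} \<in> edges G \<Longrightarrow> b \<in> V2 \<Longrightarrow> b \<in> S"
  unfolding mem_G mem_edges_between by blast

lemma edge_u: "{u, c} \<in> edges G \<Longrightarrow> c \<in> V3 \<Longrightarrow> c = w"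
  unfolding mem_G mem_edges_between by blast

lemma edge_w: "{w, b} \<in> edges G \<Longrightarrow> b \<notin> S"
  unfolding mem_G mem_edges_between by blast

lemma edge_verts: "{x, y} \<in> edges G \<Longrightarrow> x \<in> verts G"
  using uvw unfolding mem_G mem_edges_between verts_G doubleton_eq_iff by blast

lemma simple: "simple_graph G"
  unfolding simple_graph_def
proof (intro conjI ballI)
  show "finite (verts G)"
    using finite by (simp add: verts_G)
  fix e assume e: "e \<in> edges G"
  then consider "e = {u, v}" | "e \<in> edges_between V1 V2" | "e \<in> edges_between V1 V3" | "e \<in> edges_between V2 V3"
    unfolding edges_G edges_complete_tripartite by blast
  then have "\<exists>x y. e = {x, y} \<and> x \<noteq> y"
  proof cases
    case 1
    then show ?thesis
      using uvw(3) by blast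
  next
    case 2
    then show ?thesis
      using disjoint(1) unfolding edges_between_def by blast
  next
    case 3
    then show ?thesis
      using disjoint(2) unfolding edges_between_def by blast
  next
    case 4
    then show ?thesis
      using disjoint(3) unfolding edges_between_def by blast
  qed
  then obtain x y where "e = {x, y}" "x \<noteq> y"
    by blast
  then show "card e = 2" "e \<subseteq> verts G"
    using e edge_verts[of x y] edge_verts[of y x] by (auto simp: insert_commute)
qed

lemma no_loop: "{x, x} \<notin> edges G"
proof
  assume "{x, x} \<in> edges G"
  then have "card {x, x} = 2"
    using simple unfolding simple_graph_def by blast
  then show False by simp
qed

text \<open>The three kinds of deleted edges number \<open>card V2 - card S\<close>,
  \<open>card V3 - 1\<close> and \<open>card S\<close>, together one less than the degree of a
  vertex of \<open>V1\<close> in the complete tripartite graph, whatever \<open>S\<close> is. The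
  edge \<open>u v\<close> contributes the other unit of the 2.\<close>

lemma num_edges_G:
  "num_edges G = (card V1 - 1) * card V2 + (card V1 - 1) * card V3 + card V2 * card V3 + 2"
proof -
  define K where "K = edges (complete_tripartite V1 V2 V3)"
  define M1 M2 M3 where "M1 = edges_between (V2 - S) {v}" and "M2 = edges_between (V3 - {w}) {u}"
    and "M3 = edges_between S {w}"
  have K: "card K = card V1 * card V2 + card V1 * card V3 + card V2 * card V3" "finite K"
    unfolding K_def using card_edges_complete_tripartite[OF finite disjoint] by auto
  have finS: "finite S" "card S \<le> card V2"
    using S finite by (auto intro: finite_subset card_mono)
  have M: "card M1 = card V2 - card S" "card M2 = card V3 - 1" "card M3 = card S"
    "finite M1" "finite M2" "finite M3"
  proof -
    have "(V2 - S) \<inter> {v} = {}" "(V3 - {w}) \<inter> {u} = {}" "S \<inter> {w} = {}"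
      using uvw disjoint S by blast+
    then show "card M1 = card V2 - card S" "card M2 = card V3 - 1" "card M3 = card S"
      "finite M1" "finite M2" "finite M3"
      unfolding M1_def M2_def M3_def using finite finS uvw(4) S
      by (simp_all add: card_edges_between card_Diff_subset psubset_imp_subset)
  qed
  have d: "M1 \<inter> M2 = {}" "(M1 \<union> M2) \<inter> M3 = {}"
    unfolding M1_def M2_def M3_def using uvw disjoint S
    by (blast elim: edges_betweenE dest: doubleton_eq_iff[THEN iffD1])+
  have sub: "M1 \<union> M2 \<union> M3 \<subseteq> K"
  proof
    fix e assume "e \<in> M1 \<union> M2 \<union> M3"
    then obtain x y where e: "e = {x, y}" "x \<in> V2 \<and> y \<in> V1 \<or> x \<in> V3 \<and> y \<in> V1 \<or> x \<in> V2 \<and> y \<in> V3"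
      unfolding M1_def M2_def M3_def using uvw S_V2 by (blast elim: edges_betweenE)
    then show "e \<in> K"
      unfolding K_def edges_complete_tripartite e(1) Un_iff mem_edges_between by blast
  qed
  have uv: "{u, v} \<notin> K"
    using uvw disjoint unfolding K_def edges_complete_tripartite Un_iff mem_edges_between by blast
  have eq: "edges G = insert {u, v} (K - (M1 \<union> M2 \<union> M3))"
    using sub uv unfolding edges_G K_def[symmetric] M1_def[symmetric] M2_def[symmetric] M3_def[symmetric]
    by blast
  have "card (M1 \<union> M2 \<union> M3) = card V2 - card S + (card V3 - 1) + card S"
    using d M by (simp add: card_Un_disjoint)
  moreover have pos: "0 < card V1" "0 < card V3"
    using uvw finite by (auto simp: card_gt_0_iff)
  ultimately have cM: "card (M1 \<union> M2 \<union> M3) + 1 = card V2 + card V3"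
    using finS by simp
  have "card (K - (M1 \<union> M2 \<union> M3)) = card K - card (M1 \<union> M2 \<union> M3)"
    using sub M by (intro card_Diff_subset) auto
  moreover have "card (M1 \<union> M2 \<union> M3) \<le> card K"
    using sub K by (intro card_mono)
  ultimately have "num_edges G + card (M1 \<union> M2 \<union> M3) = card K + 1"
    unfolding num_edges_def eq using uv K by simp
  moreover obtain a where a: "card V1 = Suc a"
    using pos gr0_implies_Suc by blast
  moreover have "card K = a * card V2 + a * card V3 + card V2 * card V3 + (card V2 + card V3)"
    using K(1) a by simp
  ultimately show ?thesis
    using cM by simp
qed

text \<open>The triangle \<open>a s c\<close> uses all three colours. Then \<open>r\<close> must
  have the colour of \<open>s\<close>, \<open>v\<close> that of \<open>a\<close> and
  \<open>w\<close> that of \<open>c\<close>, so no colour is left for \<open>u\<close>, which is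
  adjacent to \<open>s\<close>, \<open>v\<close> and \<open>w\<close>.\<close>

lemma not_3_partite:
  assumes "2 < card V1" "1 < card V3"
  shows "\<not> r_partite 3 G"
proof
  assume "r_partite 3 G"
  then obtain P where P: "partition_on (verts G) P" "finite P" "card P = 3"
    and indep: "\<And>A e. A \<in> P \<Longrightarrow> e \<in> edges G \<Longrightarrow> \<not> e \<subseteq> A"
    unfolding r_partite_def by blast
  have "\<exists>A\<in>P. x \<in> A" if "x \<in> verts G" for x
    using P(1) that unfolding partition_on_def by blast
  then obtain col where col: "col x \<in> P \<and> x \<in> col x" if "x \<in> verts G" for x
    by metis
  have proper: "col x \<noteq> col y" if "{x, y} \<in> edges G" for x y
  proof
    assume "col x = col y"
    moreover have "x \<in> verts G" "y \<in> verts G"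
      using edge_verts[OF that] edge_verts[of y x] that by (auto simp: insert_commute)
    ultimately have "{x, y} \<subseteq> col x" "col x \<in> P"
      using col[of x] col[of y] by auto
    then show False
      using indep that by blast
  qed
  have "\<not> V1 \<subseteq> {u, v}"
    using assms(1) card_mono[of "{u, v}" V1] uvw(3) by auto
  then obtain a where a: "a \<in> V1" "a \<noteq> u" "a \<noteq> v"
    by blast
  have "\<not> V3 \<subseteq> {w}"
    using assms(2) card_mono[of "{w}" V3] by auto
  then obtain c where c: "c \<in> V3" "c \<noteq> w"
    by blast
  obtain s where s: "s \<in> S" "s \<in> V2"
    using S by blast
  obtain r where r: "r \<in> V2" "r \<notin> S"
    using S by blast
  have ac: "col a \<noteq> col c"
    by (intro proper edge_13) (use a c in auto)
  have as: "col a \<noteq> col s"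
    by (intro proper edge_12) (use a s in auto)
  have ar: "col a \<noteq> col r"
    by (intro proper edge_12) (use a r in auto)
  have sc: "col s \<noteq> col c"
    by (intro proper edge_23) (use s c in auto)
  have rc: "col r \<noteq> col c"
    by (intro proper edge_23) (use r c in auto)
  have vs: "col v \<noteq> col s"
    by (intro proper edge_12) (use uvw s in auto)
  have vc: "col v \<noteq> col c"
    by (intro proper edge_13) (use uvw c in auto)
  have aw: "col a \<noteq> col w"
    by (intro proper edge_13) (use a uvw in auto)
  have rw: "col r \<noteq> col w"
    by (intro proper edge_23) (use r uvw in auto)
  have us: "col u \<noteq> col s"
    by (intro proper edge_12) (use uvw s in auto)
  have uw: "col u \<noteq> col w"
    by (intro proper edge_13) (use uvw in auto)
  have uv': "col u \<noteq> col v"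
    by (intro proper edge_uv)
  have inP: "col x \<in> P" if "x \<in> {a, c, s, r, u, v, w}" for x
    using col[of x] that a c s r uvw by (auto simp: verts_G)
  have "{col a, col c, col s} = P"
    using P inP ac as sc by (intro card_seteq) auto
  then have three: "col x = col a \<or> col x = col c \<or> col x = col s" if "x \<in> {a, c, s, r, u, v, w}" for x
    using inP[OF that] by blast
  have "col r = col s"
    using three[of r] ar rc by auto
  have "col v = col a"
    using three[of v] vs vc by auto
  have "col w = col c"
    using three[of w] aw rw \<open>col r = col s\<close> by auto
  show False
    using three[of u] us uw uv' \<open>col v = col a\<close> \<open>col w = col c\<close> by auto
qed

text \<open>The rim would be an odd cycle in the neighbourhood of the hub. For each kind of hub this
  neighbourhood becomes bipartite once the vertices with at most one neighbour in it are discarded,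
  and those lie on no cycle.\<close>

lemma wheel_free_G:
  assumes "2 \<le> k"
  shows "free_of (wheel (2 * k + 2)) G"
proof (rule ccontr)
  assume "\<not> ?thesis"
  then obtain h r where inj: "inj_on r {..<2 * k + 1}"
    and rim: "\<And>i. i < 2 * k + 1 \<Longrightarrow> {r i, r ((i + 1) mod (2 * k + 1))} \<in> edges G"
    and spoke: "\<And>i. i < 2 * k + 1 \<Longrightarrow> {r i, h} \<in> edges G"
    using rim_of_wheel by blast
  define T where "T = r ` {..<2 * k + 1}"
  have hub: "{x, h} \<in> edges G" "{h, x} \<in> edges G" if "x \<in> T" for x
    using that spoke by (auto simp: T_def insert_commute)
  have no_leaf: False if x: "x \<in> T" and z: "\<And>y. y \<in> T \<Longrightarrow> {x, y} \<in> edges G \<Longrightarrow> y = z" for x z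
  proof -
    obtain i where i: "x = r i" "i < 2 * k + 1"
      using x by (auto simp: T_def)
    then obtain a b where "a < 2 * k + 1" "b < 2 * k + 1" "r a \<noteq> r b" "{x, r a} \<in> edges G" "{x, r b} \<in> edges G"
      using rim_vertex_two_neighbours[OF inj _ i(2) rim] assms by auto
    then show False
      using z[of "r a"] z[of "r b"] by (auto simp: T_def)
  qed
  have no_bipartition: False
    if "\<And>x y. x \<in> T \<Longrightarrow> y \<in> T \<Longrightarrow> {x, y} \<in> edges G \<Longrightarrow> (x \<in> A) \<noteq> (y \<in> A)" for A
  proof -
    obtain i where i: "i < 2 * k + 1" "(r i \<in> A) = (r ((i + 1) mod (2 * k + 1)) \<in> A)"
      using odd_cycle_monochromatic by blast
    have "(i + 1) mod (2 * k + 1) < 2 * k + 1"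
      by (rule mod_less_divisor) simp
    then show False
      using that[of "r i" "r ((i + 1) mod (2 * k + 1))"] rim[OF i(1)] i by (auto simp: T_def)
  qed
  have T_V: "x \<in> V1 \<or> x \<in> V2 \<or> x \<in> V3" if "x \<in> T" for x
    using edge_verts[OF hub(1)[OF that]] by (auto simp: verts_G)
  have "r 0 \<in> T"
    by (simp add: T_def)
  then have "h \<in> verts G"
    using edge_verts[OF hub(2)] by blast
  then consider "h = u" | "h = v" | "h \<in> V1" "h \<noteq> u" "h \<noteq> v" | "h \<in> S" | "h \<in> V2" "h \<notin> S"
    | "h = w" | "h \<in> V3" "h \<noteq> w"
    unfolding verts_G by blast
  then show False
  proof cases
    case 1
    have T: "x = w \<or> x = v \<or> x \<in> V2" if "x \<in> T" for x
      using T_V[OF that] hub[OF that] edge_u[of x] edge_within_V1[of u x] uvw 1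
      by (auto simp: doubleton_eq_iff)
    \<comment> \<open>Within the neighbourhood of \<open>u\<close>, a vertex of \<open>V2\<close>
      sees only \<open>v\<close> if it lies in \<open>S\<close> and only \<open>w\<close>
      otherwise.\<close>
    have "x \<notin> V2" if x: "x \<in> T" for x
    proof
      assume "x \<in> V2"
      show False
      proof (rule no_leaf[OF x, of "if x \<in> S then v else w"])
        fix y assume "y \<in> T" "{x, y} \<in> edges G"
        then show "y = (if x \<in> S then v else w)"
          using T[of y] no_edge_within(1)[OF \<open>x \<in> V2\<close>, of y] edge_w[of x] edge_v[of x] \<open>x \<in> V2\<close>
          by (auto simp: insert_commute)
      qed
    qed
    then have T': "x = w \<or> x = v" if "x \<in> T" for x
      using T[OF that] that by blast
    show False
    proof (rule no_bipartition[of "{v}"])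
      fix x y assume xy: "x \<in> T" "y \<in> T" "{x, y} \<in> edges G"
      then have "x \<noteq> y"
        using no_loop by blast
      then show "(x \<in> {v}) \<noteq> (y \<in> {v})"
        using T'[OF xy(1)] T'[OF xy(2)] by blast
    qed
  next
    case 2
    have T: "x \<in> S \<or> x \<in> V3 \<or> x = u" if "x \<in> T" for x
      using T_V[OF that] hub[OF that] edge_v[of x] edge_within_V1[of v x] uvw 2
      by (auto simp: doubleton_eq_iff)
    \<comment> \<open>The neighbourhood of \<open>v\<close> lies in \<open>S\<close>,
      \<open>V3\<close> and \<open>{u}\<close>, so \<open>w\<close> can see only \<open>u\<close>
      there.\<close>
    have "w \<notin> T"
    proof
      assume "w \<in> T"
      then show False
        using T edge_w no_edge_within(2)[of w] uvw by (intro no_leaf[of w u]) blast+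
    qed
    show False
    proof (rule no_bipartition[of S])
      fix x y assume xy: "x \<in> T" "y \<in> T" "{x, y} \<in> edges G"
      have "x \<noteq> w" "y \<noteq> w"
        using xy \<open>w \<notin> T\<close> by auto
      have yx: "{y, x} \<in> edges G"
        using xy(3) by (simp add: insert_commute)
      have "\<not> (x \<in> S \<and> y \<in> S)"
        using xy(3) no_edge_within(1)[of x y] S_V2 by blast
      moreover have "\<not> (x \<notin> S \<and> y \<notin> S)"
        using T[OF xy(1)] T[OF xy(2)] no_edge_within(2)[of x y] edge_u[of y] edge_u[of x] xy(3) yx
          edge_within_V1[of u u] uvw \<open>x \<noteq> w\<close> \<open>y \<noteq> w\<close> by (auto simp: doubleton_eq_iff)
      ultimately show "(x \<in> S) \<noteq> (y \<in> S)"
        by blast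
    qed
  next
    case 3
    have T: "x \<in> V2 \<or> x \<in> V3" if "x \<in> T" for x
      using T_V[OF that] hub[OF that] edge_within_V1[of h x] 3 by (auto simp: doubleton_eq_iff)
    show False
    proof (rule no_bipartition[of V2])
      fix x y assume xy: "x \<in> T" "y \<in> T" "{x, y} \<in> edges G"
      then show "(x \<in> V2) \<noteq> (y \<in> V2)"
        using T[OF xy(1)] T[OF xy(2)] no_edge_within[of x y] by blast
    qed
  next
    case 4
    have hV2: "h \<in> V2"
      using 4 S_V2 by blast
    have T: "x \<in> V1 \<or> x \<in> V3" "x \<noteq> w" if "x \<in> T" for x
      using T_V[OF that] hub[OF that] no_edge_within(1)[OF hV2, of x] edge_w[of h] 4 by auto
    have "u \<notin> T"
    proof
      assume u: "u \<in> T"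
      show False
      proof (rule no_leaf[OF u, of v])
        fix y assume y: "y \<in> T" "{u, y} \<in> edges G"
        then show "y = v"
          using T[OF y(1)] edge_u[of y] edge_within_V1[of u y] uvw by (auto simp: doubleton_eq_iff)
      qed
    qed
    show False
    proof (rule no_bipartition[of V1])
      fix x y assume xy: "x \<in> T" "y \<in> T" "{x, y} \<in> edges G"
      have "\<not> (x \<in> V1 \<and> y \<in> V1)"
        using edge_within_V1[OF xy(3)] xy \<open>u \<notin> T\<close> by (auto simp: doubleton_eq_iff)
      then show "(x \<in> V1) \<noteq> (y \<in> V1)"
        using T(1)[OF xy(1)] T(1)[OF xy(2)] no_edge_within(2)[of x y] xy(3) by blast
    qed
  next
    case 5
    have T: "x \<in> V1 \<or> x \<in> V3" "x \<noteq> v" if "x \<in> T" for x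
      using T_V[OF that] hub[OF that] no_edge_within(1)[OF 5(1), of x] edge_v[of h] 5 by auto
    show False
    proof (rule no_bipartition[of V1])
      fix x y assume xy: "x \<in> T" "y \<in> T" "{x, y} \<in> edges G"
      have "\<not> (x \<in> V1 \<and> y \<in> V1)"
        using edge_within_V1[OF xy(3)] xy T(2) by (auto simp: doubleton_eq_iff)
      then show "(x \<in> V1) \<noteq> (y \<in> V1)"
        using T(1)[OF xy(1)] T(1)[OF xy(2)] no_edge_within(2)[of x y] xy(3) by blast
    qed
  next
    case 6
    have T: "x \<in> V1 \<or> x \<in> V2" "x \<notin> S" if "x \<in> T" for x
      using T_V[OF that] hub[OF that] no_edge_within(2)[of w x] edge_w[of x] uvw 6 by auto
    have "v \<notin> T"
    proof
      assume v: "v \<in> T"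
      show False
      proof (rule no_leaf[OF v, of u])
        fix y assume y: "y \<in> T" "{v, y} \<in> edges G"
        then show "y = u"
          using T[OF y(1)] edge_v[of y] edge_within_V1[of v y] uvw by (auto simp: doubleton_eq_iff)
      qed
    qed
    show False
    proof (rule no_bipartition[of V1])
      fix x y assume xy: "x \<in> T" "y \<in> T" "{x, y} \<in> edges G"
      have "\<not> (x \<in> V1 \<and> y \<in> V1)"
        using edge_within_V1[OF xy(3)] xy \<open>v \<notin> T\<close> by (auto simp: doubleton_eq_iff)
      then show "(x \<in> V1) \<noteq> (y \<in> V1)"
        using T(1)[OF xy(1)] T(1)[OF xy(2)] no_edge_within(1)[of x y] xy(3) by blast
    qed
  next
    case 7
    have T: "x \<in> V1 \<or> x \<in> V2" "x \<noteq> u" if "x \<in> T" for x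
      using T_V[OF that] hub[OF that] no_edge_within(2)[OF 7(1), of x] edge_u[of h] 7 by auto
    show False
    proof (rule no_bipartition[of V1])
      fix x y assume xy: "x \<in> T" "y \<in> T" "{x, y} \<in> edges G"
      have "\<not> (x \<in> V1 \<and> y \<in> V1)"
        using edge_within_V1[OF xy(3)] xy T(2) by (auto simp: doubleton_eq_iff)
      then show "(x \<in> V1) \<noteq> (y \<in> V1)"
        using T(1)[OF xy(1)] T(1)[OF xy(2)] no_edge_within(1)[of x y] xy(3) by blast
    qed
  qed
qed

end

lemma G_family_extremal:
  assumes "G \<in> G_family n" "10 \<le> n" "2 \<le> k"
  shows "G \<in> nonpartite_free_graphs 3 n (wheel (2 * k + 2))" "num_edges G = (n - 1)\<^sup>2 div 3 + 2"
proof -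
  obtain V1 V2 V3 u v w S where G: "G = Gstar V1 V2 V3 u v w S"
    and fin: "finite V1" "finite V2" "finite V3"
    and disj: "V1 \<inter> V2 = {}" "V1 \<inter> V3 = {}" "V2 \<inter> V3 = {}"
    and sum: "card V1 + card V2 + card V3 = n"
    and c1: "int (card V1) = \<lceil>(real n - 1) / 3\<rceil> + 1 \<or> int (card V1) = \<lfloor>(real n - 1) / 3\<rfloor> + 1"
    and c23: "\<bar>int (card V2) - int (card V3)\<bar> \<le> 1"
    and uvw: "u \<in> V1" "v \<in> V1" "u \<noteq> v" "w \<in> V3"
    and S: "S \<subseteq> V2" "1 \<le> card S" "card S \<le> card V2 - 1"
    using assms(1) unfolding G_family_def by blast
  have "S \<noteq> V2"
    using S fin by auto
  moreover have "S \<noteq> {}"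
    using S(2) by auto
  ultimately have "gstar V1 V2 V3 u v w S"
    unfolding gstar_def using fin disj uvw S(1) by (simp add: psubset_eq)
  then interpret gstar V1 V2 V3 u v w S .
  obtain a where a: "card V1 = Suc a"
    using uvw(1) fin(1) by (metis card_gt_0_iff empty_iff gr0_implies_Suc)
  have m: "a + card V2 + card V3 = n - 1"
    using sum a by simp
  have n1: "real n - 1 = real (n - 1)"
    using assms(2) by simp
  have "int a = \<lceil>real (n - 1) / 3\<rceil> \<or> int a = \<lfloor>real (n - 1) / 3\<rfloor>"
    using c1 a unfolding n1 by auto
  note bal = this c23
  show "num_edges G = (n - 1)\<^sup>2 div 3 + 2"
    unfolding \<open>G = _\<close> num_edges_G a using product_of_balanced[OF m bal] by simp
  \<comment> \<open>The order bound 10 provides the vertices outside \<open>{u, v}\<close> in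
    \<open>V1\<close> and outside \<open>{w}\<close> in \<open>V3\<close> that
    \<open>not_3_partite\<close> requires.\<close>
  have "real (n - 1) / 3 \<ge> 3"
    using assms(2) by simp
  then have "3 \<le> \<lfloor>real (n - 1) / 3\<rfloor>"
    by (simp add: le_floor_iff)
  moreover have "\<lfloor>real (n - 1) / 3\<rfloor> \<le> \<lceil>real (n - 1) / 3\<rceil>"
    by (rule floor_le_ceiling)
  ultimately have a3: "3 \<le> a"
    using bal(1) by linarith
  have "3 * \<lceil>real (n - 1) / 3\<rceil> < int n + 2"
    using assms(2) by linarith
  then have "3 * a < n + 2"
    using bal(1) \<open>\<lfloor>real (n - 1) / 3\<rfloor> \<le> \<lceil>real (n - 1) / 3\<rceil>\<close> by linarith
  then have "1 < card V3"
    using m c23 assms(2) by linarith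
  then have "\<not> r_partite 3 G"
    unfolding \<open>G = _\<close> using a a3 by (intro not_3_partite) auto
  moreover have "card (verts G) = n"
    unfolding \<open>G = _\<close> verts_G using fin disj sum by (simp add: card_Un_disjoint Int_Un_distrib2)
  ultimately show "G \<in> nonpartite_free_graphs 3 n (wheel (2 * k + 2))"
    unfolding nonpartite_free_graphs_def \<open>G = _\<close> using simple wheel_free_G[OF assms(3)] by simp
qed

text \<open>This makes the bound attained. The witness takes the floor option for \<open>V1\<close>,
  splits the rest into halves and uses a singleton for \<open>S\<close>.\<close>

lemma G_family_nonempty:
  assumes "10 \<le> n"
  shows "G_family n \<noteq> {}"
proof -
  define a where "a = (n - 1) div 3"
  define b where "b = (n - 1 - a) div 2"
  define V1 V2 V3 where "V1 = {..<a + 1}" and "V2 = {a + 1..<a + 1 + b}" and "V3 = {a + 1 + b..<n}"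
  have ab: "3 \<le> a" "2 \<le> b" "a + 1 + b + 2 \<le> n" "n \<le> a + 1 + 2 * b + 1" "a + 1 + 2 * b \<le> n"
    using assms unfolding a_def b_def by linarith+
  have card: "card V1 = a + 1" "card V2 = b" "card V3 = n - (a + 1 + b)"
    by (auto simp: V1_def V2_def V3_def)
  have "\<lfloor>(real n - 1) / 3\<rfloor> = int a"
  proof -
    have "3 * a \<le> n - 1" "n - 1 < 3 * a + 3"
      unfolding a_def by linarith+
    then show ?thesis
      using assms by (intro floor_unique) auto
  qed
  then have "int (card V1) = \<lceil>(real n - 1) / 3\<rceil> + 1 \<or> int (card V1) = \<lfloor>(real n - 1) / 3\<rfloor> + 1"
    using card by simp
  moreover have "finite V1" "finite V2" "finite V3" "V1 \<inter> V2 = {}" "V1 \<inter> V3 = {}" "V2 \<inter> V3 = {}"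
    by (auto simp: V1_def V2_def V3_def)
  moreover have "card V1 + card V2 + card V3 = n" "\<bar>int (card V2) - int (card V3)\<bar> \<le> 1"
    "1 \<le> card {a + 1}" "card {a + 1} \<le> card V2 - 1"
    unfolding card using ab by auto
  moreover have "0 \<in> V1" "1 \<in> V1" "0 \<noteq> (1 :: nat)" "a + 1 + b \<in> V3" "{a + 1} \<subseteq> V2"
    using ab by (auto simp: V1_def V2_def V3_def)
  ultimately have "Gstar V1 V2 V3 0 1 (a + 1 + b) {a + 1} \<in> G_family n"
    unfolding G_family_def mem_Collect_eq by (intro exI conjI) (rule refl | assumption)+
  then show ?thesis
    by blast
qed

section \<open>The extremal graphs\<close>

text \<open>Because every colour occurs, the colour classes form a partition with exactly three
  members; were no edge inside a class, this would be a 3-partition.\<close>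

lemma monochromatic_edge_if_not_3_partite:
  assumes G: "simple_graph G" "\<not> r_partite 3 G"
    and f: "\<And>x. x \<in> verts G \<Longrightarrow> f x < (3 :: nat)" "\<And>i. i < 3 \<Longrightarrow> \<exists>x\<in>verts G. f x = i"
  shows "\<exists>x\<in>verts G. \<exists>y\<in>verts G. {x, y} \<in> edges G \<and> f x = f y"
proof (rule ccontr)
  assume no: "\<not> ?thesis"
  define C where "C i = {x \<in> verts G. f x = i}" for i
  have ne: "C i \<noteq> {}" if "i < 3" for i
    using f(2)[OF that] by (auto simp: C_def)
  have disj: "C i \<inter> C j = {}" if "i \<noteq> j" for i j
    using that by (auto simp: C_def)
  have "inj_on C {..<3}"
  proof (rule inj_onI)
    fix i j assume "i \<in> {..<3 :: nat}" "C i = C j"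
    then show "i = j"
      using ne[of i] disj[of i j] by auto
  qed
  then have "card (C ` {..<3}) = 3"
    by (simp add: card_image)
  moreover have "partition_on (verts G) (C ` {..<3})"
  proof (rule partition_onI)
    show "\<Union> (C ` {..<3}) = verts G"
      using f(1) by (auto simp: C_def)
    show "disjnt p q" if pq: "p \<in> C ` {..<3}" "q \<in> C ` {..<3}" "p \<noteq> q" for p q
    proof -
      obtain i j where "p = C i" "q = C j" "i \<noteq> j"
        using pq by blast
      then show ?thesis
        using disj[of i j] by (simp add: disjnt_def)
    qed
    show "{} \<notin> C ` {..<3}"
      using ne by auto
  qed
  moreover have "\<not> e \<subseteq> C i" if e: "e \<in> edges G" for e i
  proof
    assume sub: "e \<subseteq> C i"
    have "card e = 2"
      using G(1) e unfolding simple_graph_def by blast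
    then obtain x y where xy: "e = {x, y}"
      by (auto simp: card_2_iff)
    then have "x \<in> C i" "y \<in> C i"
      using sub by auto
    then show False
      using no e[unfolded xy] by (metis (mono_tags, lifting) C_def mem_Collect_eq)
  qed
  ultimately have "r_partite 3 G"
    unfolding r_partite_def by (intro exI[of _ "C ` {..<3}"]) auto
  then show False
    using G(2) by blast
qed

lemma dense_graphs_in_G_family:
  assumes "2 \<le> k"
  shows "\<exists>N. \<forall>n\<ge>N. \<forall>G\<in>nonpartite_free_graphs 3 n (wheel (2 * k + 2)).
    (n - 1)\<^sup>2 div 3 + 2 \<le> num_edges G \<longrightarrow> G \<in> G_family n"
proof -
  \<comment> \<open>Chosen so that \<open>\<eta> * 160000\<close> is 1 / 1000, the limit in
    \<open>near_partition_with_core\<close>; \<open>e\<close> compensates the factor 7 of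
    \<open>near_tripartite_exists\<close>.\<close>
  define \<eta> :: real where "\<eta> = 1 / 160000000"
  define e where "e = \<eta> / 7"
  define slack where "slack = wheel_free.edge_slack k"
  have \<eta>: "0 < \<eta>" "\<eta> * 160000 \<le> 1 / 1000"
    by (simp_all add: \<eta>_def)
  have e: "0 < e" "e \<le> 1 / 100" "7 * e = \<eta>"
    by (simp_all add: e_def \<eta>_def)
  \<comment> \<open>The three terms serve the stability argument, the inequality
    \<open>order_large\<close>, and the error in degree sums over at most four vertices, 16 being
    the square of 4.\<close>
  obtain N :: nat where N: "max (wheel_free.order_bound k e) (max ((real k + 10) / \<eta>) ((16 + slack) / \<eta>)) < real N"
    using reals_Archimedean2 by blast
  show ?thesis
  proof (intro exI[of _ N] allI impI ballI)
    fix n and G :: "nat ugraph"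
    assume n: "N \<le> n" and G: "G \<in> nonpartite_free_graphs 3 n (wheel (2 * k + 2))"
      and many: "(n - 1)\<^sup>2 div 3 + 2 \<le> num_edges G"
    have G': "simple_graph G" "card (verts G) = n" "\<not> r_partite 3 G" "free_of (wheel (2 * k + 2)) G"
      using G by (auto simp: nonpartite_free_graphs_def)
    define V where "V = verts G"
    define adj where "adj x y \<longleftrightarrow> {x, y} \<in> edges G" for x y
    have V: "finite V" "card V = n"
      using G' by (auto simp: V_def simple_graph_def)
    have "real N \<le> real n"
      using n by simp
    then have large: "wheel_free.order_bound k e \<le> n" "(real k + 10) / \<eta> \<le> n" "(16 + slack) / \<eta> \<le> n"
      using N by (simp_all only: max_less_iff_conj) linarith+
    then have large': "real k + 10 \<le> \<eta> * n" "16 + slack \<le> \<eta> * n"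
      using \<eta>(1) by (simp_all add: field_simps)
    interpret wheel_free adj k
      unfolding adj_def by (rule wheel_free_adjacency[OF G'(1,4) assms])
    have E: "edges G = {{x, y} | x y. x \<in> V \<and> y \<in> V \<and> adj x y}"
    proof (intro set_eqI iffI)
      fix e assume e: "e \<in> edges G"
      then have "e \<subseteq> V" "card e = 2"
        using G'(1) unfolding simple_graph_def V_def by blast+
      then obtain x y where "e = {x, y}" "x \<in> V" "y \<in> V"
        by (auto simp: card_2_iff)
      then show "e \<in> {{x, y} | x y. x \<in> V \<and> y \<in> V \<and> adj x y}"
        using e unfolding adj_def by blast
    qed (auto simp: adj_def)
    have "deg_sum V V = 2 * num_edges G"
      unfolding num_edges_def E by (rule deg_sum_eq_card_edges[OF V(1)])
    have "1 \<le> n"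
      using large'(1) \<eta>(1) by (cases n) auto
    have "2 / 3 * real s \<le> 2 * real m" if "s div 3 + 2 \<le> m" for s m :: nat
    proof -
      have "s \<le> 3 * m"
        using that by linarith
      then show ?thesis
        by linarith
    qed
    from this[OF many] have "2 / 3 * real ((n - 1)\<^sup>2) \<le> 2 * real (num_edges G)" .
    moreover have "real ((n - 1)\<^sup>2) = (real (card V) - 1)\<^sup>2"
      using \<open>1 \<le> n\<close> V(2) by (simp add: of_nat_diff)
    ultimately have dense: "2 / 3 * (real (card V) - 1)\<^sup>2 \<le> deg_sum V V"
      using \<open>deg_sum V V = 2 * num_edges G\<close> by simp
    interpret dense_wheel_free adj k V \<eta>
    proof
      show "finite V" "0 < \<eta>"
        by fact+
      show "real k + 10 \<le> \<eta> * card V"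
        unfolding V(2) by (rule large')
      fix U assume U: "U \<subseteq> V" "card U \<le> 4"
      have "(real (card U))\<^sup>2 \<le> 4\<^sup>2"
        using U(2) by (intro power_mono) auto
      then have "(real (card U))\<^sup>2 + edge_slack \<le> \<eta> * card V"
        using large'(2) V(2) by (simp add: slack_def)
      then show "2 / 3 * (real (card U) - 1) * card V - \<eta> * card V \<le> deg_sum U V"
        using deg_sum_lower[OF V(1) U(1) dense] by linarith
    next
      fix f :: "nat \<Rightarrow> nat"
      assume "\<And>x. x \<in> V \<Longrightarrow> f x < 3" "\<And>i. i < 3 \<Longrightarrow> \<exists>x\<in>V. f x = i"
      then show "\<exists>x\<in>V. \<exists>y\<in>V. adj x y \<and> f x = f y"
        using monochromatic_edge_if_not_3_partite[OF G'(1,3)] unfolding V_def adj_def by blast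
    qed
    obtain X P where "near_tripartite \<eta> V X P"
      using near_tripartite_exists[OF V(1) dense e(1,2)] large(1) V(2) e(3) by auto
    then obtain \<eta>' X' P' where near: "near_partition adj k V \<eta> \<eta>' X' P'"
      and core: "near_partition.core_config adj V \<eta>' X' P'"
      using near_partition_with_core \<eta>(2) by blast
    have edge_set: "edge_set = edges G"
      unfolding edge_set_def E ..
    have balanced_Gstar
      using near_partition.core_balanced[OF near _ core] many V(2) by (simp add: edge_set num_edges_def)
    then obtain V1 V2 V3 u v w S where GS: "(V, edge_set) = Gstar V1 V2 V3 u v w S"
      and disj: "V1 \<inter> V2 = {}" "V1 \<inter> V3 = {}" "V2 \<inter> V3 = {}"
      and uvw: "u \<in> V1" "v \<in> V1" "u \<noteq> v" "w \<in> V3" and S: "S \<subset> V2" "S \<noteq> {}"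
      and size: "(card V - 1)\<^sup>2 div 3 \<le> (card V1 - 1) * card V2 + (card V1 - 1) * card V3 + card V2 * card V3"
      unfolding balanced_Gstar_def by blast
    have V123: "V = V1 \<union> V2 \<union> V3"
      using GS by (simp add: Gstar_def)
    then have fin: "finite V1" "finite V2" "finite V3"
      using V(1) by auto
    have sum: "card V1 + card V2 + card V3 = n"
      using V(2) V123 disj fin by (auto simp: card_Un_disjoint Int_Un_distrib2)
    have pos: "0 < card V1"
      using uvw(1) fin(1) by (auto simp: card_gt_0_iff)
    have m: "card V1 - 1 + card V2 + card V3 = n - 1"
      using sum pos by linarith
    note bal = balanced_if_product_large[OF m size[unfolded V(2)]]
    have "real (n - 1) = real n - 1"
      using \<open>1 \<le> n\<close> by simp
    moreover have "int (card V1) = int (card V1 - 1) + 1"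
      using pos by simp
    ultimately have c1: "int (card V1) = \<lceil>(real n - 1) / 3\<rceil> + 1 \<or> int (card V1) = \<lfloor>(real n - 1) / 3\<rfloor> + 1"
      using bal(1) by metis
    have finS: "finite S"
      using S(1) fin(2) finite_subset by blast
    have "1 \<le> card S"
      using S(2) finS by (simp add: Suc_le_eq card_gt_0_iff)
    moreover have "card S \<le> card V2 - 1"
      using psubset_card_mono[OF fin(2) S(1)] by simp
    moreover have "G = Gstar V1 V2 V3 u v w S"
      using GS edge_set unfolding V_def by simp
    ultimately show "G \<in> G_family n"
      unfolding G_family_def mem_Collect_eq
      using fin disj sum c1 bal(2) uvw psubset_imp_subset[OF S(1)] by blast
  qed
qed

lemma graph_iso_refl: "graph_iso G G"
  unfolding graph_iso_def by (intro exI[of _ id]) auto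

theorem theorem1p11:
  fixes k :: nat
  assumes "k \<ge> 2"
  shows "\<exists>N. \<forall>n\<ge>N.
      int (ex4 n (wheel (2 * k + 2)))
        = int (num_edges (turan_graph n 3)) - (int n - \<lceil>real n / 3\<rceil>) + 2
    \<and> int (num_edges (turan_graph n 3)) - (int n - \<lceil>real n / 3\<rceil>) + 2
        = int (num_edges (turan_graph (n - 1) 3)) + 2
    \<and> same_up_to_iso (Ex4 n (wheel (2 * k + 2))) (G_family n)"
proof -
  obtain N where N: "\<And>n G. N \<le> n \<Longrightarrow> G \<in> nonpartite_free_graphs 3 n (wheel (2 * k + 2)) \<Longrightarrow>
      (n - 1)\<^sup>2 div 3 + 2 \<le> num_edges G \<Longrightarrow> G \<in> G_family n"
    using dense_graphs_in_G_family[OF assms] by blast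
  show ?thesis
  proof (intro exI[of _ "max N 10"] allI impI)
    fix n assume "max N 10 \<le> n"
    then have n: "N \<le> n" "10 \<le> n"
      by auto
    define W where "W = wheel (2 * k + 2)"
    define t where "t = (n - 1)\<^sup>2 div 3 + 2"
    have family: "G \<in> nonpartite_free_graphs 3 n W" "num_edges G = t" if "G \<in> G_family n" for G
      using G_family_extremal[OF that n(2) assms] unfolding W_def t_def by auto
    have max_edges: "G \<in> G_family n" if "G \<in> nonpartite_free_graphs 3 n W" "t \<le> num_edges G" for G
      using N[OF n(1)] that unfolding W_def t_def by blast
    have ex: "ex4 n W = t"
      unfolding ex4_def
    proof (rule Max_eqI[OF finite_num_edges_nonpartite_free_graphs])
      show "m \<le> t" if "m \<in> num_edges ` nonpartite_free_graphs 3 n W" for m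
        using that max_edges family(2) by (metis imageE nat_le_linear order_refl)
      show "t \<in> num_edges ` nonpartite_free_graphs 3 n W"
        using G_family_nonempty[OF n(2)] family by blast
    qed
    \<comment> \<open>Both families range over all vertex sets of natural numbers, so they agree as
      sets and reflexivity of isomorphism suffices.\<close>
    have "Ex4 n W = G_family n"
    proof
      show "Ex4 n W \<subseteq> G_family n"
        unfolding Ex4_def ex using max_edges by (blast intro: eq_refl[OF sym])
      show "G_family n \<subseteq> Ex4 n W"
        unfolding Ex4_def ex using family by blast
    qed
    then have "same_up_to_iso (Ex4 n W) (G_family n)"
      unfolding same_up_to_iso_def using graph_iso_refl by auto
    moreover have "int (num_edges (turan_graph n 3)) - (int n - \<lceil>real n / 3\<rceil>) = int ((n - 1)\<^sup>2 div 3)"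
      unfolding num_edges_turan_graph using turan_edge_difference[of n] n(2) by simp
    moreover have "int (ex4 n W) = int ((n - 1)\<^sup>2 div 3) + 2"
      unfolding ex t_def by simp
    ultimately show "int (ex4 n (wheel (2 * k + 2))) = int (num_edges (turan_graph n 3)) - (int n - \<lceil>real n / 3\<rceil>) + 2
      \<and> int (num_edges (turan_graph n 3)) - (int n - \<lceil>real n / 3\<rceil>) + 2 = int (num_edges (turan_graph (n - 1) 3)) + 2
      \<and> same_up_to_iso (Ex4 n (wheel (2 * k + 2))) (G_family n)"
      unfolding W_def num_edges_turan_graph by simp
  qed
qed

end
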